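(* Let $N\in\mathbb N$, $\alpha\in(0,N)$ and $p\in(1,\infty)$. A sequence $(u_n)_{n\in\mathbb N}$ in $E^{\alpha,p}(\mathbb R^N)$ converges weakly to $u\in E^{\alpha,p}(\mathbb R^N)$ if and only if it is bounded in $E^{\alpha,p}(\mathbb R^N)$ and converges to $u$ strongly in $L^1_{\mathrm{loc}}(\mathbb R^N)$.
   Context: $\mathbb N$ denotes the positive integers. For $\alpha\in(0,N)$ the Riesz potential is $I_\alpha(x)=A_\alpha|x|^{-(N-\alpha)}$ for $x\in\mathbb R^N\setminus\{0\}$, with $A_\alpha=\frac{\Gamma((N-\alpha)/2)}{\Gamma(\alpha/2)\pi^{N/2}2^\alpha}$. For $p\ge1$, the Coulomb--Sobolev space $E^{\alpha,p}(\mathbb R^N)$ is the vector space of (a.e. classes of) measurable functions $u:\mathbb R^N\to\mathbb R$ with $\int_{\mathbb R^N}|I_{\alpha/2}*|u|^p|^2<\infty$ that are weakly differentiable with $Du\in L^2(\mathbb R^N)$, normed by $$\|u\|_{E^{\alpha,p}}=\Bigl(\int_{\mathbb R^N}|Du|^2+\Bigl(\int_{\mathbb R^N}\bigl|I_{\alpha/2}*|u|^p\bigr|^2\Bigr)^{1/p}\Bigr)^{1/2}.$$ It is a Banach space. *)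

theory Defs
  imports "HOL-Analysis.Analysis"
begin

text \<open>Euclidean space of dimension N is \<open>real ^ 'n\<close> with \<open>N = CARD('n)\<close>. Elements of the function
  spaces below are Lebesgue measurable representatives; functions that agree almost everywhere are
  at distance zero for \<open>coulomb_sobolev_norm\<close>.\<close>

section \<open>Riesz potentials\<close>

definition riesz_const :: "nat \<Rightarrow> real \<Rightarrow> real" where
  "riesz_const N \<alpha> =
     Gamma ((real N - \<alpha>) / 2) / (Gamma (\<alpha> / 2) * pi powr (real N / 2) * 2 powr \<alpha>)"

text \<open>The value at the origin is the irrelevant \<open>0\<close>, by the convention for \<open>0 powr a\<close>.\<close>

definition riesz_kernel :: "real \<Rightarrow> real ^ 'n \<Rightarrow> real" where
  "riesz_kernel \<alpha> x = riesz_const CARD('n) \<alpha> * norm x powr (- (real CARD('n) - \<alpha>))"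

text \<open>Convolution of the Riesz kernel with a nonnegative function, with values in \<open>[0, \<infinity>]\<close>.\<close>

definition riesz_potential :: "real \<Rightarrow> (real ^ 'n \<Rightarrow> real) \<Rightarrow> real ^ 'n \<Rightarrow> ennreal" where
  "riesz_potential \<alpha> f x = (\<integral>\<^sup>+ y. ennreal (riesz_kernel \<alpha> (x - y) * f y) \<partial>lebesgue)"

definition coulomb_energy :: "real \<Rightarrow> real \<Rightarrow> (real ^ 'n \<Rightarrow> real) \<Rightarrow> ennreal" where
  "coulomb_energy \<alpha> p u =
     (\<integral>\<^sup>+ x. (riesz_potential (\<alpha> / 2) (\<lambda>y. \<bar>u y\<bar> powr p) x) ^ 2 \<partial>lebesgue)"

section \<open>Weak derivatives\<close>

definition partial_deriv :: "'n \<Rightarrow> (real ^ 'n \<Rightarrow> real) \<Rightarrow> real ^ 'n \<Rightarrow> real" where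
  "partial_deriv i f x = frechet_derivative f (at x) (axis i 1)"

primrec C_k :: "nat \<Rightarrow> (real ^ 'n \<Rightarrow> real) \<Rightarrow> bool" where
  "C_k 0 f \<longleftrightarrow> continuous_on UNIV f"
| "C_k (Suc k) f \<longleftrightarrow> (\<forall>x. f differentiable (at x)) \<and> (\<forall>i. C_k k (partial_deriv i f))"

definition test_function :: "(real ^ 'n \<Rightarrow> real) \<Rightarrow> bool" where
  "test_function \<phi> \<longleftrightarrow> (\<forall>k. C_k k \<phi>) \<and> compact (closure {x. \<phi> x \<noteq> 0})"

definition locally_integrable :: "(real ^ 'n \<Rightarrow> 'b::{banach, second_countable_topology}) \<Rightarrow> bool" where
  "locally_integrable f \<longleftrightarrow> (\<forall>K. compact K \<longrightarrow> set_integrable lebesgue K f)"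

definition has_weak_gradient :: "(real ^ 'n \<Rightarrow> real) \<Rightarrow> (real ^ 'n \<Rightarrow> real ^ 'n) \<Rightarrow> bool" where
  "has_weak_gradient u g \<longleftrightarrow>
     locally_integrable u \<and> locally_integrable g \<and>
     (\<forall>\<phi> i. test_function \<phi> \<longrightarrow>
        (\<integral>x. u x * partial_deriv i \<phi> x \<partial>lebesgue) = - (\<integral>x. g x $ i * \<phi> x \<partial>lebesgue))"

definition weakly_differentiable :: "(real ^ 'n \<Rightarrow> real) \<Rightarrow> bool" where
  "weakly_differentiable u \<longleftrightarrow> (\<exists>g. has_weak_gradient u g)"

text \<open>A weak gradient is unique up to a null set, so this choice does not affect integrals.\<close>

definition weak_gradient :: "(real ^ 'n \<Rightarrow> real) \<Rightarrow> real ^ 'n \<Rightarrow> real ^ 'n" where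
  "weak_gradient u = (SOME g. has_weak_gradient u g)"

definition dirichlet_energy :: "(real ^ 'n \<Rightarrow> real) \<Rightarrow> ennreal" where
  "dirichlet_energy u = (\<integral>\<^sup>+ x. ennreal ((norm (weak_gradient u x))\<^sup>2) \<partial>lebesgue)"

section \<open>The Coulomb--Sobolev space\<close>

definition coulomb_sobolev :: "real \<Rightarrow> real \<Rightarrow> (real ^ 'n \<Rightarrow> real) set" where
  "coulomb_sobolev \<alpha> p =
     {u. u \<in> borel_measurable lebesgue \<and> coulomb_energy \<alpha> p u < \<infinity> \<and>
         weakly_differentiable u \<and> dirichlet_energy u < \<infinity>}"

definition coulomb_sobolev_norm :: "real \<Rightarrow> real \<Rightarrow> (real ^ 'n \<Rightarrow> real) \<Rightarrow> real" where
  "coulomb_sobolev_norm \<alpha> p u =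
     sqrt (enn2real (dirichlet_energy u) + enn2real (coulomb_energy \<alpha> p u) powr (1 / p))"

text \<open>Continuous linear functionals. The bound by the norm forces equal values on functions that
  agree almost everywhere, so these are exactly the functionals on the space of classes; values
  outside \<open>coulomb_sobolev \<alpha> p\<close> are unconstrained and never used.\<close>

definition coulomb_sobolev_dual ::
    "real \<Rightarrow> real \<Rightarrow> ((real ^ 'n \<Rightarrow> real) \<Rightarrow> real) set" where
  "coulomb_sobolev_dual \<alpha> p =
     {L. (\<forall>v\<in>coulomb_sobolev \<alpha> p. \<forall>w\<in>coulomb_sobolev \<alpha> p. L (\<lambda>x. v x + w x) = L v + L w) \<and>
         (\<forall>c. \<forall>v\<in>coulomb_sobolev \<alpha> p. L (\<lambda>x. c * v x) = c * L v) \<and>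
         (\<exists>C. \<forall>v\<in>coulomb_sobolev \<alpha> p. \<bar>L v\<bar> \<le> C * coulomb_sobolev_norm \<alpha> p v)}"

definition coulomb_sobolev_weakly_converges ::
    "real \<Rightarrow> real \<Rightarrow> (nat \<Rightarrow> real ^ 'n \<Rightarrow> real) \<Rightarrow> (real ^ 'n \<Rightarrow> real) \<Rightarrow> bool" where
  "coulomb_sobolev_weakly_converges \<alpha> p u v \<longleftrightarrow>
     (\<forall>L\<in>coulomb_sobolev_dual \<alpha> p. (\<lambda>k. L (u k)) \<longlonglongrightarrow> L v)"

definition coulomb_sobolev_bounded :: "real \<Rightarrow> real \<Rightarrow> (nat \<Rightarrow> real ^ 'n \<Rightarrow> real) \<Rightarrow> bool" where
  "coulomb_sobolev_bounded \<alpha> p u \<longleftrightarrow> (\<exists>C. \<forall>k. coulomb_sobolev_norm \<alpha> p (u k) \<le> C)"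

definition converges_L1_loc :: "(nat \<Rightarrow> real ^ 'n \<Rightarrow> real) \<Rightarrow> (real ^ 'n \<Rightarrow> real) \<Rightarrow> bool" where
  "converges_L1_loc u v \<longleftrightarrow>
     (\<forall>K. compact K \<longrightarrow> (\<lambda>k. \<integral>\<^sup>+ x\<in>K. ennreal \<bar>u k x - v x\<bar> \<partial>lebesgue) \<longlonglongrightarrow> 0)"

end

theory Submission
  imports Defs
begin

text \<open>
  Bounded sequences that converge in \<open>L\<^sup>1\<^sub>l\<^sub>o\<^sub>c\<close> converge weakly because the space is uniformly
  convex. This is exploited for the sum \<open>F\<close> of the Dirichlet energy and the Coulomb energy, without
  the roots that the norm contains. The pointwise inequality
  \<open>\<bar>a - b\<bar>\<^sup>p \<le> \<epsilon> (\<bar>a\<bar>\<^sup>p + \<bar>b\<bar>\<^sup>p) + C ((\<bar>a\<bar>\<^sup>p + \<bar>b\<bar>\<^sup>p) / 2 - \<bar>(a + b) / 2\<bar>\<^sup>p)\<close>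
  (\<open>powr_uniform_convexity\<close>), integrated against the Riesz kernel and squared, shows that
  \<open>F (u - v)\<close> is small when \<open>F u\<close> and \<open>F v\<close> are bounded and \<open>F\<close> has a small convexity defect at
  \<open>u\<close>, \<open>v\<close> (\<open>total_energy_uniform_convexity\<close>). Suppose that \<open>w n\<close> is bounded and null in
  \<open>L\<^sup>1\<^sub>l\<^sub>o\<^sub>c\<close>, but \<open>L (w n) \<ge> \<epsilon>\<close> infinitely often for a functional \<open>L\<close>. Choose almost minimizers
  \<open>z k\<close> of \<open>F\<close> on the decreasing convex sets where \<open>L \<ge> \<epsilon>\<close> and where the local \<open>L\<^sup>1\<close> norms are at
  most the suprema of those of \<open>w n\<close>, \<open>n \<ge> k\<close>. They form a Cauchy sequence for \<open>F\<close> that is null in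
  \<open>L\<^sup>1\<^sub>l\<^sub>o\<^sub>c\<close>. Lower semicontinuity of \<open>F\<close> forces \<open>F (z k)\<close> to tend to zero
  (\<open>energy_Cauchy_L1_loc_null_imp_energy_null\<close>), whereas \<open>L (z k) \<ge> \<epsilon>\<close>: a contradiction
  (\<open>dual_eventually_less\<close>).

  Conversely, weakly convergent sequences are bounded by a gliding hump argument
  (\<open>gliding_hump\<close>). Its input is, for every vector, a functional that norms it up to a constant; the
  derivatives of the Dirichlet energy and of the Coulomb energy are such functionals
  (\<open>gradient_norming_functional\<close>, \<open>coulomb_norming_functional\<close>). Local convergence then follows as
  in Rellich's theorem. The local \<open>L\<^sup>1\<close> distance between \<open>w\<close> and its averages over balls of radius
  \<open>\<epsilon>\<close> is at most \<open>2 \<epsilon>\<close> times the \<open>L\<^sup>1\<close> norm of the gradient on a larger ball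
  (\<open>ball_average_estimate\<close>), uniformly along a bounded sequence. For fixed \<open>\<epsilon>\<close> the averages are
  continuous functionals of \<open>w\<close>, which tend to zero along a weakly null sequence
  (\<open>ball_averages_tendsto_0\<close>).

  Both directions rest on the abundance of test functions: every bounded measurable function of
  bounded support is an almost everywhere limit of uniformly bounded test functions
  (\<open>bounded_measurable_approx_test_functions\<close>). This gives the uniqueness of weak gradients, the
  density of test functions in \<open>L\<^sup>2\<close>, and the duality by which translations are estimated.
\<close>

section \<open>Calculus of smooth functions\<close>

lemma partial_deriv_eq:
  assumes "(f has_derivative f') (at x)"
  shows "partial_deriv i f x = f' (axis i 1)"
  using frechet_derivative_at[OF assms] by (simp add: partial_deriv_def)

lemma C_k_SucI:
  assumes "\<And>x. (f has_derivative f' x) (at x)" and "\<And>i. C_k k (\<lambda>x. f' x (axis i 1))"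
  shows "C_k (Suc k) f"
proof -
  have "partial_deriv i f = (\<lambda>x. f' x (axis i 1))" for i
    using partial_deriv_eq[OF assms(1)] by (intro ext)
  then show ?thesis
    using assms by (auto simp: differentiable_def)
qed

lemma C_k_differentiable: "C_k (Suc k) f \<Longrightarrow> f differentiable (at x)"
  by simp

lemma C_k_has_derivative:
  "C_k (Suc k) f \<Longrightarrow> (f has_derivative frechet_derivative f (at x)) (at x)"
  using C_k_differentiable frechet_derivative_works by blast

lemma C_k_SucD: "C_k (Suc k) f \<Longrightarrow> C_k k f"
proof (induction k arbitrary: f)
  case 0
  then show ?case
    by (auto simp: continuous_on_eq_continuous_within intro: differentiable_imp_continuous_within)
next
  case (Suc k)
  then show ?case by auto
qed

lemma C_k_continuous_on: "C_k k f \<Longrightarrow> continuous_on UNIV f"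
  by (induction k) (use C_k_SucD in auto)

lemma C_k_const [simp]: "C_k k (\<lambda>x. c)"
proof (induction k arbitrary: c)
  case (Suc k)
  show ?case by (rule C_k_SucI[where f'="\<lambda>x h. 0"]) (use Suc in auto)
qed auto

lemma C_k_add: "C_k k f \<Longrightarrow> C_k k g \<Longrightarrow> C_k k (\<lambda>x. f x + g x)"
proof (induction k arbitrary: f g)
  case 0
  then show ?case by (auto intro: continuous_intros)
next
  case (Suc k)
  show ?case
  proof (rule C_k_SucI)
    show "((\<lambda>x. f x + g x) has_derivative (\<lambda>h. frechet_derivative f (at x) h
        + frechet_derivative g (at x) h)) (at x)" for x
      using Suc.prems by (intro has_derivative_add C_k_has_derivative)
    show "C_k k (\<lambda>x. frechet_derivative f (at x) (axis i 1)
        + frechet_derivative g (at x) (axis i 1))" for i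
      using Suc.prems by (intro Suc.IH) (auto simp: partial_deriv_def[abs_def])
  qed
qed

lemma C_k_mult: "C_k k f \<Longrightarrow> C_k k g \<Longrightarrow> C_k k (\<lambda>x. f x * g x)"
proof (induction k arbitrary: f g)
  case 0
  then show ?case by (auto intro: continuous_intros)
next
  case (Suc k)
  show ?case
  proof (rule C_k_SucI)
    show "((\<lambda>x. f x * g x) has_derivative (\<lambda>h. f x * frechet_derivative g (at x) h
        + frechet_derivative f (at x) h * g x)) (at x)" for x
      using Suc.prems by (intro has_derivative_mult C_k_has_derivative)
    show "C_k k (\<lambda>x. f x * frechet_derivative g (at x) (axis i 1)
        + frechet_derivative f (at x) (axis i 1) * g x)" for i
      using Suc.prems C_k_SucD[OF Suc.prems(1)] C_k_SucD[OF Suc.prems(2)]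
      by (intro C_k_add Suc.IH) (auto simp: partial_deriv_def[abs_def])
  qed
qed

lemma C_k_bounded_linear: "bounded_linear f \<Longrightarrow> C_k k f"
proof (cases k)
  case 0
  assume "bounded_linear f"
  then show ?thesis using 0 by (auto simp: linear_continuous_on)
next
  case (Suc m)
  assume f: "bounded_linear f"
  show ?thesis unfolding Suc
    by (rule C_k_SucI[where f'="\<lambda>x. f"]) (use f in \<open>auto intro: bounded_linear_imp_has_derivative\<close>)
qed

lemma C_k_real_polynomial_function: "real_polynomial_function f \<Longrightarrow> C_k k f"
  by (induction rule: real_polynomial_function.induct)
     (auto intro: C_k_add C_k_mult C_k_bounded_linear)

lemma C_k_translate: "C_k k f \<Longrightarrow> C_k k (\<lambda>x. f (x - a))"
proof (induction k arbitrary: f)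
  case 0
  then show ?case
    by (auto intro!: continuous_on_compose2[of UNIV f] continuous_intros)
next
  case (Suc k)
  show ?case
  proof (rule C_k_SucI)
    fix x
    have "((\<lambda>x. x - a) has_derivative (\<lambda>h. h)) (at x)"
      by (auto intro!: derivative_eq_intros)
    from has_derivative_compose[OF this C_k_has_derivative[OF Suc.prems]]
    show "((\<lambda>x. f (x - a)) has_derivative (\<lambda>h. frechet_derivative f (at (x - a)) h)) (at x)" .
  next
    fix i
    show "C_k k (\<lambda>x. frechet_derivative f (at (x - a)) (axis i 1))"
      using Suc.IH[of "partial_deriv i f"] Suc.prems by (simp add: partial_deriv_def[abs_def])
  qed
qed

section \<open>A smooth bump function\<close>

text \<open>All derivatives of \<open>exp (-1/t)\<close> are products of a polynomial in \<open>1/t\<close> with \<open>exp (-1/t)\<close>;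
  carrying the polynomial as a parameter makes the family closed under differentiation.\<close>

definition flat_exp :: "real poly \<Rightarrow> real \<Rightarrow> real" where
  "flat_exp P t = (if t \<le> 0 then 0 else poly P (1 / t) * exp (- (1 / t)))"

lemma poly_times_exp_minus_tendsto_0: "((\<lambda>s. poly P s * exp (- s)) \<longlongrightarrow> (0::real)) at_top"
proof -
  have "((\<lambda>s. \<Sum>i\<le>degree P. coeff P i * (s ^ i / exp s)) \<longlongrightarrow> (\<Sum>i\<le>degree P. coeff P i * 0)) at_top"
    by (intro tendsto_intros tendsto_power_div_exp_0)
  then show ?thesis
    by (simp add: poly_altdef exp_minus sum_distrib_right divide_inverse mult.assoc)
qed

lemma flat_exp_has_derivative:
  "(flat_exp P has_real_derivative flat_exp ([:0, 0, 1:] * (P - pderiv P)) t) (at t)"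
proof -
  consider "t < 0" | "t > 0" | "t = 0" by linarith
  then show ?thesis
  proof cases
    case 1
    have "((\<lambda>t. 0) has_real_derivative 0) (at t)" by simp
    then have "(flat_exp P has_real_derivative 0) (at t)"
      by (rule DERIV_cong_ev[THEN iffD1, rotated -1])
         (use 1 eventually_nhds_in_open[of "{..<0}" t] in \<open>auto simp: flat_exp_def elim!:
             eventually_mono\<close>)
    then show ?thesis using 1 by (simp add: flat_exp_def)
  next
    case 2
    have "((\<lambda>t. poly P (1 / t) * exp (- (1 / t))) has_real_derivative
       (poly (pderiv P) (1 / t) * (- (1 / t\<^sup>2))) * exp (- (1/t))
           + poly P (1/t) * (exp (- (1/t)) * (1 / t\<^sup>2))) (at t)"
      using 2 by (auto intro!: derivative_eq_intros DERIV_chain2[OF poly_DERIV]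
          simp: power2_eq_square divide_simps)
    also have "(poly (pderiv P) (1 / t) * (- (1 / t\<^sup>2))) * exp (- (1/t))
        + poly P (1/t) * (exp (- (1/t)) * (1 / t\<^sup>2))
       = flat_exp ([:0, 0, 1:] * (P - pderiv P)) t"
      using 2 by (simp add: flat_exp_def field_simps power2_eq_square)
    finally show ?thesis
      by (rule DERIV_cong_ev[THEN iffD1, rotated -1])
         (use 2 eventually_nhds_in_open[of "{0<..}" t] in \<open>auto simp: flat_exp_def elim!:
             eventually_mono\<close>)
  next
    case 3
    have "((\<lambda>h. flat_exp P h / h) \<longlongrightarrow> 0) (at 0)"
    proof (rule filterlim_split_at)
      show "((\<lambda>h. flat_exp P h / h) \<longlongrightarrow> 0) (at_left 0)"
        by (rule tendsto_eventually) (auto simp: flat_exp_def eventually_at_filter)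
      have "((\<lambda>h. poly ([:0,1:] * P) (inverse h) * exp (- inverse h)) \<longlongrightarrow> 0) (at_right 0)"
        by (rule filterlim_compose[OF poly_times_exp_minus_tendsto_0 filterlim_inverse_at_top_right])
      then show "((\<lambda>h. flat_exp P h / h) \<longlongrightarrow> 0) (at_right 0)"
        by (rule Lim_transform_eventually)
           (auto simp: flat_exp_def eventually_at_filter divide_inverse ac_simps)
    qed
    then show ?thesis using 3 by (simp add: DERIV_def flat_exp_def)
  qed
qed

lemma C_k_flat_exp_compose:
  assumes "\<And>k. C_k k r"
  shows "C_k k (\<lambda>x. flat_exp P (r x))"
proof (induction k arbitrary: P)
  case 0
  have "isCont (flat_exp P) t" for t
    using flat_exp_has_derivative DERIV_isCont by blast
  then have "continuous_on UNIV (flat_exp P)"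
    by (simp add: continuous_on_eq_continuous_at)
  then show ?case
    using C_k_continuous_on[OF assms]
    by (auto intro: continuous_on_compose2[of UNIV "flat_exp P"])
next
  case (Suc k)
  let ?P = "[:0, 0, 1:] * (P - pderiv P)"
  show ?case
  proof (rule C_k_SucI)
    fix x
    have "(flat_exp P has_derivative (\<lambda>h. flat_exp ?P (r x) * h)) (at (r x))"
      using flat_exp_has_derivative has_field_derivative_def by blast
    from has_derivative_compose[OF C_k_has_derivative[OF assms] this]
    show "((\<lambda>x. flat_exp P (r x)) has_derivative
       (\<lambda>h. flat_exp ?P (r x) * frechet_derivative r (at x) h)) (at x)" .
    show "C_k k (\<lambda>x. flat_exp ?P (r x) * frechet_derivative r (at x) (axis i 1))" for i
      using assms[of "Suc k"] by (intro C_k_mult Suc) (simp add: partial_deriv_def[abs_def])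
  qed
qed

definition smooth_bump :: "real \<Rightarrow> real ^ 'n \<Rightarrow> real" where
  "smooth_bump R x = flat_exp 1 (R\<^sup>2 - (norm x)\<^sup>2)"

lemma C_k_smooth_bump: "C_k k (smooth_bump R)"
proof -
  have "real_polynomial_function (\<lambda>x::real^'a. \<Sum>i\<in>UNIV. x $ i * x $ i)"
    by (intro real_polynomial_function_sum real_polynomial_function.intros bounded_linear_vec_nth) auto
  then have "real_polynomial_function (\<lambda>x::real^'a. R\<^sup>2 + (-1) * (\<Sum>i\<in>UNIV. x $ i * x $ i))"
    by (intro real_polynomial_function.intros(2-4))
  also have "(\<lambda>x::real^'a. R\<^sup>2 + (-1) * (\<Sum>i\<in>UNIV. x $ i * x $ i)) = (\<lambda>x. R\<^sup>2 - (norm x)\<^sup>2)"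
    by (auto simp: power2_norm_eq_inner inner_vec_def)
  finally have "C_k k (\<lambda>x::real^'a. R\<^sup>2 - (norm x)\<^sup>2)" for k
    by (rule C_k_real_polynomial_function)
  from C_k_flat_exp_compose[OF this] show ?thesis
    by (simp add: smooth_bump_def[abs_def])
qed

lemma smooth_bump_bounds: "0 \<le> smooth_bump R x" "smooth_bump R x \<le> 1"
  by (auto simp: smooth_bump_def flat_exp_def)

lemma smooth_bump_eq_0: "0 \<le> R \<Longrightarrow> R \<le> norm x \<Longrightarrow> smooth_bump R x = 0"
  using power_mono[of R "norm x" 2] by (auto simp: smooth_bump_def flat_exp_def)

lemma smooth_bump_ge:
  assumes "0 \<le> r" "r < R" "norm x \<le> r"
  shows "exp (- (1 / (R\<^sup>2 - r\<^sup>2))) \<le> smooth_bump R x"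
proof -
  have 1: "r\<^sup>2 < R\<^sup>2" "(norm x)\<^sup>2 \<le> r\<^sup>2"
    using assms by (auto intro: power_strict_mono power_mono)
  then have "1 / (R\<^sup>2 - (norm x)\<^sup>2) \<le> 1 / (R\<^sup>2 - r\<^sup>2)"
    by (intro divide_left_mono) auto
  then show ?thesis using 1 by (auto simp: smooth_bump_def flat_exp_def)
qed

lemma test_functionI:
  fixes \<phi> :: "real ^ 'n \<Rightarrow> real"
  assumes "\<And>k. C_k k \<phi>" "\<And>x. \<phi> x \<noteq> 0 \<Longrightarrow> norm x \<le> R"
  shows "test_function \<phi>"
proof -
  have "closure {x. \<phi> x \<noteq> 0} \<subseteq> cball 0 R"
    by (rule closure_minimal) (use assms(2) in auto)
  then have "compact (closure {x. \<phi> x \<noteq> 0})"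
    by (meson bounded_cball bounded_subset closed_closure compact_eq_bounded_closed)
  then show ?thesis using assms(1) by (auto simp: test_function_def)
qed

section \<open>Approximation by test functions\<close>

text \<open>Dividing by a bump, approximating the quotient by a polynomial (Stone--Weierstrass) and
  multiplying by the bump again produces a smooth function with the right support.
  The quotient stays continuous because \<open>\<psi>\<close> lives where the bump is bounded below.\<close>

lemma continuous_approx_test_function:
  fixes \<psi> :: "real ^ 'n \<Rightarrow> real"
  assumes \<psi>: "continuous_on UNIV \<psi>" "\<And>x. norm x > R + 1/2 \<Longrightarrow> \<psi> x = 0" and R: "0 \<le> R" and e: "0 < e"
  obtains \<phi> where "test_function \<phi>" "\<And>x. \<bar>\<phi> x - \<psi> x\<bar> \<le> e" "\<And>x. norm x > R + 1 \<Longrightarrow> \<phi> x = 0"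
proof -
  let ?b = "smooth_bump (R + 1) :: real^'n \<Rightarrow> real"
  define \<beta> where "\<beta> = exp (- (1 / ((R+1)\<^sup>2 - (R+1/2)\<^sup>2)))"
  have \<beta>: "\<beta> > 0" by (simp add: \<beta>_def)
  have b: "continuous_on UNIV ?b" using C_k_smooth_bump C_k_continuous_on by blast
  \<comment> \<open>\<open>\<beta>\<close> is a lower bound of the bump on the support of \<open>\<psi>\<close>, so the maximum only matters where \<open>\<psi> = 0\<close>.\<close>
  define f where "f = (\<lambda>x. \<psi> x / max (?b x) \<beta>)"
  have "max (?b x) \<beta> \<noteq> 0" for x using \<beta> by (auto simp: max_def)
  then have "continuous_on UNIV f"
    unfolding f_def by (intro continuous_intros \<psi> b) auto
  then have "continuous_on (cball 0 (R+1)) f" by (rule continuous_on_subset) auto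
  then obtain q where q: "real_polynomial_function q" "\<And>x. x \<in> cball 0 (R+1) \<Longrightarrow> \<bar>f x - q x\<bar> < e"
    using Stone_Weierstrass_real_polynomial_function[OF compact_cball _ e] by blast
  have bf: "?b x * f x = \<psi> x" for x
  proof (cases "norm x > R + 1/2")
    case True
    then show ?thesis using \<psi> by (simp add: f_def)
  next
    case False
    then have "\<beta> \<le> ?b x"
      unfolding \<beta>_def using R by (intro smooth_bump_ge) auto
    then show ?thesis using \<beta> by (simp add: f_def max_def)
  qed
  let ?\<phi> = "\<lambda>x. ?b x * q x"
  show thesis
  proof
    show "test_function ?\<phi>"
    proof (rule test_functionI)
      show "C_k k ?\<phi>" for k
        using C_k_smooth_bump C_k_real_polynomial_function[OF q(1)] by (intro C_k_mult) auto
      show "norm x \<le> R + 1" if "?\<phi> x \<noteq> 0" for x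
        using that smooth_bump_eq_0[of "R+1" x] R by force
    qed
    show "?\<phi> x = 0" if "norm x > R + 1" for x
      using that smooth_bump_eq_0[of "R+1" x] R by force
    show "\<bar>?\<phi> x - \<psi> x\<bar> \<le> e" for x
    proof (cases "norm x \<le> R + 1")
      case True
      have "\<bar>?\<phi> x - \<psi> x\<bar> = ?b x * \<bar>f x - q x\<bar>"
        unfolding bf[symmetric] right_diff_distrib[symmetric] abs_mult
        using smooth_bump_bounds[of "R+1" x] by (simp add: abs_minus_commute)
      also have "\<dots> \<le> 1 * e"
        using smooth_bump_bounds[of "R+1" x] q(2)[of x] True
            by (intro mult_mono) (auto intro: less_imp_le)
      finally show ?thesis by simp
    next
      case False
      then show ?thesis using \<psi>(2)[of x] smooth_bump_eq_0[of "R+1" x] R e by auto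
    qed
  qed
qed

text \<open>Lebesgue measurable functions are almost everywhere limits of continuous functions; truncation to
  \<open>[-M, M]\<close> and a continuous cutoff keep the limit, and each term is then replaced by a nearby
  test function. The bound \<open>M + 1\<close> leaves room for the last step.\<close>

lemma bounded_measurable_approx_test_functions:
  fixes s :: "real ^ 'n \<Rightarrow> real"
  assumes s: "s \<in> borel_measurable lebesgue" and M: "\<And>x. \<bar>s x\<bar> \<le> M"
    and supp: "\<And>x. norm x > R \<Longrightarrow> s x = 0" and R: "0 \<le> R"
  obtains \<phi> :: "nat \<Rightarrow> real ^ 'n \<Rightarrow> real" where
    "\<And>n. test_function (\<phi> n)" "\<And>n x. \<bar>\<phi> n x\<bar> \<le> M + 1"
    "\<And>n x. norm x > R + 1 \<Longrightarrow> \<phi> n x = 0" "AE x in lebesgue. (\<lambda>n. \<phi> n x) \<longlonglongrightarrow> s x"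
proof -
  have M0: "M \<ge> 0" using M[of 0] by linarith
  obtain N g where N: "negligible N" and g: "\<And>n. continuous_on UNIV (g n)"
    and lim: "\<And>x. x \<notin> N \<Longrightarrow> (\<lambda>n::nat. g n x) \<longlonglongrightarrow> s x"
    using lebesgue_measurable_imp_measurable_on[OF s, of UNIV] unfolding measurable_on_def by auto
  define cut :: "real^'n \<Rightarrow> real" where "cut x = max 0 (min 1 (1 + 2 * (R - norm x)))" for x
  define \<psi> where "\<psi> n x = cut x * max (- M) (min M (g n x))" for n x
  have \<psi>c: "continuous_on UNIV (\<psi> n)" for n
    unfolding \<psi>_def cut_def by (intro continuous_intros g)
  have \<psi>0: "\<psi> n x = 0" if "norm x > R + 1/2" for n x
    using that by (simp add: \<psi>_def cut_def)
  have \<psi>M: "\<bar>\<psi> n x\<bar> \<le> M" for n x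
  proof -
    have "\<bar>\<psi> n x\<bar> \<le> 1 * M"
      unfolding \<psi>_def abs_mult by (intro mult_mono) (use M0 in \<open>auto simp: cut_def\<close>)
    then show ?thesis by simp
  qed
  have "\<exists>\<phi>. test_function \<phi> \<and> (\<forall>x. \<bar>\<phi> x - \<psi> n x\<bar>
      \<le> inverse (real (Suc n))) \<and> (\<forall>x. norm x > R + 1 \<longrightarrow> \<phi> x = 0)" for n
    by (rule continuous_approx_test_function[where \<psi>="\<psi> n" and e="inverse (real (Suc n))", OF \<psi>c \<psi>0
        R]) auto
  then obtain \<phi> where \<phi>: "\<And>n. test_function (\<phi> n)" "\<And>n x. \<bar>\<phi> n x - \<psi> n x\<bar> \<le> inverse (real (Suc n))"
     "\<And>n x. norm x > R + 1 \<Longrightarrow> \<phi> n x = 0" by metis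
  show thesis
  proof
    show "\<bar>\<phi> n x\<bar> \<le> M + 1" for n x
    proof -
      have "inverse (real (Suc n)) \<le> 1" by (simp add: field_simps)
      then show ?thesis using \<phi>(2)[of n x] \<psi>M[of n x] by linarith
    qed
    have "(\<lambda>n. \<phi> n x) \<longlonglongrightarrow> s x" if "x \<notin> N" for x
    proof -
      have "(\<lambda>n. \<psi> n x) \<longlonglongrightarrow> cut x * max (- M) (min M (s x))"
        unfolding \<psi>_def by (intro tendsto_intros lim that)
      also have "cut x * max (- M) (min M (s x)) = s x"
      proof (cases "norm x \<le> R")
        case True
        then show ?thesis using M[of x] M0 by (auto simp: cut_def min_def max_def)
      qed (use supp[of x] M0 in auto)
      finally have "(\<lambda>n. \<psi> n x) \<longlonglongrightarrow> s x" .
      moreover have "(\<lambda>n. \<phi> n x - \<psi> n x) \<longlonglongrightarrow> 0"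
        by (rule Lim_null_comparison[OF _ LIMSEQ_inverse_real_of_nat]) (use \<phi>(2) in auto)
      ultimately show ?thesis using tendsto_add by fastforce
    qed
    moreover have "N \<in> null_sets lebesgue" using N negligible_iff_null_sets by blast
    ultimately show "AE x in lebesgue. (\<lambda>n. \<phi> n x) \<longlonglongrightarrow> s x"
      using AE_not_in by (metis (mono_tags, lifting) AE_mp AE_I2)
  qed (use \<phi> in auto)
qed

section \<open>Locally integrable functions and test functions\<close>

lemma continuous_compact_support_bounded:
  fixes f :: "real ^ 'n \<Rightarrow> real"
  assumes "continuous_on UNIV f" "\<And>x. norm x > R \<Longrightarrow> f x = 0"
  obtains B where "0 \<le> B" "\<And>x. \<bar>f x\<bar> \<le> B"
proof -
  have "compact (f ` cball 0 R)"
    by (intro compact_continuous_image compact_cball continuous_on_subset[OF assms(1)]) auto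
  then obtain B where B: "\<And>x. x \<in> cball 0 R \<Longrightarrow> \<bar>f x\<bar> \<le> B"
    using compact_imp_bounded bounded_iff by (metis image_eqI real_norm_def)
  show thesis
  proof
    show "\<bar>f x\<bar> \<le> max 0 B" for x
      using assms(2)[of x] B[of x] by (cases "norm x > R") auto
  qed auto
qed

lemma test_function_support:
  fixes \<phi> :: "real ^ 'n \<Rightarrow> real"
  assumes "test_function \<phi>"
  obtains R where "0 \<le> R" "\<And>x. norm x > R \<Longrightarrow> \<phi> x = 0"
proof -
  obtain R where R: "\<And>x. x \<in> closure {x. \<phi> x \<noteq> 0} \<Longrightarrow> norm x \<le> R"
    using assms compact_imp_bounded bounded_iff unfolding test_function_def by metis
  have "\<phi> x = 0" if "norm x > max 0 R" for x
    using that R[of x] closure_subset[of "{x. \<phi> x \<noteq> 0}"] by auto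
  then show thesis by (intro that[of "max 0 R"]) auto
qed

lemma test_function_has_derivative:
  "test_function \<phi> \<Longrightarrow> (\<phi> has_derivative frechet_derivative \<phi> (at x)) (at x)"
  by (rule C_k_has_derivative[of 0]) (auto simp: test_function_def)

lemma test_function_continuous: "test_function \<phi> \<Longrightarrow> continuous_on UNIV \<phi>"
  using C_k_continuous_on by (auto simp: test_function_def)

lemma continuous_lebesgue_measurable:
  fixes f :: "real ^ 'n \<Rightarrow> 'b::{real_normed_vector, second_countable_topology}"
  shows "continuous_on UNIV f \<Longrightarrow> f \<in> borel_measurable lebesgue"
  by (intro measurable_completion) (simp add: borel_measurable_continuous_onI)

lemma test_function_measurable: "test_function \<phi> \<Longrightarrow> \<phi> \<in> borel_measurable lebesgue"
  by (intro continuous_lebesgue_measurable test_function_continuous)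

lemma test_function_bounded:
  assumes "test_function \<phi>" obtains B where "0 \<le> B" "\<And>x. \<bar>\<phi> x\<bar> \<le> B"
  using test_function_support[OF assms] continuous_compact_support_bounded
      test_function_continuous[OF assms]
  by metis

lemma test_function_partial_deriv:
  fixes \<phi> :: "real ^ 'n \<Rightarrow> real"
  assumes "test_function \<phi>"
  shows "test_function (partial_deriv i \<phi>)"
proof -
  obtain R where R: "0 \<le> R" "\<And>x. norm x > R \<Longrightarrow> \<phi> x = 0"
    by (rule test_function_support[OF assms], rule that)
  show ?thesis
  proof (rule test_functionI)
    show "C_k k (partial_deriv i \<phi>)" for k
      using assms C_k.simps(2)[of k \<phi>] unfolding test_function_def by blast
    show "norm x \<le> R" if "partial_deriv i \<phi> x \<noteq> 0" for x
    proof (rule ccontr)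
      assume x: "\<not> norm x \<le> R"
      have "((\<lambda>x. 0) has_derivative (\<lambda>h. 0)) (at x)" by simp
      then have "(\<phi> has_derivative (\<lambda>h. 0)) (at x)"
        by (rule has_derivative_transform_within_open[of _ _ _ _ "{x. R < norm x}"])
           (use x R(2) in \<open>auto intro!: open_Collect_less continuous_intros\<close>)
      then show False using that partial_deriv_eq by fastforce
    qed
  qed
qed

lemma test_function_translate:
  assumes "test_function \<phi>" shows "test_function (\<lambda>x. \<phi> (x - a))"
proof -
  obtain R where R: "0 \<le> R" "\<And>x. norm x > R \<Longrightarrow> \<phi> x = 0"
    by (rule test_function_support[OF assms], rule that)
  show ?thesis
  proof (rule test_functionI)
    show "C_k k (\<lambda>x. \<phi> (x - a))" for k
      using assms by (auto intro!: C_k_translate simp: test_function_def)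
    show "norm x \<le> R + norm a" if "\<phi> (x - a) \<noteq> 0" for x
      using that R(2)[of "x - a"] norm_triangle_ineq2[of x a] by force
  qed
qed

lemma partial_deriv_translate:
  assumes "test_function \<phi>"
  shows "partial_deriv i (\<lambda>x. \<phi> (x - a)) x = partial_deriv i \<phi> (x - a)"
proof -
  have "((\<lambda>x. x - a) has_derivative (\<lambda>h. h)) (at x)"
    by (auto intro!: derivative_eq_intros)
  from has_derivative_compose[OF this test_function_has_derivative[OF assms]]
  show ?thesis by (rule partial_deriv_eq[THEN trans]) (simp add: partial_deriv_def)
qed

lemma directional_derivative_eq_sum:
  assumes "test_function \<phi>"
  shows "frechet_derivative \<phi> (at x) h = (\<Sum>i\<in>UNIV. h $ i * partial_deriv i \<phi> x)"
proof -
  interpret bounded_linear "frechet_derivative \<phi> (at x)"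
    using test_function_has_derivative[OF assms] has_derivative_bounded_linear by blast
  have "h = (\<Sum>i\<in>UNIV. (h $ i) *\<^sub>R axis i 1)"
    using basis_expansion[of h] by (simp add: scalar_mult_eq_scaleR)
  then have "frechet_derivative \<phi> (at x) h = frechet_derivative \<phi> (at x) (\<Sum>i\<in>UNIV. (h $ i) *\<^sub>R axis i 1)"
    by simp
  then show ?thesis by (simp add: sum scaleR partial_deriv_def)
qed

lemma cball_sets_lebesgue [measurable]: "cball a r \<in> sets lebesgue"
  by simp

lemma cball_emeasure_finite: "emeasure lebesgue (cball a r) < \<infinity>"
  using fmeasurableD2[OF lmeasurable_cball] by (simp add: less_top)

definition ball_L1 :: "real \<Rightarrow> (real ^ 'n \<Rightarrow> 'b::{banach, second_countable_topology}) \<Rightarrow> real" where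
  "ball_L1 R f = set_lebesgue_integral lebesgue (cball 0 R) (\<lambda>x. norm (f x))"

lemma locally_integrable_ball:
  "locally_integrable f \<Longrightarrow> integrable lebesgue (\<lambda>x. indicator (cball 0 R) x *\<^sub>R f x)"
  by (auto simp: locally_integrable_def set_integrable_def)

lemma locally_integrable_measurable:
  fixes f :: "real ^ 'n \<Rightarrow> 'b::{banach, second_countable_topology}"
  assumes "locally_integrable f"
  shows "f \<in> borel_measurable lebesgue"
proof (rule borel_measurable_LIMSEQ_metric)
  show "(\<lambda>x. indicator (cball 0 (real n)) x *\<^sub>R f x) \<in> borel_measurable lebesgue" for n
    using locally_integrable_ball[OF assms] by (rule borel_measurable_integrable)
  show "(\<lambda>n. indicator (cball 0 (real n)) x *\<^sub>R f x) \<longlonglongrightarrow> f x" for x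
  proof (rule tendsto_eventually)
    obtain n0 where "norm x \<le> real n0" using real_arch_simple by blast
    then show "\<forall>\<^sub>F n in sequentially. indicator (cball 0 (real n)) x *\<^sub>R f x = f x"
      by (intro eventually_sequentiallyI[of n0]) auto
  qed
qed

lemma locally_integrableI_balls:
  fixes f :: "real ^ 'n \<Rightarrow> 'b::{banach, second_countable_topology}"
  assumes "f \<in> borel_measurable lebesgue"
    and "\<And>R. (\<integral>\<^sup>+x. indicator (cball 0 R) x * ennreal (norm (f x)) \<partial>lebesgue) < \<infinity>"
  shows "locally_integrable f"
  unfolding locally_integrable_def
proof (intro allI impI)
  fix K :: "(real^'n) set" assume K: "compact K"
  then obtain R where "\<forall>x\<in>K. norm x \<le> R"
    using compact_imp_bounded bounded_iff by blast
  then have R: "K \<subseteq> cball 0 R" by auto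
  have Km: "K \<in> sets lebesgue" using K by (simp add: borel_compact)
  show "set_integrable lebesgue K f" unfolding set_integrable_def
  proof (rule integrableI_bounded)
    show "(\<lambda>x. indicator K x *\<^sub>R f x) \<in> borel_measurable lebesgue" using Km assms(1) by measurable
    have "(\<integral>\<^sup>+x. ennreal (norm (indicator K x *\<^sub>R f x)) \<partial>lebesgue)
        \<le> (\<integral>\<^sup>+x. indicator (cball 0 R) x * ennreal (norm (f x)) \<partial>lebesgue)"
      using R by (intro nn_integral_mono) (auto simp: indicator_def)
    also have "\<dots> < \<infinity>" by fact
    finally show "(\<integral>\<^sup>+x. ennreal (norm (indicator K x *\<^sub>R f x)) \<partial>lebesgue) < \<infinity>" .
  qed
qed

lemma locally_integrable_ball_norm:
  "locally_integrable f \<Longrightarrow> integrable lebesgue (\<lambda>x. indicator (cball 0 R) x * norm (f x))"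
  using integrable_norm[OF locally_integrable_ball, of f R] by simp

lemma ball_L1_nn_integral:
  fixes f :: "real ^ 'n \<Rightarrow> 'b::{banach, second_countable_topology}"
  assumes "locally_integrable f"
  shows "ennreal (ball_L1 R f) = (\<integral>\<^sup>+x. indicator (cball 0 R) x * ennreal (norm (f x)) \<partial>lebesgue)"
proof -
  have "(\<integral>\<^sup>+x. ennreal (indicator (cball 0 R) x * norm (f x)) \<partial>lebesgue) = ennreal (ball_L1 R f)"
    unfolding ball_L1_def set_lebesgue_integral_def real_scaleR_def
    by (rule nn_integral_eq_integral[OF locally_integrable_ball_norm[OF assms]]) auto
  then show ?thesis by (simp add: ennreal_mult' ennreal_indicator)
qed

lemma ball_L1_nonneg: "0 \<le> ball_L1 R f"
  by (auto simp: ball_L1_def set_lebesgue_integral_def intro!: integral_nonneg_AE)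

lemma locally_integrable_times_bounded:
  fixes f :: "real ^ 'n \<Rightarrow> real"
  assumes f: "locally_integrable f" and \<phi>: "\<phi> \<in> borel_measurable lebesgue" "\<And>x. \<bar>\<phi> x\<bar> \<le> B"
    and supp: "\<And>x. norm x > R \<Longrightarrow> \<phi> x = 0"
  shows "integrable lebesgue (\<lambda>x. f x * \<phi> x)"
    and "\<bar>\<integral>x. f x * \<phi> x \<partial>lebesgue\<bar> \<le> B * ball_L1 R f"
proof -
  note [measurable] = locally_integrable_measurable[OF f] \<phi>(1)
  have i: "integrable lebesgue (\<lambda>x. B * (indicator (cball 0 R) x * norm (f x)))"
    by (intro integrable_mult_right locally_integrable_ball_norm f)
  have b: "norm (f x * \<phi> x) \<le> B * (indicator (cball 0 R) x * norm (f x))" for x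
    using supp[of x] mult_left_mono[OF \<phi>(2)[of x], of "\<bar>f x\<bar>"]
    by (cases "norm x > R") (auto simp: abs_mult mult.commute)
  show *: "integrable lebesgue (\<lambda>x. f x * \<phi> x)"
    by (rule Bochner_Integration.integrable_bound[OF i])
       (use b abs_ge_self order_trans in \<open>auto intro!: AE_I2, fastforce\<close>)
  have "norm (\<integral>x. f x * \<phi> x \<partial>lebesgue) \<le> (\<integral>x. B * (indicator (cball 0 R) x * norm (f x)) \<partial>lebesgue)"
    by (rule Bochner_Integration.integral_norm_bound_integral[OF * i]) (use b in auto)
  then show "\<bar>\<integral>x. f x * \<phi> x \<partial>lebesgue\<bar> \<le> B * ball_L1 R f"
    by (simp add: ball_L1_def set_lebesgue_integral_def)
qed

lemma locally_integrable_times_test_function: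
  fixes f :: "real ^ 'n \<Rightarrow> real"
  assumes "locally_integrable f" "test_function \<phi>"
  shows "integrable lebesgue (\<lambda>x. f x * \<phi> x)"
proof -
  obtain R where "0 \<le> R" "\<And>x. norm x > R \<Longrightarrow> \<phi> x = 0"
    by (rule test_function_support[OF assms(2)], rule that)
  moreover obtain B where "0 \<le> B" "\<And>x. \<bar>\<phi> x\<bar> \<le> B"
    by (rule test_function_bounded[OF assms(2)], rule that)
  ultimately show ?thesis
    using locally_integrable_times_bounded(1)[OF assms(1) test_function_measurable[OF assms(2)]] by blast
qed

text \<open>The sign of \<open>f\<close>, cut off outside the ball, is an almost everywhere limit of test functions
  bounded by \<open>2\<close>, so the \<open>L\<^sup>1\<close> norm is a limit of pairings with such functions.\<close>

lemma ball_L1_le_by_duality: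
  fixes f :: "real ^ 'n \<Rightarrow> real"
  assumes f: "locally_integrable f" and R: "0 \<le> R"
    and M: "\<And>\<phi>. test_function \<phi> \<Longrightarrow> (\<And>x. \<bar>\<phi> x\<bar> \<le> 2) \<Longrightarrow> (\<And>x. norm x > R + 1 \<Longrightarrow> \<phi> x = 0)
        \<Longrightarrow> (\<integral>x. f x * \<phi> x \<partial>lebesgue) \<le> M"
  shows "ball_L1 R f \<le> M"
proof -
  define s where "s x = indicator (cball 0 R) x * sgn (f x)" for x
  note [measurable] = locally_integrable_measurable[OF f]
  have s1: "s \<in> borel_measurable lebesgue" unfolding s_def[abs_def] by measurable
  have s2: "\<bar>s x\<bar> \<le> 1" for x by (auto simp: s_def abs_mult indicator_def sgn_if)
  have s3: "s x = 0" if "norm x > R" for x using that by (simp add: s_def)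
  obtain \<phi> where \<phi>: "\<And>n. test_function (\<phi> n)" "\<And>n x. \<bar>\<phi> n x\<bar> \<le> 1 + 1"
    "\<And>n x. norm x > R + 1 \<Longrightarrow> \<phi> n x = 0" "AE x in lebesgue. (\<lambda>n. \<phi> n x) \<longlonglongrightarrow> s x"
    by (rule bounded_measurable_approx_test_functions[OF s1 s2 s3 R], assumption, rule that)
  note [measurable] = s1 test_function_measurable[OF \<phi>(1)]
  have i: "integrable lebesgue (\<lambda>x. 2 * (indicator (cball 0 (R+1)) x * norm (f x)))"
    by (intro integrable_mult_right locally_integrable_ball_norm f)
  have b: "norm (f x * \<phi> n x) \<le> 2 * (indicator (cball 0 (R+1)) x * norm (f x))" for x n
    using \<phi>(3)[of x n] mult_left_mono[OF \<phi>(2)[of n x], of "\<bar>f x\<bar>"]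
    by (cases "norm x > R+1") (auto simp: abs_mult mult.commute)
  have "(\<lambda>n. \<integral>x. f x * \<phi> n x \<partial>lebesgue) \<longlonglongrightarrow> (\<integral>x. f x * s x \<partial>lebesgue)"
    by (rule integral_dominated_convergence[OF _ _ i])
       (use b eventually_mono[OF \<phi>(4) tendsto_mult[OF tendsto_const]] in auto)
  moreover have "(\<integral>x. f x * \<phi> n x \<partial>lebesgue) \<le> M" for n
    using \<phi> by (intro M) auto
  ultimately have "(\<integral>x. f x * s x \<partial>lebesgue) \<le> M"
    by (intro LIMSEQ_le_const2) auto
  also have "(\<lambda>x. f x * s x) = (\<lambda>x. indicator (cball 0 R) x * norm (f x))"
    by (auto simp: s_def sgn_if)
  finally show ?thesis by (simp add: ball_L1_def set_lebesgue_integral_def)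
qed

lemma ball_L1_zero_imp_AE:
  fixes f :: "real ^ 'n \<Rightarrow> real"
  assumes f: "locally_integrable f" and z: "\<And>R. 0 \<le> R \<Longrightarrow> ball_L1 R f \<le> 0"
  shows "AE x in lebesgue. f x = 0"
proof -
  note [measurable] = locally_integrable_measurable[OF f]
  have "AE x in lebesgue. indicator (cball 0 (real n)) x * ennreal (norm (f x)) = 0" for n
  proof (rule nn_integral_0_iff_AE[THEN iffD1])
    have "ball_L1 (real n) f = 0" using z[of "real n"] ball_L1_nonneg[of "real n" f] by auto
    then show "(\<integral>\<^sup>+x. indicator (cball 0 (real n)) x * ennreal (norm (f x)) \<partial>lebesgue) = 0"
      using ball_L1_nn_integral[OF f, of "real n"] by simp
  qed measurable
  then have "AE x in lebesgue. \<forall>n. indicator (cball 0 (real n)) x * ennreal (norm (f x)) = 0"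
    unfolding AE_all_countable by blast
  then show ?thesis
  proof eventually_elim
    fix x assume *: "\<forall>n. indicator (cball 0 (real n)) x * ennreal (norm (f x)) = 0"
    obtain n where "norm x \<le> real n" using real_arch_simple by blast
    then show "f x = 0" using *[rule_format, of n] by auto
  qed
qed

lemma fundamental_lemma_calculus_of_variations:
  fixes f :: "real ^ 'n \<Rightarrow> real"
  assumes "locally_integrable f" "\<And>\<phi>. test_function \<phi> \<Longrightarrow> (\<integral>x. f x * \<phi> x \<partial>lebesgue) = 0"
  shows "AE x in lebesgue. f x = 0"
  using assms by (intro ball_L1_zero_imp_AE ball_L1_le_by_duality) auto

lemma locally_integrable_nth: "locally_integrable g \<Longrightarrow> locally_integrable (\<lambda>x. g x $ i)"
  unfolding locally_integrable_def set_integrable_def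
  using integrable_bounded_linear[OF bounded_linear_vec_nth] by fastforce

lemma locally_integrable_lincomb:
  fixes f g :: "real ^ 'n \<Rightarrow> 'b::{banach, second_countable_topology}"
  assumes "locally_integrable f" "locally_integrable g"
  shows "locally_integrable (\<lambda>x. a *\<^sub>R f x + b *\<^sub>R g x)"
  using assms unfolding locally_integrable_def by (auto intro!: set_integral_add)

section \<open>Weak gradients\<close>

lemma has_weak_gradient_unique:
  assumes "has_weak_gradient u g" "has_weak_gradient u g'"
  shows "AE x in lebesgue. g x = g' x"
proof -
  have "AE x in lebesgue. g x $ i - g' x $ i = 0" for i
  proof (rule fundamental_lemma_calculus_of_variations)
    have l: "locally_integrable (\<lambda>x. g x $ i)" "locally_integrable (\<lambda>x. g' x $ i)"
      using assms by (auto simp: has_weak_gradient_def intro: locally_integrable_nth)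
    from locally_integrable_lincomb[OF this, of 1 "-1"]
    show "locally_integrable (\<lambda>x. g x $ i - g' x $ i)" by simp
    fix \<phi> :: "real ^ 'a \<Rightarrow> real" assume \<phi>: "test_function \<phi>"
    have "(\<integral>x. (g x $ i - g' x $ i) * \<phi> x \<partial>lebesgue)
        = (\<integral>x. g x $ i * \<phi> x \<partial>lebesgue) - (\<integral>x. g' x $ i * \<phi> x \<partial>lebesgue)"
      using l \<phi> by (simp add: left_diff_distrib locally_integrable_times_test_function)
    also have "\<dots> = 0"
    proof -
      have "(\<integral>x. u x * partial_deriv i \<phi> x \<partial>lebesgue) = - (\<integral>x. g x $ i * \<phi> x \<partial>lebesgue)"
        "(\<integral>x. u x * partial_deriv i \<phi> x \<partial>lebesgue) = - (\<integral>x. g' x $ i * \<phi> x \<partial>lebesgue)"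
        using assms \<phi> by (auto simp: has_weak_gradient_def)
      then show ?thesis by linarith
    qed
    finally show "(\<integral>x. (g x $ i - g' x $ i) * \<phi> x \<partial>lebesgue) = 0" .
  qed
  then have "AE x in lebesgue. \<forall>i. g x $ i - g' x $ i = 0"
    by (simp add: AE_all_countable)
  then show ?thesis by eventually_elim (simp add: vec_eq_iff)
qed

lemma has_weak_gradient_lincomb:
  assumes "has_weak_gradient u g" "has_weak_gradient v h"
  shows "has_weak_gradient (\<lambda>x. a * u x + b * v x) (\<lambda>x. a *\<^sub>R g x + b *\<^sub>R h x)"
  unfolding has_weak_gradient_def
proof (intro conjI allI impI)
  have l: "locally_integrable u" "locally_integrable v" "locally_integrable g" "locally_integrable h"
    using assms by (auto simp: has_weak_gradient_def)
  show "locally_integrable (\<lambda>x. a * u x + b * v x)"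
    using locally_integrable_lincomb[OF l(1,2), of a b] by simp
  show "locally_integrable (\<lambda>x. a *\<^sub>R g x + b *\<^sub>R h x)"
    using locally_integrable_lincomb[OF l(3,4)] .
  fix \<phi> :: "real ^ 'a \<Rightarrow> real" and i assume \<phi>: "test_function \<phi>"
  note I = locally_integrable_times_test_function
  note [simp] = I[OF l(1) test_function_partial_deriv[OF \<phi>, of i]] I[OF l(2)
      test_function_partial_deriv[OF \<phi>, of i]]
    I[OF locally_integrable_nth[OF l(3), of i] \<phi>] I[OF locally_integrable_nth[OF l(4), of i] \<phi>]
  have "(\<integral>x. u x * partial_deriv i \<phi> x \<partial>lebesgue) = - (\<integral>x. g x $ i * \<phi> x \<partial>lebesgue)"
    "(\<integral>x. v x * partial_deriv i \<phi> x \<partial>lebesgue) = - (\<integral>x. h x $ i * \<phi> x \<partial>lebesgue)"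
    using assms \<phi> by (auto simp: has_weak_gradient_def)
  then show "(\<integral>x. (a * u x + b * v x) * partial_deriv i \<phi> x \<partial>lebesgue)
      = - (\<integral>x. (a *\<^sub>R g x + b *\<^sub>R h x) $ i * \<phi> x \<partial>lebesgue)"
    by (simp add: distrib_right mult.assoc)
qed

lemma has_weak_gradient_weak_gradient:
  "weakly_differentiable u \<Longrightarrow> has_weak_gradient u (weak_gradient u)"
  unfolding weakly_differentiable_def weak_gradient_def by (metis someI_ex)

lemma weakly_differentiable_lincomb:
  "weakly_differentiable u \<Longrightarrow> weakly_differentiable v \<Longrightarrow> weakly_differentiable (\<lambda>x. a * u x + b * v x)"
  using has_weak_gradient_lincomb by (fastforce simp: weakly_differentiable_def)

lemma weak_gradient_lincomb:
  assumes "weakly_differentiable u" "weakly_differentiable v"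
  shows "AE x in lebesgue. weak_gradient (\<lambda>x. a * u x + b * v x) x
      = a *\<^sub>R weak_gradient u x + b *\<^sub>R weak_gradient v x"
  using assms
  by (intro has_weak_gradient_unique[OF has_weak_gradient_weak_gradient has_weak_gradient_lincomb]
      weakly_differentiable_lincomb has_weak_gradient_weak_gradient)

lemma weak_gradient_measurable:
  "weakly_differentiable u \<Longrightarrow> weak_gradient u \<in> borel_measurable lebesgue"
  using has_weak_gradient_weak_gradient locally_integrable_measurable
      by (auto simp: has_weak_gradient_def)

lemma has_weak_gradient_cong_AE:
  assumes g: "has_weak_gradient u g" and uv: "AE x in lebesgue. u x
      = v x" and v: "v \<in> borel_measurable lebesgue"
  shows "has_weak_gradient v g"
proof -
  have u: "u \<in> borel_measurable lebesgue"
    using g locally_integrable_measurable by (auto simp: has_weak_gradient_def)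
  have "locally_integrable v"
    unfolding locally_integrable_def set_integrable_def
  proof (intro allI impI)
    fix K :: "(real^'a) set" assume K: "compact K"
    then have [measurable]: "K \<in> sets lebesgue" by (simp add: borel_compact)
    note [measurable] = v
    show "integrable lebesgue (\<lambda>x. indicator K x *\<^sub>R v x)"
    proof (rule integrable_cong_AE_imp)
      show "integrable lebesgue (\<lambda>x. indicator K x *\<^sub>R u x)"
        using g K by (simp add: has_weak_gradient_def locally_integrable_def set_integrable_def)
      show "AE x in lebesgue. indicator K x *\<^sub>R u x = indicator K x *\<^sub>R v x"
        using uv by eventually_elim simp
    qed measurable
  qed
  moreover have "(\<integral>x. v x * partial_deriv i \<phi> x \<partial>lebesgue) = (\<integral>x. u x * partial_deriv i \<phi> x \<partial>lebesgue)"
    if \<phi>: "test_function \<phi>" for i \<phi>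
  proof (rule integral_cong_AE)
    note [measurable] = u v test_function_measurable[OF test_function_partial_deriv[OF \<phi>, of i]]
    show "(\<lambda>x. u x * partial_deriv i \<phi> x) \<in> borel_measurable lebesgue"
      "(\<lambda>x. v x * partial_deriv i \<phi> x) \<in> borel_measurable lebesgue" by measurable
    show "AE x in lebesgue. v x * partial_deriv i \<phi> x = u x * partial_deriv i \<phi> x"
      using uv by eventually_elim simp
  qed
  ultimately show ?thesis
    using g by (simp add: has_weak_gradient_def)
qed

section \<open>Density of test functions in the square integrable functions\<close>

definition truncation :: "nat \<Rightarrow> (real ^ 'n \<Rightarrow> real) \<Rightarrow> real ^ 'n \<Rightarrow> real" where
  "truncation n a x = indicator (cball 0 (real n)) x * max (- real n) (min (real n) (a x))"

lemma truncation_measurable [measurable (raw)]: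
  assumes [measurable]: "a \<in> borel_measurable lebesgue"
  shows "truncation n a \<in> borel_measurable lebesgue"
  unfolding truncation_def[abs_def] by measurable

lemma truncation_error_le: "(a x - truncation n a x)\<^sup>2 \<le> (a x)\<^sup>2"
proof -
  have "\<bar>a x - truncation n a x\<bar> \<le> \<bar>a x\<bar>"
    by (auto simp: truncation_def indicator_def min_def max_def abs_if)
  then show ?thesis by (simp add: abs_le_square_iff)
qed

lemma square_integrable_truncation:
  fixes a :: "real ^ 'n \<Rightarrow> real"
  assumes a: "a \<in> borel_measurable lebesgue" "integrable lebesgue (\<lambda>x. (a x)\<^sup>2)"
  shows "(\<lambda>n. \<integral>x. (a x - truncation n a x)\<^sup>2 \<partial>lebesgue) \<longlonglongrightarrow> 0"
proof -
  note [measurable] = a(1)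
  have "(\<lambda>n. \<integral>x. (a x - truncation n a x)\<^sup>2 \<partial>lebesgue) \<longlonglongrightarrow> (\<integral>x. 0 \<partial>(lebesgue::(real^'n) measure))"
  proof (rule integral_dominated_convergence[OF _ _ a(2)])
    show "AE x in lebesgue. (\<lambda>n. (a x - truncation n a x)\<^sup>2) \<longlonglongrightarrow> 0"
    proof (rule AE_I2)
      fix x :: "real ^ 'n"
      obtain n0 where n0: "max (norm x) \<bar>a x\<bar> \<le> real n0" using real_arch_simple by blast
      have "\<forall>\<^sub>F n in sequentially. (a x - truncation n a x)\<^sup>2 = 0"
      proof (rule eventually_sequentiallyI[of n0])
        fix n assume "n0 \<le> n"
        then have "norm x \<le> real n" "\<bar>a x\<bar> \<le> real n"
          using n0 by (auto intro: order_trans)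
        then show "(a x - truncation n a x)\<^sup>2 = 0"
          by (simp add: truncation_def min_def max_def abs_le_iff)
      qed
      then show "(\<lambda>n. (a x - truncation n a x)\<^sup>2) \<longlonglongrightarrow> 0"
        by (rule tendsto_eventually)
    qed
  qed (use truncation_error_le in \<open>auto intro!: AE_I2\<close>)
  then show ?thesis by simp
qed

lemma test_functions_dense_L2:
  fixes a :: "real ^ 'n \<Rightarrow> real"
  assumes a: "a \<in> borel_measurable lebesgue" "integrable lebesgue (\<lambda>x. (a x)\<^sup>2)" and e: "0 < e"
  obtains \<phi> where "test_function \<phi>" "integrable lebesgue (\<lambda>x. (a x - \<phi> x)\<^sup>2)"
    "(\<integral>x. (a x - \<phi> x)\<^sup>2 \<partial>lebesgue) < e"
proof -
  note [measurable] = a(1)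
  define s where "s n = truncation n a" for n
  have [measurable]: "s n \<in> borel_measurable lebesgue" for n unfolding s_def by measurable
  have "\<forall>\<^sub>F n in sequentially. (\<integral>x. (a x - s n x)\<^sup>2 \<partial>lebesgue) < e/4"
    unfolding s_def using square_integrable_truncation[OF a] e by (intro order_tendstoD) auto
  then obtain n where n: "(\<integral>x. (a x - s n x)\<^sup>2 \<partial>lebesgue) < e/4"
    using eventually_sequentially by auto
  have ias: "integrable lebesgue (\<lambda>x. (a x - s n x)\<^sup>2)"
    by (rule Bochner_Integration.integrable_bound[OF a(2)]) (auto simp: s_def truncation_error_le)
  obtain \<phi> where \<phi>: "\<And>m. test_function (\<phi> m)" "\<And>m x. \<bar>\<phi> m x\<bar> \<le> real n + 1"
    "\<And>m x. norm x > real n + 1 \<Longrightarrow> \<phi> m x = 0" "AE x in lebesgue. (\<lambda>m. \<phi> m x) \<longlonglongrightarrow> s n x"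
    by (rule bounded_measurable_approx_test_functions[of "s n" "real n" "real n"])
       (auto simp: s_def truncation_def indicator_def)
  note [measurable] = test_function_measurable[OF \<phi>(1)]
  let ?w = "\<lambda>x. (2 * real n + 1)\<^sup>2 * indicator (cball (0::real^'n) (real n + 1)) x"
  have w: "integrable lebesgue ?w"
    by (intro integrable_mult_right integrable_real_indicator cball_emeasure_finite) simp
  have b: "(s n x - \<phi> m x)\<^sup>2 \<le> ?w x" for m x
  proof (cases "norm x \<le> real n + 1")
    case True
    have "\<bar>s n x\<bar> \<le> real n" by (auto simp: s_def truncation_def indicator_def)
    then have "\<bar>s n x - \<phi> m x\<bar> \<le> \<bar>2 * real n + 1\<bar>" using \<phi>(2)[of m x] by linarith
    then show ?thesis using True by (simp only: abs_le_square_iff) simp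
  next
    case False
    then show ?thesis using \<phi>(3)[of x m] by (simp add: s_def truncation_def)
  qed
  have "(\<lambda>m. \<integral>x. (s n x - \<phi> m x)\<^sup>2 \<partial>lebesgue) \<longlonglongrightarrow> (\<integral>x. 0 \<partial>(lebesgue::(real^'n) measure))"
  proof (rule integral_dominated_convergence[OF _ _ w])
    show "AE x in lebesgue. (\<lambda>m. (s n x - \<phi> m x)\<^sup>2) \<longlonglongrightarrow> 0"
      using \<phi>(4)
    proof eventually_elim
      fix x assume "(\<lambda>m. \<phi> m x) \<longlonglongrightarrow> s n x"
      then have "(\<lambda>m. (s n x - \<phi> m x)\<^sup>2) \<longlonglongrightarrow> (s n x - s n x)\<^sup>2" by (intro tendsto_intros)
      then show "(\<lambda>m. (s n x - \<phi> m x)\<^sup>2) \<longlonglongrightarrow> 0" by simp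
    qed
  qed (use b in auto)
  then have "(\<lambda>m. \<integral>x. (s n x - \<phi> m x)\<^sup>2 \<partial>lebesgue) \<longlonglongrightarrow> 0" by simp
  then have "\<forall>\<^sub>F m in sequentially. (\<integral>x. (s n x - \<phi> m x)\<^sup>2 \<partial>lebesgue) < e/4"
    using e by (intro order_tendstoD) auto
  then obtain m where m: "(\<integral>x. (s n x - \<phi> m x)\<^sup>2 \<partial>lebesgue) < e/4"
    using eventually_sequentially by auto
  have isf: "integrable lebesgue (\<lambda>x. (s n x - \<phi> m x)\<^sup>2)"
    by (rule Bochner_Integration.integrable_bound[OF w]) (use b in auto)
  have ineq: "(a x - \<phi> m x)\<^sup>2 \<le> 2 * (a x - s n x)\<^sup>2 + 2 * (s n x - \<phi> m x)\<^sup>2" for x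
  proof -
    have "0 \<le> ((a x - s n x) - (s n x - \<phi> m x))\<^sup>2" by simp
    then show ?thesis by (simp add: power2_eq_square algebra_simps)
  qed
  have isum: "integrable lebesgue (\<lambda>x. 2 * (a x - s n x)\<^sup>2 + 2 * (s n x - \<phi> m x)\<^sup>2)"
    using ias isf by auto
  have iaf: "integrable lebesgue (\<lambda>x. (a x - \<phi> m x)\<^sup>2)"
    by (rule Bochner_Integration.integrable_bound[OF isum]) (use ineq in \<open>auto intro!: AE_I2 intro:
        order_trans abs_ge_self\<close>)
  have "(\<integral>x. (a x - \<phi> m x)\<^sup>2 \<partial>lebesgue) \<le> (\<integral>x. 2 * (a x - s n x)\<^sup>2 + 2 * (s n x - \<phi> m x)\<^sup>2 \<partial>lebesgue)"
    by (rule integral_mono[OF iaf isum ineq])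
  also have "\<dots> < e" using ias isf n m by simp
  finally show thesis using that \<phi>(1) iaf by blast
qed

text \<open>Density of test functions extends the convergence from test functions to all of \<open>L\<^sup>2\<close>: by
  Young's inequality with a small parameter \<open>t\<close>, the error is uniform in \<open>j\<close> because \<open>b\<close> is bounded.\<close>

lemma L2_bounded_distributional_null_imp_weak:
  fixes a :: "real ^ 'n \<Rightarrow> real" and b :: "nat \<Rightarrow> real ^ 'n \<Rightarrow> real"
  assumes a: "a \<in> borel_measurable lebesgue" "integrable lebesgue (\<lambda>x. (a x)\<^sup>2)"
    and b: "\<And>j. locally_integrable (b j)" "\<And>j. integrable lebesgue (\<lambda>x. (b j x)\<^sup>2)"
       "\<And>j. (\<integral>x. (b j x)\<^sup>2 \<partial>lebesgue) \<le> B"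
    and lim: "\<And>\<phi>. test_function \<phi> \<Longrightarrow> (\<lambda>j. \<integral>x. b j x * \<phi> x \<partial>lebesgue) \<longlonglongrightarrow> 0"
  shows "(\<lambda>j. \<integral>x. b j x * a x \<partial>lebesgue) \<longlonglongrightarrow> 0"
proof (rule LIMSEQ_I)
  fix e :: real assume e: "0 < e"
  note [measurable] = a(1) locally_integrable_measurable[OF b(1)]
  have B: "0 \<le> B" by (rule order_trans[OF integral_nonneg_AE b(3)[of 0]]) auto
  define t where "t = e / (B + 1)"
  have t: "t > 0" "t * B \<le> e" using e B by (auto simp: t_def field_simps)
  obtain \<phi> where \<phi>: "test_function \<phi>" "integrable lebesgue (\<lambda>x. (a x - \<phi> x)\<^sup>2)"
    "(\<integral>x. (a x - \<phi> x)\<^sup>2 \<partial>lebesgue) < t * e / 2"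
    using test_functions_dense_L2[OF a, of "t * e / 2"] t e by auto
  note [measurable] = test_function_measurable[OF \<phi>(1)]
  have "\<forall>\<^sub>F j in sequentially. \<bar>\<integral>x. b j x * \<phi> x \<partial>lebesgue\<bar> < e/4"
    using order_tendstoD(2)[OF tendsto_rabs_zero[OF lim[OF \<phi>(1)]], of "e/4"] e by auto
  then obtain J where J: "\<And>j. j \<ge> J \<Longrightarrow> \<bar>\<integral>x. b j x * \<phi> x \<partial>lebesgue\<bar> < e/4"
    using eventually_sequentially by auto
  have "\<bar>\<integral>x. b j x * a x \<partial>lebesgue\<bar> < e" if "j \<ge> J" for j
  proof -
    let ?w = "\<lambda>x. (1 / (2*t)) * (a x - \<phi> x)\<^sup>2 + (t/2) * (b j x)\<^sup>2"
    have iw: "integrable lebesgue ?w" using \<phi>(2) b(2) by auto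
    have bd: "norm (b j x * (a x - \<phi> x)) \<le> ?w x" for x
    proof -
      have "0 \<le> (\<bar>a x - \<phi> x\<bar> - t * \<bar>b j x\<bar>)\<^sup>2" by simp
      then have "2 * t * (\<bar>b j x\<bar> * \<bar>a x - \<phi> x\<bar>) \<le> (a x - \<phi> x)\<^sup>2 + t\<^sup>2 * (b j x)\<^sup>2"
        by (simp add: power2_diff power_mult_distrib mult_ac)
      then have "\<bar>b j x\<bar> * \<bar>a x - \<phi> x\<bar> \<le> ((a x - \<phi> x)\<^sup>2 + t\<^sup>2 * (b j x)\<^sup>2) / (2 * t)"
        using t by (simp add: pos_le_divide_eq mult.commute)
      also have "\<dots> = ?w x" using t by (simp add: add_divide_distrib power2_eq_square)
      finally show ?thesis by (simp add: abs_mult)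
    qed
    have i1: "integrable lebesgue (\<lambda>x. b j x * (a x - \<phi> x))"
      by (rule Bochner_Integration.integrable_bound[OF iw]) (use bd in \<open>auto intro!: AE_I2 intro:
          order_trans abs_ge_self\<close>)
    have i2: "integrable lebesgue (\<lambda>x. b j x * \<phi> x)"
      using locally_integrable_times_test_function[OF b(1) \<phi>(1)] .
    have "(\<integral>x. b j x * a x \<partial>lebesgue) = (\<integral>x. b j x * (a x - \<phi> x) + b j x * \<phi> x \<partial>lebesgue)"
      by (simp add: algebra_simps)
    also have "\<dots> = (\<integral>x. b j x * (a x - \<phi> x) \<partial>lebesgue) + (\<integral>x. b j x * \<phi> x \<partial>lebesgue)"
      using i1 i2 by simp
    finally have eq: "(\<integral>x. b j x * a x \<partial>lebesgue) = \<dots>" .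
    have "norm (\<integral>x. b j x * (a x - \<phi> x) \<partial>lebesgue) \<le> (\<integral>x. ?w x \<partial>lebesgue)"
      by (rule Bochner_Integration.integral_norm_bound_integral[OF i1 iw]) (use bd in auto)
    also have "\<dots> = (1 / (2*t)) * (\<integral>x. (a x - \<phi> x)\<^sup>2 \<partial>lebesgue) + (t/2) * (\<integral>x. (b j x)\<^sup>2 \<partial>lebesgue)"
      using \<phi>(2) b(2) by simp
    also have "\<dots> \<le> (1 / (2*t)) * (t * e / 2) + (t/2) * B"
      using \<phi>(3) b(3)[of j] t by (intro add_mono mult_left_mono) auto
    also have "\<dots> \<le> e/4 + e/2" using t by (simp add: field_simps)
    finally show ?thesis using eq J[OF that] by simp
  qed
  then show "\<exists>J. \<forall>j\<ge>J. norm ((\<integral>x. b j x * a x \<partial>lebesgue) - 0) < e" by auto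
qed

section \<open>Translations and averages of weakly differentiable functions\<close>

lemma directional_derivative_bounded:
  fixes \<phi> :: "real ^ 'n \<Rightarrow> real"
  assumes "test_function \<phi>"
  obtains C where "0 \<le> C" "\<And>y. \<bar>frechet_derivative \<phi> (at y) h\<bar> \<le> C"
proof -
  have "\<exists>B. \<forall>y. \<bar>partial_deriv i \<phi> y\<bar> \<le> B" for i
    by (rule test_function_bounded[OF test_function_partial_deriv[OF assms, of i]]) auto
  then obtain B where B: "\<And>i y. \<bar>partial_deriv i \<phi> y\<bar> \<le> B i" by metis
  have "\<bar>frechet_derivative \<phi> (at y) h\<bar> \<le> (\<Sum>i\<in>UNIV. \<bar>h $ i\<bar> * B i)" for y
    unfolding directional_derivative_eq_sum[OF assms]
    by (rule order_trans[OF sum_abs]) (auto simp: abs_mult intro!: sum_mono mult_left_mono B)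
  from this this[of 0] show thesis using that abs_ge_zero order_trans by blast
qed

lemma translation_along_line_has_derivative:
  fixes \<phi> :: "real ^ 'n \<Rightarrow> real"
  assumes "test_function \<phi>"
  shows "((\<lambda>t. \<phi> (x - t *\<^sub>R h)) has_real_derivative - frechet_derivative \<phi> (at (x - t *\<^sub>R h)) h) (at t)"
proof -
  interpret bounded_linear "frechet_derivative \<phi> (at (x - t *\<^sub>R h))"
    using test_function_has_derivative[OF assms] has_derivative_bounded_linear by blast
  have "((\<lambda>t. x - t *\<^sub>R h) has_derivative (\<lambda>s. - (s *\<^sub>R h))) (at t)"
    by (auto intro!: derivative_eq_intros)
  from has_derivative_compose[OF this test_function_has_derivative[OF assms]]
  show ?thesis unfolding has_field_derivative_def
    by (rule has_derivative_eq_rhs) (auto simp: neg scaleR)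
qed

text \<open>The derivative in \<open>t\<close> falls on the test function, where it is a directional derivative that weak
  differentiability moves to \<open>w\<close>.\<close>

lemma pairing_with_translate_has_derivative:
  fixes w :: "real ^ 'n \<Rightarrow> real"
  assumes w: "has_weak_gradient w g" and \<phi>: "test_function \<phi>"
  shows "((\<lambda>t. \<integral>x. w x * \<phi> (x - t *\<^sub>R h) \<partial>lebesgue) has_real_derivative
      (\<integral>x. (g x \<bullet> h) * \<phi> (x - t *\<^sub>R h) \<partial>lebesgue)) (at t)"
proof -
  have lw: "locally_integrable w" and lg: "locally_integrable g"
    using w by (auto simp: has_weak_gradient_def)
  note [measurable] = locally_integrable_measurable[OF lw]
  have \<phi>t: "test_function (\<lambda>x. \<phi> (x - t *\<^sub>R h))" for t using test_function_translate[OF \<phi>] .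
  note [measurable] = test_function_measurable[OF \<phi>t]
  note I = locally_integrable_times_test_function
  obtain C where C: "0 \<le> C" "\<And>y. \<bar>frechet_derivative \<phi> (at y) h\<bar> \<le> C"
    by (rule directional_derivative_bounded[OF \<phi>, of h], rule that)
  obtain R where R: "0 \<le> R" "\<And>x. norm x > R \<Longrightarrow> \<phi> x = 0"
    by (rule test_function_support[OF \<phi>], rule that)
  have lip: "\<bar>\<phi> (x - (t + s) *\<^sub>R h) - \<phi> (x - t *\<^sub>R h)\<bar> \<le> C * \<bar>s\<bar>" for x s
    using field_differentiable_bound[of UNIV "\<lambda>t. \<phi> (x - t *\<^sub>R h)" "\<lambda>t. - frechet_derivative \<phi> (at
        (x - t *\<^sub>R h)) h" C "t+s" t]
      translation_along_line_has_derivative[OF \<phi>] C(2) by simp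
  let ?J = "\<lambda>t. \<integral>x. w x * \<phi> (x - t *\<^sub>R h) \<partial>lebesgue"
  define \<phi>' where "\<phi>' x = - frechet_derivative \<phi> (at (x - t *\<^sub>R h)) h" for x
  define Q where "Q s x = (\<phi> (x - (t + s) *\<^sub>R h) - \<phi> (x - t *\<^sub>R h)) / s" for s x
  have \<phi>'_sum: "\<phi>' x = (\<Sum>i\<in>UNIV. - (h $ i) * partial_deriv i (\<lambda>x. \<phi> (x - t *\<^sub>R h)) x)" for x
    by (simp add: \<phi>'_def directional_derivative_eq_sum[OF \<phi>] partial_deriv_translate[OF \<phi>] sum_negf)
  have grad: "(\<integral>x. w x * \<phi>' x \<partial>lebesgue)
     = (\<integral>x. (g x \<bullet> h) * \<phi> (x - t *\<^sub>R h) \<partial>lebesgue)"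
  proof -
    have "(\<integral>x. w x * \<phi>' x \<partial>lebesgue)
        = (\<integral>x. (\<Sum>i\<in>UNIV. - (h $ i) * (w x * partial_deriv i (\<lambda>x. \<phi> (x - t *\<^sub>R h)) x)) \<partial>lebesgue)"
      by (simp add: \<phi>'_sum sum_distrib_left mult_ac)
    also have "\<dots> = (\<Sum>i\<in>UNIV. - (h $ i) * (\<integral>x. w x * partial_deriv i (\<lambda>x. \<phi> (x - t *\<^sub>R h)) x \<partial>lebesgue))"
      by (subst Bochner_Integration.integral_sum)
         (auto intro!: integrable_minus integrable_mult_right I[OF lw] test_function_partial_deriv
             \<phi>t simp del: mult_minus_left)
    also have "\<dots> = (\<Sum>i\<in>UNIV. (h $ i) * (\<integral>x. g x $ i * \<phi> (x - t *\<^sub>R h) \<partial>lebesgue))"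
      using w \<phi>t by (auto simp: has_weak_gradient_def intro!: sum.cong)
    also have "\<dots> = (\<integral>x. (\<Sum>i\<in>UNIV. (h $ i) * (g x $ i * \<phi> (x - t *\<^sub>R h))) \<partial>lebesgue)"
      by (subst Bochner_Integration.integral_sum)
         (auto intro!: integrable_mult_right I[OF locally_integrable_nth[OF lg]] \<phi>t)
    also have "\<dots> = (\<integral>x. (g x \<bullet> h) * \<phi> (x - t *\<^sub>R h) \<partial>lebesgue)"
      by (simp add: inner_vec_def sum_distrib_left mult_ac)
    finally show ?thesis .
  qed
  have "((\<lambda>s. (?J (t + s) - ?J t) / s) \<longlongrightarrow> (\<integral>x. w x * \<phi>' x \<partial>lebesgue)) (at 0)"
    unfolding tendsto_at_iff_sequentially comp_def
  proof (intro allI impI)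
    fix S :: "nat \<Rightarrow> real" assume S: "\<forall>i. S i \<in> UNIV - {0}" "S \<longlonglongrightarrow> 0"
    then have S0: "S n \<noteq> 0" for n by auto
    \<comment> \<open>A bound on the increments confines all translates to one ball, which gives a dominating function.\<close>
    obtain K where K: "\<And>n. \<bar>S n\<bar> \<le> K"
      using convergent_imp_Bseq[OF convergentI[OF S(2)]] unfolding Bseq_def by auto
    define R' where "R' = R + (\<bar>t\<bar> + K) * norm h"
    have out: "\<phi> (x - (t + s) *\<^sub>R h) = 0" if "norm x > R'" "\<bar>s\<bar> \<le> K" for x s
    proof (rule R(2))
      have "norm ((t + s) *\<^sub>R h) \<le> (\<bar>t\<bar> + K) * norm h"
        unfolding norm_scaleR using that by (intro mult_right_mono) auto
      then show "R < norm (x - (t + s) *\<^sub>R h)"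
        using that norm_triangle_ineq2[of x "(t+s) *\<^sub>R h"] by (auto simp: R'_def)
    qed
    have K0: "0 \<le> K" using K[of 0] by linarith
    have "(\<lambda>n. \<integral>x. w x * Q (S n) x \<partial>lebesgue)
       \<longlonglongrightarrow> (\<integral>x. w x * \<phi>' x \<partial>lebesgue)"
    proof (rule integral_dominated_convergence)
      show "integrable lebesgue (\<lambda>x. C * (indicator (cball 0 R') x * norm (w x)))"
        by (intro integrable_mult_right locally_integrable_ball_norm lw)
      show "AE x in lebesgue. norm (w x * Q (S n) x) \<le> C * (indicator (cball 0 R') x * norm (w x))" for n
      proof (rule AE_I2)
        fix x
        show "norm (w x * Q (S n) x) \<le> C * (indicator (cball 0 R') x * norm (w x))"
        proof (cases "norm x > R'")
          case True
          then show ?thesis using out[of x "S n"] out[of x 0] K K0 by (simp add: Q_def)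
        next
          case False
          have "\<bar>Q (S n) x\<bar> \<le> C"
            using lip[of x "S n"] S0[of n] by (simp add: Q_def field_simps)
          from mult_left_mono[OF this, of "\<bar>w x\<bar>"] False show ?thesis
            by (simp add: abs_mult mult.commute)
        qed
      qed
      show "AE x in lebesgue. (\<lambda>n. w x * Q (S n) x)
         \<longlonglongrightarrow> w x * \<phi>' x"
      proof (rule AE_I2, rule tendsto_mult[OF tendsto_const])
        fix x
        have "((\<lambda>s. Q s x) \<longlongrightarrow> \<phi>' x) (at 0)"
          using translation_along_line_has_derivative[OF \<phi>, of x h t]
              by (simp add: DERIV_def Q_def \<phi>'_def)
        then show "(\<lambda>n. Q (S n) x) \<longlonglongrightarrow> \<phi>' x"
          using S unfolding tendsto_at_iff_sequentially comp_def by blast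
      qed
      show "(\<lambda>x. w x * \<phi>' x) \<in> borel_measurable lebesgue" unfolding \<phi>'_sum
        by (rule borel_measurable_times[OF locally_integrable_measurable[OF lw]])
          (intro borel_measurable_times borel_measurable_sum borel_measurable_const
            test_function_measurable test_function_partial_deriv \<phi>t)
      show "(\<lambda>x. w x * Q (S n) x) \<in> borel_measurable lebesgue" for n unfolding Q_def by measurable
    qed
    also have "(\<lambda>n. \<integral>x. w x * Q (S n) x \<partial>lebesgue)
        = (\<lambda>n. (?J (t + S n) - ?J t) / S n)"
      using I[OF lw \<phi>t] by (simp add: Q_def right_diff_distrib diff_divide_distrib)
    finally show "(\<lambda>n. (?J (t + S n) - ?J t) / S n) \<longlonglongrightarrow> (\<integral>x. w x * \<phi>' x \<partial>lebesgue)" .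
  qed
  then show ?thesis unfolding grad DERIV_def .
qed

lemma ball_L1_inner_le:
  assumes "locally_integrable g"
  shows "locally_integrable (\<lambda>x. g x \<bullet> h)" "ball_L1 R (\<lambda>x. g x \<bullet> h) \<le> norm h * ball_L1 R g"
proof -
  show *: "locally_integrable (\<lambda>x. g x \<bullet> h)"
    unfolding locally_integrable_def set_integrable_def
  proof (intro allI impI)
    fix K :: "(real^'a) set" assume "compact K"
    then have "integrable lebesgue (\<lambda>x. (indicator K x *\<^sub>R g x) \<bullet> h)"
      using assms by (intro integrable_inner_left) (auto simp: locally_integrable_def set_integrable_def)
    then show "integrable lebesgue (\<lambda>x. indicator K x *\<^sub>R (g x \<bullet> h))" by simp
  qed
  have "ball_L1 R (\<lambda>x. g x \<bullet> h) \<le> (\<integral>x. norm h * (indicator (cball 0 R) x * norm (g x)) \<partial>lebesgue)"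
    unfolding ball_L1_def set_lebesgue_integral_def real_scaleR_def
  proof (rule integral_mono)
    show "indicator (cball 0 R) x * norm (g x \<bullet> h)
        \<le> norm h * (indicator (cball 0 R) x * norm (g x))" for x
      using Cauchy_Schwarz_ineq2[of "g x" h] by (auto simp: indicator_def mult.commute)
  qed (use locally_integrable_ball_norm[OF assms, of R] locally_integrable_ball_norm[OF *, of R] in auto)
  then show "ball_L1 R (\<lambda>x. g x \<bullet> h) \<le> norm h * ball_L1 R g"
    by (simp add: ball_L1_def set_lebesgue_integral_def)
qed

lemma pairing_with_translate_diff_le:
  fixes w :: "real ^ 'n \<Rightarrow> real"
  assumes w: "has_weak_gradient w g" and \<phi>: "test_function \<phi>" "\<And>x. \<bar>\<phi> x\<bar> \<le> B"
    and supp: "\<And>x. norm x > R \<Longrightarrow> \<phi> x = 0" and h: "norm h \<le> 1"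
  shows "\<bar>\<integral>x. w x * (\<phi> (x - h) - \<phi> x) \<partial>lebesgue\<bar> \<le> B * norm h * ball_L1 (R + 1) g"
proof -
  have lw: "locally_integrable w" and lg: "locally_integrable g"
    using w by (auto simp: has_weak_gradient_def)
  have B: "0 \<le> B" using \<phi>(2)[of 0] by linarith
  let ?J = "\<lambda>t. \<integral>x. w x * \<phi> (x - t *\<^sub>R h) \<partial>lebesgue"
  let ?J' = "\<lambda>t. \<integral>x. (g x \<bullet> h) * \<phi> (x - t *\<^sub>R h) \<partial>lebesgue"
  have "\<exists>z>0. z < 1 \<and> ?J 1 - ?J 0 = (1 - 0) * ?J' z"
    by (rule MVT2) (auto intro: pairing_with_translate_has_derivative[OF w \<phi>(1)])
  then obtain z where z: "0 < z" "z < 1" "?J 1 - ?J 0 = ?J' z" by auto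
  have "\<bar>?J' z\<bar> \<le> B * ball_L1 (R + 1) (\<lambda>x. g x \<bullet> h)"
  proof (rule locally_integrable_times_bounded(2)[OF ball_L1_inner_le(1)[OF lg]
      test_function_measurable[OF test_function_translate[OF \<phi>(1)]] \<phi>(2)])
    fix x :: "real ^ 'n" assume x: "R + 1 < norm x"
    have "z * norm h \<le> 1" using z h mult_mono[of z 1 "norm h" 1] by simp
    then show "\<phi> (x - z *\<^sub>R h) = 0"
      using x z norm_triangle_ineq2[of x "z *\<^sub>R h"] by (intro supp) auto
  qed
  also have "\<dots> \<le> B * (norm h * ball_L1 (R + 1) g)"
    by (intro mult_left_mono ball_L1_inner_le lg B)
  finally have "\<bar>?J 1 - ?J 0\<bar> \<le> B * norm h * ball_L1 (R + 1) g" using z(3) by (simp add: mult.assoc)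
  moreover have "?J 1 - ?J 0 = (\<integral>x. w x * (\<phi> (x - h) - \<phi> x) \<partial>lebesgue)"
    using locally_integrable_times_test_function[OF lw test_function_translate[OF \<phi>(1), of h]]
      locally_integrable_times_test_function[OF lw \<phi>(1)] by (simp add: right_diff_distrib)
  ultimately show ?thesis by simp
qed

lemma nn_integral_translate_borel:
  fixes f :: "real ^ 'n \<Rightarrow> ennreal"
  assumes [measurable]: "f \<in> borel_measurable borel"
  shows "(\<integral>\<^sup>+x. f (x + h) \<partial>lebesgue) = (\<integral>\<^sup>+x. f x \<partial>lebesgue)"
proof -
  have "(\<integral>\<^sup>+x. f x \<partial>lborel) = (\<integral>\<^sup>+x. f x \<partial>distr lborel borel ((+) h))"
    by (simp add: lborel_distr_plus)
  also have "\<dots> = (\<integral>\<^sup>+x. f (x + h) \<partial>lborel)"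
    by (subst nn_integral_distr) (auto simp: add.commute)
  finally show ?thesis by (simp add: nn_integral_completion)
qed

lemma integral_translate_borel:
  fixes f :: "real ^ 'n \<Rightarrow> real"
  assumes [measurable]: "f \<in> borel_measurable borel"
  shows "(\<integral>x. f (x + h) \<partial>lebesgue) = (\<integral>x. f x \<partial>lebesgue)"
proof -
  have "(\<integral>x. f x \<partial>lborel) = (\<integral>x. f x \<partial>distr lborel borel ((+) h))"
    by (simp add: lborel_distr_plus)
  also have "\<dots> = (\<integral>x. f (x + h) \<partial>lborel)"
    by (subst integral_distr) (auto simp: add.commute)
  finally show ?thesis by (simp add: integral_completion)
qed

lemma locally_integrable_translate_borel:
  fixes w :: "real ^ 'n \<Rightarrow> real"
  assumes w: "locally_integrable w" and [measurable]: "w \<in> borel_measurable borel"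
  shows "locally_integrable (\<lambda>x. w (x + h))"
proof (rule locally_integrableI_balls)
  note cball_sets_lebesgue [measurable del]
  have [measurable]: "cball a r \<in> sets borel" for a :: "real ^ 'n" and r by simp
  show "(\<lambda>x. w (x + h)) \<in> borel_measurable lebesgue" by (rule measurable_completion) simp
  fix R
  have "(\<integral>\<^sup>+x. indicator (cball 0 R) x * ennreal (norm (w (x + h))) \<partial>lebesgue)
     \<le> (\<integral>\<^sup>+x. indicator (cball 0 (R + norm h)) (x + h) * ennreal (norm (w (x + h))) \<partial>lebesgue)"
  proof (rule nn_integral_mono)
    fix x
    show "indicator (cball 0 R) x * ennreal (norm (w (x + h)))
        \<le> indicator (cball 0 (R + norm h)) (x + h) * ennreal (norm (w (x + h)))"
      using norm_triangle_ineq[of x h] by (auto simp: indicator_def)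
  qed
  also have "\<dots> = (\<integral>\<^sup>+x. indicator (cball 0 (R + norm h)) x * ennreal (norm (w x)) \<partial>lebesgue)"
    by (rule nn_integral_translate_borel[of "\<lambda>x. indicator (cball 0 (R
        + norm h)) x * ennreal (norm (w x))"]) measurable
  also have "\<dots> < \<infinity>"
    using ball_L1_nn_integral[OF w, of "R + norm h"] by (metis ennreal_less_top infinity_ennreal_def)
  finally show "(\<integral>\<^sup>+x. indicator (cball 0 R) x * ennreal (norm (w (x + h))) \<partial>lebesgue) < \<infinity>" .
qed

text \<open>The modulus of continuity of translations is controlled by the gradient: by duality it
  suffices to move the translation to a test function \<open>\<phi>\<close>, where \<open>t \<mapsto> \<integral>w \<phi>(\<cdot> - t h)\<close> has
  derivative \<open>\<integral>(g \<bullet> h) \<phi>(\<cdot> - t h)\<close>.\<close>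

lemma ball_L1_translation_diff_le:
  fixes w :: "real ^ 'n \<Rightarrow> real"
  assumes w: "has_weak_gradient w g" and wb [measurable]: "w \<in> borel_measurable borel"
    and h: "norm h \<le> 1" and R: "0 \<le> R"
  shows "ball_L1 R (\<lambda>x. w (x + h) - w x) \<le> 2 * norm h * ball_L1 (R + 2) g"
proof (rule ball_L1_le_by_duality[OF _ R])
  have lw: "locally_integrable w" using w by (auto simp: has_weak_gradient_def)
  note lwh = locally_integrable_translate_borel[OF lw wb, of h]
  show "locally_integrable (\<lambda>x. w (x + h) - w x)"
    using locally_integrable_lincomb[OF lwh lw, of 1 "-1"] by simp
  fix \<phi> :: "real ^ 'n \<Rightarrow> real"
  assume \<phi>: "test_function \<phi>" "\<And>x. \<bar>\<phi> x\<bar> \<le> 2" "\<And>x. R + 1 < norm x \<Longrightarrow> \<phi> x = 0"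
  have [measurable]: "\<phi> \<in> borel_measurable borel"
    using test_function_continuous[OF \<phi>(1)] by (rule borel_measurable_continuous_onI)
  note I = locally_integrable_times_test_function
  have "(\<integral>x. (w (x + h) - w x) * \<phi> x \<partial>lebesgue)
      = (\<integral>x. w (x + h) * \<phi> x \<partial>lebesgue) - (\<integral>x. w x * \<phi> x \<partial>lebesgue)"
    using I[OF lwh \<phi>(1)] I[OF lw \<phi>(1)] by (simp add: left_diff_distrib)
  also have "(\<integral>x. w (x + h) * \<phi> x \<partial>lebesgue) = (\<integral>x. w x * \<phi> (x - h) \<partial>lebesgue)"
    using integral_translate_borel[of "\<lambda>x. w x * \<phi> (x - h)" h] by simp
  also have "(\<integral>x. w x * \<phi> (x - h) \<partial>lebesgue) - (\<integral>x. w x * \<phi> x \<partial>lebesgue)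
      = (\<integral>x. w x * (\<phi> (x - h) - \<phi> x) \<partial>lebesgue)"
    using I[OF lw test_function_translate[OF \<phi>(1)]] I[OF lw \<phi>(1)] by (simp add: right_diff_distrib)
  also have "\<dots> \<le> 2 * norm h * ball_L1 (R + 1 + 1) g"
    by (rule order_trans[OF abs_ge_self pairing_with_translate_diff_le[OF w \<phi> h]])
  finally show "(\<integral>x. (w (x + h) - w x) * \<phi> x \<partial>lebesgue) \<le> 2 * norm h * ball_L1 (R + 2) g"
    by (simp add: add.assoc)
qed

definition ball_average :: "real \<Rightarrow> (real ^ 'n \<Rightarrow> real) \<Rightarrow> real ^ 'n \<Rightarrow> real" where
  "ball_average \<epsilon> w x = (\<integral>y. indicator (cball x \<epsilon>) y * w y \<partial>lebesgue) / measure lebesgue (cball (0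
      :: real ^ 'n) \<epsilon>)"

lemma measure_cball_pos: "0 < \<epsilon> \<Longrightarrow> 0 < measure lebesgue (cball (0 :: real ^ 'n) \<epsilon>)"
  by (simp add: content_cball)

text \<open>The difference \<open>w x - ball_average \<epsilon> w x\<close> is the average of \<open>w x - w (x + h)\<close> over
  \<open>norm h \<le> \<epsilon>\<close>; by Tonelli's theorem its local \<open>L\<^sup>1\<close> norm is at most the average of those of the
  translation differences.\<close>

lemma ball_average_estimate_borel:
  fixes w :: "real ^ 'n \<Rightarrow> real"
  assumes w: "has_weak_gradient w g" and wb [measurable]: "w \<in> borel_measurable borel"
    and \<epsilon>: "0 < \<epsilon>" "\<epsilon> \<le> 1" and R: "0 \<le> R"
  shows "(\<integral>\<^sup>+x. indicator (cball 0 R) x * ennreal \<bar>w x - ball_average \<epsilon> w x\<bar> \<partial>lebesgue)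
      \<le> ennreal (2 * \<epsilon> * ball_L1 (R + 2) g)"
proof -
  note cball_sets_lebesgue [measurable del]
  have [measurable]: "cball a r \<in> sets borel" for a :: "real ^ 'n" and r by simp
  define V where "V = measure lebesgue (cball (0 :: real ^ 'n) \<epsilon>)"
  have V: "0 < V" unfolding V_def by (rule measure_cball_pos[OF \<epsilon>(1)])
  have emV: "emeasure lebesgue (cball (0 :: real ^ 'n) \<epsilon>) = ennreal V"
    unfolding V_def by (rule emeasure_eq_ennreal_measure) (use cball_emeasure_finite[of "0::real^'n"
        \<epsilon>] in auto)
  have lw: "locally_integrable w" using w by (auto simp: has_weak_gradient_def)
  let ?i = "indicator (cball 0 \<epsilon>) :: real ^ 'n \<Rightarrow> real"
  let ?I = "indicator (cball 0 \<epsilon>) :: real ^ 'n \<Rightarrow> ennreal"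
  let ?K = "indicator (cball 0 R) :: real ^ 'n \<Rightarrow> ennreal"
  have pt: "ennreal \<bar>w x - ball_average \<epsilon> w x\<bar>
      \<le> ennreal (1/V) * (\<integral>\<^sup>+h. ?I h * ennreal \<bar>w (x + h) - w x\<bar> \<partial>lebesgue)" for x
  proof -
    have i1: "integrable lebesgue (\<lambda>h. ?i h * w (x + h))"
      using locally_integrable_ball[OF locally_integrable_translate_borel[OF lw wb, of x], of \<epsilon>]
          by (simp add: add.commute)
    have i2: "integrable lebesgue (\<lambda>h. ?i h * w x)"
      by (intro integrable_mult_left integrable_real_indicator cball_emeasure_finite) simp
    have e1: "(\<integral>h. ?i h * w (x + h) \<partial>lebesgue) = V * ball_average \<epsilon> w x"
    proof -
      have "(\<integral>h. ?i h * w (x + h) \<partial>lebesgue) = (\<integral>h. indicator (cball x \<epsilon>) (h + x) * w (h + x) \<partial>lebesgue)"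
        by (intro Bochner_Integration.integral_cong) (auto simp: indicator_def dist_norm add.commute)
      also have "\<dots> = (\<integral>y. indicator (cball x \<epsilon>) y * w y \<partial>lebesgue)"
        by (rule integral_translate_borel[of "\<lambda>y. indicator (cball x \<epsilon>) y * w y"]) measurable
      finally show ?thesis using V by (simp add: ball_average_def V_def)
    qed
    have "(\<integral>h. ?i h * (w (x + h) - w x) \<partial>lebesgue) = V * ball_average \<epsilon> w x - V * w x"
      using i1 i2 by (simp add: right_diff_distrib e1) (simp add: V_def)
    then have "w x - ball_average \<epsilon> w x = - (1/V) * (\<integral>h. ?i h * (w (x + h) - w x) \<partial>lebesgue)"
      using V by (simp add: field_simps)
    then have "ennreal \<bar>w x - ball_average \<epsilon> w x\<bar>
        = ennreal (1/V) * ennreal (norm (\<integral>h. ?i h * (w (x + h) - w x) \<partial>lebesgue))"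
      using V by (simp flip: ennreal_mult')
    also have "\<dots> \<le> ennreal (1/V) * (\<integral>\<^sup>+h. ennreal (norm (?i h * (w (x + h) - w x))) \<partial>lebesgue)"
      using i1 i2 by (intro mult_left_mono integral_norm_bound_ennreal) (auto simp: right_diff_distrib)
    finally show ?thesis by (simp add: abs_mult ennreal_mult' ennreal_indicator)
  qed
  have "(\<integral>\<^sup>+x. ?K x * ennreal \<bar>w x - ball_average \<epsilon> w x\<bar> \<partial>lebesgue)
     \<le> (\<integral>\<^sup>+x. ?K x * (ennreal (1/V) * (\<integral>\<^sup>+h. ?I h * ennreal \<bar>w (x + h) - w x\<bar> \<partial>lebesgue)) \<partial>lebesgue)"
    by (intro nn_integral_mono mult_left_mono pt) auto
  also have "\<dots> = (\<integral>\<^sup>+x. (\<integral>\<^sup>+h. ennreal (1/V) * (?K x * ?I h * ennreal \<bar>w (x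
      + h) - w x\<bar>) \<partial>lborel) \<partial>lborel)"
    unfolding nn_integral_completion
    by (intro nn_integral_cong, subst nn_integral_cmult[symmetric], measurable)
       (subst nn_integral_cmult[symmetric], auto simp: mult_ac)
  also have "\<dots> = (\<integral>\<^sup>+h. (\<integral>\<^sup>+x. ennreal (1/V) * (?K x * ?I h * ennreal \<bar>w (x
      + h) - w x\<bar>) \<partial>lborel) \<partial>lborel)"
    by (rule lborel_pair.Fubini'[symmetric]) measurable
  also have "\<dots> = (\<integral>\<^sup>+h. (ennreal (1/V) * ?I h) * (\<integral>\<^sup>+x. ?K x * ennreal \<bar>w (x
      + h) - w x\<bar> \<partial>lebesgue) \<partial>lborel)"
    unfolding nn_integral_completion
    by (intro nn_integral_cong, subst nn_integral_cmult[symmetric], measurable) (auto simp: mult_ac)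
  also have "\<dots> \<le> (\<integral>\<^sup>+h. (ennreal (1/V) * ?I h) * ennreal (2 * \<epsilon> * ball_L1 (R + 2) g) \<partial>lborel)"
  proof (rule nn_integral_mono)
    fix h :: "real ^ 'n"
    show "(ennreal (1/V) * ?I h) * (\<integral>\<^sup>+x. ?K x * ennreal \<bar>w (x + h) - w x\<bar> \<partial>lebesgue)
       \<le> (ennreal (1/V) * ?I h) * ennreal (2 * \<epsilon> * ball_L1 (R + 2) g)"
    proof (cases "norm h \<le> \<epsilon>")
      case True
      have lwh: "locally_integrable (\<lambda>x. w (x + h) - w x)"
        using locally_integrable_lincomb[OF locally_integrable_translate_borel[OF lw wb, of h] lw,
            of 1 "-1"] by simp
      have "ball_L1 R (\<lambda>x. w (x + h) - w x) \<le> 2 * norm h * ball_L1 (R + 2) g"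
        using True \<epsilon> by (intro ball_L1_translation_diff_le[OF w wb _ R]) auto
      also have "\<dots> \<le> 2 * \<epsilon> * ball_L1 (R + 2) g"
        using True by (intro mult_right_mono ball_L1_nonneg) auto
      finally have "ennreal (ball_L1 R (\<lambda>x. w (x + h) - w x)) \<le> ennreal (2 * \<epsilon> * ball_L1 (R + 2) g)"
        by (rule ennreal_leI)
      then show ?thesis
        unfolding ball_L1_nn_integral[OF lwh, of R] real_norm_def by (rule mult_left_mono) simp
    qed simp
  qed
  also have "\<dots> = ennreal (1/V) * ennreal V * ennreal (2 * \<epsilon> * ball_L1 (R + 2) g)"
  proof -
    have "(\<integral>\<^sup>+h. ?I h \<partial>lborel) = ennreal V" using emV by simp
    then show ?thesis by (simp add: nn_integral_multc nn_integral_cmult)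
  qed
  also have "ennreal (1/V) * ennreal V = 1" using V by (simp flip: ennreal_mult')
  finally show ?thesis by simp
qed

text \<open>Measurability on the product space requires Borel functions; passing to a Borel representative
  changes no average.\<close>

lemma borel_representative_ball_average:
  fixes w :: "real ^ 'n \<Rightarrow> real"
  assumes wm: "w \<in> borel_measurable lebesgue"
  obtains w' where "w' \<in> borel_measurable borel" "w' \<in> borel_measurable lebesgue"
    "AE x in lebesgue. w x = w' x" "\<And>\<epsilon>. ball_average \<epsilon> w = ball_average \<epsilon> w'"
proof -
  from completion_ex_borel_measurable_real[OF wm] obtain w' where
    w': "w' \<in> borel_measurable lborel" "AE x in lborel. w x = w' x" by blast
  have ae: "AE x in lebesgue. w x = w' x" using w'(2) by (rule AE_completion)
  have w'm: "w' \<in> borel_measurable lebesgue" using w'(1) by (rule measurable_completion)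
  note [measurable] = wm w'm
  have "ball_average \<epsilon> w x = ball_average \<epsilon> w' x" for \<epsilon> x
  proof -
    have "(\<integral>y. indicator (cball x \<epsilon>) y * w y \<partial>lebesgue) = (\<integral>y. indicator (cball x \<epsilon>) y * w' y \<partial>lebesgue)"
    proof (rule integral_cong_AE)
      show "AE y in lebesgue. indicator (cball x \<epsilon>) y * w y = indicator (cball x \<epsilon>) y * w' y"
        using ae by eventually_elim simp
    qed measurable
    then show ?thesis by (simp add: ball_average_def)
  qed
  then show thesis using w'(1) by (intro that[OF _ w'm ae]) auto
qed

lemma ball_average_measurable:
  fixes w :: "real ^ 'n \<Rightarrow> real"
  assumes "w \<in> borel_measurable lebesgue"
  shows "ball_average \<epsilon> w \<in> borel_measurable lebesgue"
proof -
  note cball_sets_lebesgue [measurable del]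
  obtain w' where [measurable]: "w' \<in> borel_measurable borel" and eq: "ball_average \<epsilon> w
      = ball_average \<epsilon> w'"
    by (rule borel_representative_ball_average[OF assms], rule that)
  have [measurable]: "cball a r \<in> sets borel" for a :: "real ^ 'n" and r by simp
  have "(\<integral>y. indicator (cball x \<epsilon>) y * w' y \<partial>lebesgue) = (\<integral>y. (if dist x y
      \<le> \<epsilon> then w' y else 0) \<partial>lborel)" for x
  proof -
    have "(\<integral>y. indicator (cball x \<epsilon>) y * w' y \<partial>lebesgue) = (\<integral>y. indicator (cball x \<epsilon>) y * w' y \<partial>lborel)"
      by (rule integral_completion) measurable
    also have "\<dots> = (\<integral>y. (if dist x y \<le> \<epsilon> then w' y else 0) \<partial>lborel)"
      by (intro Bochner_Integration.integral_cong) (auto simp: indicator_def)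
    finally show ?thesis .
  qed
  moreover have "(\<lambda>x. \<integral>y. (if dist x y \<le> \<epsilon> then w' y else 0) \<partial>lborel) \<in> borel_measurable lborel"
    by (rule lborel.borel_measurable_lebesgue_integral) measurable
  ultimately have "ball_average \<epsilon> w' \<in> borel_measurable lebesgue"
    unfolding ball_average_def[abs_def] by (intro measurable_completion) simp
  then show ?thesis unfolding eq .
qed

lemma ball_average_estimate:
  fixes w :: "real ^ 'n \<Rightarrow> real"
  assumes w: "has_weak_gradient w g" and \<epsilon>: "0 < \<epsilon>" "\<epsilon> \<le> 1" and R: "0 \<le> R"
  shows "(\<integral>\<^sup>+x. indicator (cball 0 R) x * ennreal \<bar>w x - ball_average \<epsilon> w x\<bar> \<partial>lebesgue)
      \<le> ennreal (2 * \<epsilon> * ball_L1 (R + 2) g)"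
proof -
  have wm: "w \<in> borel_measurable lebesgue"
    using w locally_integrable_measurable by (auto simp: has_weak_gradient_def)
  obtain w' where w': "w' \<in> borel_measurable borel" "w' \<in> borel_measurable lebesgue"
    "AE x in lebesgue. w x = w' x" "ball_average \<epsilon> w = ball_average \<epsilon> w'"
    by (rule borel_representative_ball_average[OF wm], rule that)
  have "(\<integral>\<^sup>+x. indicator (cball 0 R) x * ennreal \<bar>w x - ball_average \<epsilon> w x\<bar> \<partial>lebesgue)
     = (\<integral>\<^sup>+x. indicator (cball 0 R) x * ennreal \<bar>w' x - ball_average \<epsilon> w' x\<bar> \<partial>lebesgue)"
    unfolding w'(4) using w'(3) by (intro nn_integral_cong_AE) auto
  also have "\<dots> \<le> ennreal (2 * \<epsilon> * ball_L1 (R + 2) g)"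
    by (rule ball_average_estimate_borel[OF has_weak_gradient_cong_AE[OF w w'(3,2)] w'(1) \<epsilon> R])
  finally show ?thesis .
qed

section \<open>Uniform convexity of the power function\<close>

definition powr_defect :: "real \<Rightarrow> real \<Rightarrow> real \<Rightarrow> real" where
  "powr_defect p a b = (\<bar>a\<bar> powr p + \<bar>b\<bar> powr p) / 2 - \<bar>(a + b) / 2\<bar> powr p"

lemma powr_defect_commute: "powr_defect p a b = powr_defect p b a"
  by (simp add: powr_defect_def add.commute)

lemma powr_defect_scale: "powr_defect p (c * a) (c * b) = \<bar>c\<bar> powr p * powr_defect p a b"
proof -
  have "\<bar>(c * a + c * b) / 2\<bar> = \<bar>c\<bar> * \<bar>(a + b) / 2\<bar>"
    unfolding abs_mult[symmetric] by (simp add: algebra_simps)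
  then show ?thesis
    unfolding powr_defect_def abs_mult[of c] by (simp only: powr_mult abs_ge_zero) (simp add:
        algebra_simps)
qed

text \<open>For \<open>0 \<le> t\<close> the defect is strictly decreasing on \<open>[t, 1]\<close> and vanishes at \<open>1\<close>. For
  \<open>-1 < t < 0\<close> the defect is at least that of \<open>-t\<close>, whose midpoint with \<open>1\<close> is larger.\<close>

lemma powr_defect_pos_unit:
  assumes p: "1 < p" and t: "-1 \<le> t" "t < 1"
  shows "0 < powr_defect p t 1"
proof -
  have nonneg: "((1 + s) / 2) powr p < (1 + s powr p) / 2" if s: "0 \<le> s" "s < 1" for s
  proof -
    let ?f = "\<lambda>s. (1 + s powr p) / 2 - ((1 + s) / 2) powr p"
    have "?f s > ?f 1"
    proof (rule DERIV_neg_imp_decreasing_open[OF s(2)])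
      show "continuous_on {s..1} ?f"
        using s p by (intro continuous_intros continuous_on_powr') auto
      fix x assume x: "s < x" "x < 1"
      then have x0: "0 < x" using s by simp
      have "(?f has_real_derivative (p * x powr (p - 1)) / 2 - (p * ((1
          + x) / 2) powr (p - 1)) * (1 / 2)) (at x)"
        using x0 by (auto intro!: derivative_eq_intros)
      moreover have "x powr (p - 1) < ((1 + x) / 2) powr (p - 1)"
        using x x0 p by (intro powr_less_mono2) auto
      ultimately show "\<exists>y. DERIV ?f x :> y \<and> y < 0"
        using p by (intro exI conjI) auto
    qed
    then show ?thesis by simp
  qed
  have "\<bar>(1 + t) / 2\<bar> powr p < (1 + \<bar>t\<bar> powr p) / 2"
  proof (cases "0 \<le> t \<or> t = -1")
    case True
    then show ?thesis using nonneg[of t] t p by auto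
  next
    case False
    have "\<bar>(1 + t) / 2\<bar> powr p \<le> ((1 + \<bar>t\<bar>) / 2) powr p"
      using t p by (intro powr_mono2) auto
    then show ?thesis using nonneg[of "\<bar>t\<bar>"] t False by simp
  qed
  then show ?thesis by (simp add: powr_defect_def add.commute)
qed

lemma powr_defect_nonneg_unit:
  assumes "1 < p" "\<bar>t\<bar> \<le> 1" shows "0 \<le> powr_defect p t 1"
proof (cases "t = 1")
  case False
  then show ?thesis using powr_defect_pos_unit[of p t] assms by (simp add: abs_le_iff)
qed (simp add: powr_defect_def)

text \<open>On \<open>[-1, 1]\<close> the deviation \<open>\<bar>t - 1\<bar>\<^sup>p\<close> is at least \<open>\<epsilon>\<close> only on a compact set, where the
  defect is bounded away from zero.\<close>

lemma powr_uniform_convexity_unit: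
  fixes p \<epsilon> :: real
  assumes p: "1 < p" and e: "0 < \<epsilon>"
  obtains C where "0 \<le> C"
    "\<And>t. \<bar>t\<bar> \<le> 1 \<Longrightarrow> \<bar>t - 1\<bar> powr p \<le> \<epsilon> * (\<bar>t\<bar> powr p + 1) + C * powr_defect p t 1"
proof -
  let ?h = "\<lambda>t. powr_defect p t 1"
  let ?S = "{-1..1} \<inter> {t. \<epsilon> \<le> \<bar>t - 1\<bar> powr p}"
  have hc: "continuous_on UNIV ?h"
    unfolding powr_defect_def using p by (intro continuous_intros continuous_on_powr') auto
  have "continuous_on UNIV (\<lambda>t. \<bar>t - 1\<bar> powr p)"
    using p by (intro continuous_intros continuous_on_powr') auto
  then have "closed {t. \<epsilon> \<le> \<bar>t - 1\<bar> powr p}"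
    by (rule closed_Collect_le[OF continuous_on_const])
  then have S: "compact ?S" by (intro compact_Int_closed) auto
  have off: "\<bar>t - 1\<bar> powr p \<le> \<epsilon> * (\<bar>t\<bar> powr p + 1)" if "\<bar>t\<bar> \<le> 1" "t \<notin> ?S" for t
  proof -
    have "\<bar>t - 1\<bar> powr p < \<epsilon>" using that by (auto simp: abs_le_iff)
    also have "\<epsilon> \<le> \<epsilon> * (\<bar>t\<bar> powr p + 1)" using e by simp
    finally show ?thesis by simp
  qed
  show thesis
  proof (cases "?S = {}")
    case True
    then show thesis using off by (intro that[of 0]) auto
  next
    case False
    then obtain t0 where t0: "t0 \<in> ?S" "\<And>t. t \<in> ?S \<Longrightarrow> ?h t0 \<le> ?h t"
      using continuous_attains_inf[OF S False continuous_on_subset[OF hc subset_UNIV]] by blast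
    have "t0 \<noteq> 1" using t0(1) e by auto
    then have d: "0 < ?h t0" using powr_defect_pos_unit[OF p, of t0] t0(1) by auto
    show thesis
    proof (rule that[of "2 powr p / ?h t0"])
      show "0 \<le> 2 powr p / ?h t0" using d by simp
      fix t :: real assume t: "\<bar>t\<bar> \<le> 1"
      show "\<bar>t - 1\<bar> powr p \<le> \<epsilon> * (\<bar>t\<bar> powr p + 1) + 2 powr p / ?h t0 * ?h t"
      proof (cases "t \<in> ?S")
        case True
        have "\<bar>t - 1\<bar> powr p \<le> 2 powr p" using t p by (intro powr_mono2) auto
        also have "\<dots> \<le> 2 powr p / ?h t0 * ?h t"
          using mult_left_mono[OF t0(2)[OF True], of "2 powr p / ?h t0"] d by simp
        also have "\<dots> \<le> \<epsilon> * (\<bar>t\<bar> powr p + 1) + \<dots>" using e by simp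
        finally show ?thesis .
      next
        case False
        have "0 \<le> 2 powr p / ?h t0 * ?h t"
          by (rule mult_nonneg_nonneg) (use d powr_defect_nonneg_unit[OF p t] in auto)
        then show ?thesis using off[OF t False] by linarith
      qed
    qed
  qed
qed

lemma ratio_of_smaller:
  fixes a b :: real
  assumes "\<bar>a\<bar> \<le> \<bar>b\<bar>"
  obtains t where "\<bar>t\<bar> \<le> 1" "a = b * t"
proof (cases "b = 0")
  case True
  then show thesis using assms by (intro that[of 0]) auto
next
  case False
  then show thesis using assms by (intro that[of "a / b"]) (auto simp: abs_divide)
qed

text \<open>Both sides are homogeneous of degree \<open>p\<close>, so the larger entry may be taken to be \<open>1\<close>.\<close>

lemma powr_uniform_convexity:
  fixes p \<epsilon> :: real
  assumes p: "1 < p" and e: "0 < \<epsilon>"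
  obtains C where "0 \<le> C"
    "\<And>a b. \<bar>a - b\<bar> powr p \<le> \<epsilon> * (\<bar>a\<bar> powr p + \<bar>b\<bar> powr p) + C * powr_defect p a b"
proof -
  obtain C where C: "0 \<le> C"
    "\<And>t. \<bar>t\<bar> \<le> 1 \<Longrightarrow> \<bar>t - 1\<bar> powr p \<le> \<epsilon> * (\<bar>t\<bar> powr p + 1) + C * powr_defect p t 1"
    by (rule powr_uniform_convexity_unit[OF p e], rule that)
  let ?P = "\<lambda>a b. \<bar>a - b\<bar> powr p \<le> \<epsilon> * (\<bar>a\<bar> powr p + \<bar>b\<bar> powr p) + C * powr_defect p a b"
  have *: "?P a b" if ab: "\<bar>a\<bar> \<le> \<bar>b\<bar>" for a b :: real
  proof -
    obtain t where t: "\<bar>t\<bar> \<le> 1" "a = b * t" by (rule ratio_of_smaller[OF ab], rule that)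
    have "\<bar>a - b\<bar> = \<bar>b\<bar> * \<bar>t - 1\<bar>" unfolding t abs_mult[symmetric] by (simp add: algebra_simps)
    then have "\<bar>a - b\<bar> powr p = \<bar>b\<bar> powr p * \<bar>t - 1\<bar> powr p" by (simp only: powr_mult abs_ge_zero)
    moreover have "\<bar>a\<bar> powr p = \<bar>b\<bar> powr p * \<bar>t\<bar> powr p" by (simp add: t abs_mult powr_mult)
    moreover have "powr_defect p a b = \<bar>b\<bar> powr p * powr_defect p t 1"
      using powr_defect_scale[of p b t 1] by (simp add: t)
    ultimately show ?thesis
      using mult_left_mono[OF C(2)[OF t(1)], of "\<bar>b\<bar> powr p"] by (simp add: algebra_simps)
  qed
  have "?P a b" for a b
    using *[of a b] *[of b a] powr_defect_commute[of p a b]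
    by (cases "\<bar>a\<bar> \<le> \<bar>b\<bar>") (auto simp: abs_minus_commute add.commute)
  then show thesis by (rule that[OF C(1)])
qed

lemma powr_defect_nonneg:
  assumes p: "1 < p"
  shows "0 \<le> powr_defect p a b"
proof -
  have *: "0 \<le> powr_defect p a b" if ab: "\<bar>a\<bar> \<le> \<bar>b\<bar>" for a b
  proof -
    obtain t where t: "\<bar>t\<bar> \<le> 1" "a = b * t" by (rule ratio_of_smaller[OF ab], rule that)
    then show ?thesis
      using powr_defect_scale[of p b t 1] powr_defect_nonneg_unit[OF p t(1)] by simp
  qed
  show ?thesis
    using *[of a b] *[of b a] powr_defect_commute[of p a b] by (cases "\<bar>a\<bar> \<le> \<bar>b\<bar>") auto
qed

lemma powr_add_le:
  fixes a b p :: real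
  assumes p: "0 \<le> p"
  shows "\<bar>a + b\<bar> powr p \<le> 2 powr p * (\<bar>a\<bar> powr p + \<bar>b\<bar> powr p)"
proof -
  have "\<bar>a + b\<bar> powr p \<le> (2 * max \<bar>a\<bar> \<bar>b\<bar>) powr p"
    using p by (intro powr_mono2) auto
  also have "\<dots> = 2 powr p * (max \<bar>a\<bar> \<bar>b\<bar>) powr p" by (simp add: powr_mult)
  also have "\<dots> \<le> 2 powr p * (\<bar>a\<bar> powr p + \<bar>b\<bar> powr p)"
    by (intro mult_left_mono) (auto simp: max_def)
  finally show ?thesis .
qed

section \<open>Squares in the extended nonnegative reals\<close>

lemma ennreal_power2_add_le: "(x + y)\<^sup>2 \<le> 2 * x\<^sup>2 + 2 * (y :: ennreal)\<^sup>2"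
proof (cases x; cases y)
  fix a b :: real assume ab: "0 \<le> a" "0 \<le> b" "x = ennreal a" "y = ennreal b"
  have "0 \<le> (a - b)\<^sup>2" by simp
  then have "(a + b)\<^sup>2 \<le> 2 * a\<^sup>2 + 2 * b\<^sup>2" by (simp add: power2_eq_square algebra_simps)
  then have "ennreal ((a + b)\<^sup>2) \<le> ennreal (2 * a\<^sup>2 + 2 * b\<^sup>2)" by (rule ennreal_leI)
  also have "ennreal (2 * a\<^sup>2 + 2 * b\<^sup>2) = 2 * ennreal (a\<^sup>2) + 2 * ennreal (b\<^sup>2)"
    by (subst ennreal_plus) (auto simp: ennreal_mult')
  finally show ?thesis using ab by (simp add: ennreal_power flip: ennreal_plus)
qed (auto simp: power2_eq_square ennreal_mult_top)

text \<open>Infima over tails increase to the lower limit, and multiplication in \<open>[0, \<infinity>]\<close> is continuous on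
  the diagonal.\<close>

lemma ennreal_liminf_power2_ge:
  fixes y :: "nat \<Rightarrow> ennreal"
  assumes "x \<le> liminf y"
  shows "x\<^sup>2 \<le> liminf (\<lambda>j. (y j)\<^sup>2)"
proof -
  define m where "m n = (INF j\<in>{n..}. y j)" for n
  have "incseq m" unfolding m_def incseq_def by (auto intro!: INF_superset_mono)
  then have "m \<longlonglongrightarrow> (SUP n. m n)" by (rule LIMSEQ_SUP)
  then have m: "m \<longlonglongrightarrow> liminf y" by (simp add: liminf_SUP_INF m_def)
  have "(\<lambda>n. m n * m n) \<longlonglongrightarrow> liminf y * liminf y"
    by (rule tendsto_mult_ennreal[OF m m]) auto
  moreover have "m n * m n \<le> liminf (\<lambda>j. (y j)\<^sup>2)" for n
  proof -
    have "m n * m n \<le> (INF j\<in>{n..}. (y j)\<^sup>2)"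
      unfolding power2_eq_square by (intro INF_greatest mult_mono) (auto simp: m_def intro: INF_lower)
    also have "\<dots> \<le> liminf (\<lambda>j. (y j)\<^sup>2)"
      unfolding liminf_SUP_INF by (rule SUP_upper) simp
    finally show ?thesis .
  qed
  ultimately have "liminf y * liminf y \<le> liminf (\<lambda>j. (y j)\<^sup>2)"
    by (intro LIMSEQ_le_const2) auto
  then show ?thesis using mult_mono[OF assms assms] by (simp add: power2_eq_square)
qed

section \<open>The Coulomb energy\<close>

text \<open>The type argument fixes the dimension, which enters through the upper bound for \<open>\<alpha>\<close>.\<close>

locale coulomb_exponents =
  fixes \<alpha> p :: real and space_dim :: "'n::finite itself"
  assumes alpha: "0 < \<alpha>" "\<alpha> < real CARD('n)" and p: "1 < p"
begin

abbreviation kernel :: "real ^ 'n \<Rightarrow> real" where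
  "kernel \<equiv> riesz_kernel (\<alpha> / 2)"

abbreviation energy :: "(real ^ 'n \<Rightarrow> real) \<Rightarrow> ennreal" where
  "energy \<equiv> coulomb_energy \<alpha> p"

text \<open>The Riesz potential as an operator on densities with values in \<open>[0, \<infinity>]\<close>, on which it is
  additive, monotone and symmetric; all nonlinearity of the energy is left to \<open>\<bar>u\<bar>\<^sup>p\<close> and
  to the square.\<close>

definition potential :: "(real ^ 'n \<Rightarrow> ennreal) \<Rightarrow> real ^ 'n \<Rightarrow> ennreal" where
  "potential f x = (\<integral>\<^sup>+ y. ennreal (kernel (x - y)) * f y \<partial>lebesgue)"

abbreviation power_potential :: "(real ^ 'n \<Rightarrow> real) \<Rightarrow> real ^ 'n \<Rightarrow> ennreal" where
  "power_potential u \<equiv> potential (\<lambda>y. ennreal (\<bar>u y\<bar> powr p))"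

lemma riesz_const_pos: "0 < riesz_const CARD('n) (\<alpha> / 2)"
  using alpha by (simp add: riesz_const_def Gamma_real_pos)

lemma kernel_nonneg: "0 \<le> kernel z"
  using riesz_const_pos by (simp add: riesz_kernel_def)

lemma kernel_minus: "kernel (x - y) = kernel (y - x)"
  by (simp add: riesz_kernel_def norm_minus_commute)

lemma kernel_measurable [measurable]: "kernel \<in> borel_measurable borel"
  unfolding riesz_kernel_def[abs_def] by measurable

lemma kernel_lower_bound:
  assumes "0 < R"
  obtains c where "0 < c" "\<And>z. z \<noteq> 0 \<Longrightarrow> norm z \<le> R \<Longrightarrow> c \<le> kernel z"
proof
  let ?c = "riesz_const CARD('n) (\<alpha> / 2) * R powr (- (real CARD('n) - \<alpha> / 2))"
  show "0 < ?c" using assms riesz_const_pos by simp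
  show "?c \<le> kernel z" if "z \<noteq> 0" "norm z \<le> R" for z
    unfolding riesz_kernel_def using that alpha riesz_const_pos
    by (intro mult_left_mono powr_mono2') auto
qed

lemma coulomb_energy_eq: "energy u = (\<integral>\<^sup>+ x. (power_potential u x)\<^sup>2 \<partial>lebesgue)"
  unfolding coulomb_energy_def riesz_potential_def potential_def
  by (simp add: ennreal_mult' kernel_nonneg)

lemma potential_cong_AE:
  assumes "AE y in lebesgue. f y = g y"
  shows "potential f = potential g"
  unfolding potential_def using assms by (intro ext nn_integral_cong_AE) auto

lemma ex_borel_representative:
  fixes f :: "real ^ 'n \<Rightarrow> ennreal"
  assumes "f \<in> borel_measurable lebesgue"
  obtains f' where "f' \<in> borel_measurable borel" "AE y in lebesgue. f y = f' y"
proof -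
  obtain f' where "f' \<in> borel_measurable lborel" "AE y in lborel. f y = f' y"
    using completion_ex_borel_measurable[OF assms] by blast
  then show thesis by (intro that[of f'] AE_completion) auto
qed

lemma potential_borel_measurable:
  assumes "f \<in> borel_measurable lebesgue"
  shows "potential f \<in> borel_measurable borel"
proof -
  obtain f' where [measurable]: "f' \<in> borel_measurable borel" and "AE y in lebesgue. f y = f' y"
    by (rule ex_borel_representative[OF assms], rule that)
  then have "potential f = potential f'" by (intro potential_cong_AE)
  also have "potential f' \<in> borel_measurable borel"
    unfolding potential_def[abs_def] nn_integral_completion by measurable
  finally show ?thesis .
qed

lemma potential_measurable [measurable (raw)]:
  "f \<in> borel_measurable lebesgue \<Longrightarrow> potential f \<in> borel_measurable lebesgue"
  using potential_borel_measurable by (intro measurable_completion) simp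

lemma kernel_translate_measurable [measurable]: "(\<lambda>y. kernel (x - y)) \<in> borel_measurable lebesgue"
  by (rule measurable_completion) simp

lemma potential_add:
  assumes "f \<in> borel_measurable lebesgue" "g \<in> borel_measurable lebesgue"
  shows "potential (\<lambda>y. f y + g y) x = potential f x + potential g x"
  unfolding potential_def distrib_left using assms by (intro nn_integral_add) auto

lemma potential_cmult:
  assumes "f \<in> borel_measurable lebesgue"
  shows "potential (\<lambda>y. c * f y) x = c * potential f x"
proof -
  have "potential (\<lambda>y. c * f y) x = (\<integral>\<^sup>+ y. c * (ennreal (kernel (x - y)) * f y) \<partial>lebesgue)"
    unfolding potential_def by (intro nn_integral_cong) (simp add: mult_ac)
  also have "\<dots> = c * potential f x"
    unfolding potential_def using assms by (intro nn_integral_cmult) auto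
  finally show ?thesis .
qed

lemma potential_mono: "(\<And>y. f y \<le> g y) \<Longrightarrow> potential f x \<le> potential g x"
  unfolding potential_def by (intro nn_integral_mono mult_left_mono) auto

lemma potential_symmetric:
  assumes f: "f \<in> borel_measurable lebesgue" and h: "h \<in> borel_measurable lebesgue"
  shows "(\<integral>\<^sup>+ x. potential f x * h x \<partial>lebesgue) = (\<integral>\<^sup>+ y. f y * potential h y \<partial>lebesgue)"
proof -
  obtain f' where f' [measurable]: "f' \<in> borel_measurable borel" and f'2: "AE y in lebesgue. f y = f' y"
    by (rule ex_borel_representative[OF f], rule that)
  obtain h' where h' [measurable]: "h' \<in> borel_measurable borel" and h'2: "AE y in lebesgue. h y = h' y"
    by (rule ex_borel_representative[OF h], rule that)
  have "(\<integral>\<^sup>+ x. potential f x * h x \<partial>lebesgue) = (\<integral>\<^sup>+ x. potential f' x * h' x \<partial>lebesgue)"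
    unfolding potential_cong_AE[OF f'2] using h'2 by (intro nn_integral_cong_AE) auto
  also have "\<dots> = (\<integral>\<^sup>+ x. (\<integral>\<^sup>+ y. ennreal (kernel (x - y)) * f' y * h' x \<partial>lborel) \<partial>lborel)"
    unfolding potential_def nn_integral_completion
    by (intro nn_integral_cong nn_integral_multc[symmetric]) simp
  also have "\<dots> = (\<integral>\<^sup>+ y. (\<integral>\<^sup>+ x. ennreal (kernel (x - y)) * f' y * h' x \<partial>lborel) \<partial>lborel)"
    by (rule lborel_pair.Fubini'[symmetric]) measurable
  also have "\<dots> = (\<integral>\<^sup>+ y. (\<integral>\<^sup>+ x. f' y * (ennreal (kernel (y - x)) * h' x) \<partial>lborel) \<partial>lborel)"
    by (intro nn_integral_cong) (metis kernel_minus mult.assoc mult.commute)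
  also have "\<dots> = (\<integral>\<^sup>+ y. f' y * potential h' y \<partial>lebesgue)"
    unfolding potential_def nn_integral_completion
    by (intro nn_integral_cong nn_integral_cmult) simp
  also have "\<dots> = (\<integral>\<^sup>+ y. f y * potential h y \<partial>lebesgue)"
    unfolding potential_cong_AE[OF h'2] using f'2 by (intro nn_integral_cong_AE) auto
  finally show ?thesis .
qed

lemma coulomb_energy_scale:
  assumes [measurable]: "u \<in> borel_measurable lebesgue"
  shows "energy (\<lambda>x. c * u x) = ennreal (\<bar>c\<bar> powr (2 * p)) * energy u"
proof -
  have "power_potential (\<lambda>x. c * u x) x = ennreal (\<bar>c\<bar> powr p) * power_potential u x" for x
    by (subst potential_cmult[symmetric]) (auto simp: abs_mult powr_mult ennreal_mult')
  then have "energy (\<lambda>x. c * u x) = (\<integral>\<^sup>+ x. (ennreal (\<bar>c\<bar> powr p))\<^sup>2 * (power_potential u x)\<^sup>2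
      \<partial>lebesgue)"
    by (simp add: coulomb_energy_eq power_mult_distrib)
  also have "\<dots> = (ennreal (\<bar>c\<bar> powr p))\<^sup>2 * energy u"
    unfolding coulomb_energy_eq by (intro nn_integral_cmult) measurable
  also have "(ennreal (\<bar>c\<bar> powr p))\<^sup>2 = ennreal (\<bar>c\<bar> powr (2 * p))"
  proof -
    have "(\<bar>c\<bar> powr p)\<^sup>2 = \<bar>c\<bar> powr (2 * p)"
      unfolding power2_eq_square powr_add[symmetric] by simp
    then show ?thesis by (simp add: ennreal_power)
  qed
  finally show ?thesis .
qed

lemma coulomb_energy_add_le:
  assumes [measurable]: "u \<in> borel_measurable lebesgue" "v \<in> borel_measurable lebesgue"
  shows "energy (\<lambda>x. u x + v x) \<le> ennreal (2 * 2 powr (2 * p)) * (energy u + energy v)"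
proof -
  let ?c = "ennreal (2 powr p)"
  have c2: "2 * ?c\<^sup>2 = ennreal (2 * 2 powr (2 * p))"
  proof -
    have "(2 powr p)\<^sup>2 = (2::real) powr (2 * p)"
      unfolding power2_eq_square powr_add[symmetric] by simp
    then show ?thesis by (simp add: ennreal_power ennreal_mult')
  qed
  have pt: "(power_potential (\<lambda>x. u x + v x) x)\<^sup>2
      \<le> ennreal (2 * 2 powr (2 * p)) * ((power_potential u x)\<^sup>2 + (power_potential v x)\<^sup>2)" for x
  proof -
    have "power_potential (\<lambda>x. u x + v x) x \<le> potential (\<lambda>y. ?c * ennreal (\<bar>u y\<bar> powr p)
        + ?c * ennreal (\<bar>v y\<bar> powr p)) x"
    proof (rule potential_mono)
      fix y
      have "ennreal (\<bar>u y + v y\<bar> powr p) \<le> ennreal (2 powr p * (\<bar>u y\<bar> powr p + \<bar>v y\<bar> powr p))"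
        using p by (intro ennreal_leI powr_add_le) auto
      then show "ennreal (\<bar>u y + v y\<bar> powr p)
          \<le> ?c * ennreal (\<bar>u y\<bar> powr p) + ?c * ennreal (\<bar>v y\<bar> powr p)"
        by (simp add: ennreal_mult' distrib_left)
    qed
    also have "\<dots> = ?c * power_potential u x + ?c * power_potential v x"
      by (subst potential_add) (auto simp: potential_cmult)
    finally have "(power_potential (\<lambda>x. u x + v x) x)\<^sup>2
        \<le> (?c * power_potential u x + ?c * power_potential v x)\<^sup>2"
      by (rule power_mono) simp
    also have "\<dots> \<le> 2 * (?c * power_potential u x)\<^sup>2 + 2 * (?c * power_potential v x)\<^sup>2"
      by (rule ennreal_power2_add_le)
    also have "\<dots> = 2 * ?c\<^sup>2 * ((power_potential u x)\<^sup>2 + (power_potential v x)\<^sup>2)"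
      by (simp add: power_mult_distrib distrib_left mult_ac)
    finally show ?thesis unfolding c2 .
  qed
  have "energy (\<lambda>x. u x + v x) \<le> (\<integral>\<^sup>+ x. ennreal (2 * 2 powr (2 * p)) * ((power_potential u x)\<^sup>2
      + (power_potential v x)\<^sup>2) \<partial>lebesgue)"
    unfolding coulomb_energy_eq by (intro nn_integral_mono pt)
  also have "\<dots> = ennreal (2 * 2 powr (2 * p)) * (energy u + energy v)"
    unfolding coulomb_energy_eq
    by (subst nn_integral_cmult, measurable, subst nn_integral_add, measurable)
  finally show ?thesis .
qed

text \<open>The kernel is bounded below on bounded sets, so the Coulomb energy controls the local
  \<open>L\<^sup>p\<close> norms.\<close>

lemma coulomb_energy_controls_ball:
  assumes R: "0 < R"
  obtains C where "0 \<le> C" "\<And>u. u \<in> borel_measurable lebesgue \<Longrightarrow>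
    (\<integral>\<^sup>+ y. indicator (cball 0 R) y * ennreal (\<bar>u y\<bar> powr p) \<partial>lebesgue)\<^sup>2 \<le> ennreal C * energy u"
proof -
  obtain c where c: "0 < c" "\<And>z. z \<noteq> 0 \<Longrightarrow> norm z \<le> 2 * R \<Longrightarrow> c \<le> kernel z"
    using R by (auto intro: kernel_lower_bound[of "2 * R"])
  define V where "V = measure lebesgue (cball (0 :: real ^ 'n) R)"
  have V: "0 < V" unfolding V_def by (rule measure_cball_pos[OF R])
  have emV: "emeasure lebesgue (cball (0 :: real ^ 'n) R) = ennreal V"
    unfolding V_def by (rule emeasure_eq_ennreal_measure) (use cball_emeasure_finite[of "0::real^'n"
        R] in auto)
  show thesis
  proof (rule that[of "1 / (V * c\<^sup>2)"])
    show "0 \<le> 1 / (V * c\<^sup>2)" using V by simp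
    fix u :: "real ^ 'n \<Rightarrow> real" assume [measurable]: "u \<in> borel_measurable lebesgue"
    let ?I = "\<integral>\<^sup>+ y. indicator (cball 0 R) y * ennreal (\<bar>u y\<bar> powr p) \<partial>lebesgue"
    have pt: "indicator (cball 0 R) x * (ennreal c * ?I)\<^sup>2 \<le> (power_potential u x)\<^sup>2" for x
    proof (cases "norm x \<le> R")
      case True
      have "ennreal c * ?I = (\<integral>\<^sup>+ y. ennreal c * (indicator (cball 0 R) y * ennreal (\<bar>u y\<bar> powr p))
          \<partial>lebesgue)"
        by (rule nn_integral_cmult[symmetric]) measurable
      also have "\<dots> \<le> power_potential u x"
        unfolding potential_def
      proof (rule nn_integral_mono_AE)
        have "AE y in lebesgue. y \<noteq> x" by (rule AE_completion[OF AE_lborel_singleton])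
        then show "AE y in lebesgue. ennreal c * (indicator (cball 0 R) y * ennreal (\<bar>u y\<bar> powr p))
            \<le> ennreal (kernel (x - y)) * ennreal (\<bar>u y\<bar> powr p)"
        proof eventually_elim
          fix y assume y: "y \<noteq> x"
          show "ennreal c * (indicator (cball 0 R) y * ennreal (\<bar>u y\<bar> powr p))
              \<le> ennreal (kernel (x - y)) * ennreal (\<bar>u y\<bar> powr p)"
          proof (cases "norm y \<le> R")
            case yR: True
            then have "c \<le> kernel (x - y)"
              using y True norm_triangle_ineq4[of x y] by (intro c(2)) auto
            then show ?thesis using yR by (auto intro!: mult_right_mono ennreal_leI)
          qed simp
        qed
      qed
      finally show ?thesis using True by (auto intro!: power_mono)
    qed simp
    have "ennreal V * (ennreal c * ?I)\<^sup>2 = (\<integral>\<^sup>+ x. indicator (cball (0::real^'n) R) x * (ennreal c *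
        ?I)\<^sup>2 \<partial>lebesgue)"
      by (subst nn_integral_multc) (auto simp: emV)
    also have "\<dots> \<le> energy u"
      unfolding coulomb_energy_eq by (intro nn_integral_mono pt)
    finally have "ennreal (1 / (V * c\<^sup>2)) * (ennreal V * (ennreal c * ?I)\<^sup>2)
        \<le> ennreal (1 / (V * c\<^sup>2)) * energy u"
      by (rule mult_left_mono) simp
    moreover have "ennreal (1 / (V * c\<^sup>2)) * (ennreal V * (ennreal c * ?I)\<^sup>2) = ?I\<^sup>2"
    proof -
      have "ennreal (1 / (V * c\<^sup>2)) * (ennreal V * (ennreal c * ?I)\<^sup>2)
          = (ennreal (1 / (V * c\<^sup>2)) * ennreal V * ennreal (c\<^sup>2)) * ?I\<^sup>2"
        using c(1) by (simp add: power_mult_distrib ennreal_power mult_ac)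
      also have "ennreal (1 / (V * c\<^sup>2)) * ennreal V * ennreal (c\<^sup>2) = 1"
        using V c(1) by (simp flip: ennreal_mult')
      finally show ?thesis by simp
    qed
    ultimately show "?I\<^sup>2 \<le> ennreal (1 / (V * c\<^sup>2)) * energy u" by simp
  qed
qed

text \<open>Fatou's lemma is applied twice, inside the potential and to the integral of its square.\<close>

lemma coulomb_energy_Fatou:
  assumes u [measurable]: "u \<in> borel_measurable lebesgue" and v [measurable]: "\<And>j. v j
      \<in> borel_measurable lebesgue"
    and lim: "AE x in lebesgue. (\<lambda>j. v j x) \<longlonglongrightarrow> u x" and B: "\<And>j. energy (v j) \<le> B"
  shows "energy u \<le> B"
proof -
  have G: "power_potential u x \<le> liminf (\<lambda>j. power_potential (v j) x)" for x
  proof -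
    have "power_potential u x = (\<integral>\<^sup>+ y. liminf (\<lambda>j. ennreal (kernel (x - y)) * ennreal (\<bar>v j y\<bar> powr
        p)) \<partial>lebesgue)"
      unfolding potential_def
    proof (rule nn_integral_cong_AE)
      show "AE y in lebesgue. ennreal (kernel (x - y)) * ennreal (\<bar>u y\<bar> powr p)
          = liminf (\<lambda>j. ennreal (kernel (x - y)) * ennreal (\<bar>v j y\<bar> powr p))"
        using lim
      proof eventually_elim
        fix y assume "(\<lambda>j. v j y) \<longlonglongrightarrow> u y"
        then have "(\<lambda>j. \<bar>v j y\<bar> powr p) \<longlonglongrightarrow> \<bar>u y\<bar> powr p"
          using p by (intro tendsto_intros) auto
        then have "(\<lambda>j. ennreal (kernel (x - y)) * ennreal (\<bar>v j y\<bar> powr p))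
            \<longlonglongrightarrow> ennreal (kernel (x - y)) * ennreal (\<bar>u y\<bar> powr p)"
          by (intro tendsto_mult_ennreal tendsto_const tendsto_ennrealI) auto
        from lim_imp_Liminf[OF _ this]
        show "ennreal (kernel (x - y)) * ennreal (\<bar>u y\<bar> powr p)
            = liminf (\<lambda>j. ennreal (kernel (x - y)) * ennreal (\<bar>v j y\<bar> powr p))" by simp
      qed
    qed
    also have "\<dots> \<le> liminf (\<lambda>j. power_potential (v j) x)"
      unfolding potential_def by (rule nn_integral_liminf) measurable
    finally show ?thesis .
  qed
  have "energy u \<le> (\<integral>\<^sup>+ x. liminf (\<lambda>j. (power_potential (v j) x)\<^sup>2) \<partial>lebesgue)"
    unfolding coulomb_energy_eq by (intro nn_integral_mono ennreal_liminf_power2_ge G)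
  also have "\<dots> \<le> liminf (\<lambda>j. energy (v j))"
    unfolding coulomb_energy_eq by (rule nn_integral_liminf) measurable
  also have "\<dots> \<le> B"
    by (rule Liminf_le) (use B in auto)
  finally show ?thesis .
qed

lemma power_potential_finite_AE:
  assumes [measurable]: "u \<in> borel_measurable lebesgue" and fin: "energy u < \<infinity>"
  shows "AE x in lebesgue. power_potential u x < \<infinity>"
proof -
  have "AE x in lebesgue. (power_potential u x)\<^sup>2 \<noteq> \<infinity>"
    using fin unfolding coulomb_energy_eq by (intro nn_integral_PInf_AE) auto
  then show ?thesis
  proof eventually_elim
    fix x assume "(power_potential u x)\<^sup>2 \<noteq> \<infinity>"
    then show "power_potential u x < \<infinity>"
      by (cases "power_potential u x = top") (auto simp: power2_eq_square less_top)
  qed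
qed

text \<open>Integrating the pointwise inequality against the kernel and then squaring makes
  the convexity defect \<open>h - m\<close> of the potentials appear, with \<open>h\<close> the mean of the potentials and \<open>m\<close> the
  potential at the midpoint; since \<open>(h - m)\<^sup>2 \<le> h\<^sup>2 - m\<^sup>2\<close> for
  \<open>0 \<le> m \<le> h\<close>, it is controlled by the convexity defect of the energy.\<close>

lemma coulomb_energy_uniform_convexity_aux:
  assumes \<epsilon>: "0 < \<epsilon>"
  obtains C where "\<forall>u v. u \<in> borel_measurable lebesgue \<longrightarrow> v \<in> borel_measurable lebesgue \<longrightarrow>
      energy u < \<infinity> \<longrightarrow> energy v < \<infinity> \<longrightarrow>
      energy (\<lambda>x. u x - v x) + ennreal (2 * C\<^sup>2) * energy (\<lambda>x. (u x + v x) / 2)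
        \<le> ennreal (4 * \<epsilon>\<^sup>2 + C\<^sup>2) * (energy u + energy v) \<and>
      energy (\<lambda>x. (u x + v x) / 2) \<le> ennreal (1/2) * (energy u + energy v)"
proof -
  obtain C where C: "0 \<le> C"
    "\<And>a b. \<bar>a - b\<bar> powr p \<le> \<epsilon> * (\<bar>a\<bar> powr p + \<bar>b\<bar> powr p) + C * powr_defect p a b"
    by (rule powr_uniform_convexity[OF p \<epsilon>], rule that)
  have both: "energy (\<lambda>x. u x - v x) + ennreal (2 * C\<^sup>2) * energy (\<lambda>x. (u x + v x) / 2)
        \<le> ennreal (4 * \<epsilon>\<^sup>2 + C\<^sup>2) * (energy u + energy v)"
     "energy (\<lambda>x. (u x + v x) / 2) \<le> ennreal (1/2) * (energy u + energy v)"
    if uv: "u \<in> borel_measurable lebesgue" "v \<in> borel_measurable lebesgue"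
      "energy u < \<infinity>" "energy v < \<infinity>" for u v
  proof -
    note [measurable] = uv(1,2)
    define U where "U = power_potential u"
    define W where "W = power_potential v"
    define M where "M = power_potential (\<lambda>x. (u x + v x) / 2)"
    define D where "D = power_potential (\<lambda>x. u x - v x)"
    have [measurable]: "U \<in> borel_measurable lebesgue" "W \<in> borel_measurable lebesgue"
      "M \<in> borel_measurable lebesgue" "D \<in> borel_measurable lebesgue"
      unfolding U_def W_def M_def D_def by measurable
    have ineq1: "D x + ennreal C * M x \<le> ennreal (\<epsilon> + C / 2) * (U x + W x)" for x
    proof -
      have "D x + ennreal C * M x = potential (\<lambda>y. ennreal (\<bar>u y - v y\<bar> powr p)
          + ennreal C * ennreal (\<bar>(u y + v y) / 2\<bar> powr p)) x"
        unfolding D_def M_def by (subst potential_add) (auto simp: potential_cmult)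
      also have "\<dots> \<le> potential (\<lambda>y. ennreal (\<epsilon> + C / 2) * (ennreal (\<bar>u y\<bar> powr p)
          + ennreal (\<bar>v y\<bar> powr p))) x"
      proof (rule potential_mono)
        fix y
        have "\<bar>u y - v y\<bar> powr p + C * \<bar>(u y + v y) / 2\<bar> powr p
            \<le> (\<epsilon> + C / 2) * (\<bar>u y\<bar> powr p + \<bar>v y\<bar> powr p)"
          using C(2)[of "u y" "v y"] by (simp add: powr_defect_def algebra_simps add_divide_distrib)
        then have "ennreal (\<bar>u y - v y\<bar> powr p + C * \<bar>(u y + v y) / 2\<bar> powr p)
            \<le> ennreal ((\<epsilon> + C / 2) * (\<bar>u y\<bar> powr p + \<bar>v y\<bar> powr p))"
          by (rule ennreal_leI)
        then show "ennreal (\<bar>u y - v y\<bar> powr p) + ennreal C * ennreal (\<bar>(u y + v y) / 2\<bar> powr p)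
            \<le> ennreal (\<epsilon> + C / 2) * (ennreal (\<bar>u y\<bar> powr p) + ennreal (\<bar>v y\<bar> powr p))"
          using C(1) \<epsilon> by (simp add: ennreal_mult)
      qed
      also have "\<dots> = ennreal (\<epsilon> + C / 2) * (U x + W x)"
        unfolding U_def W_def by (subst potential_cmult, measurable, subst potential_add) auto
      finally show ?thesis .
    qed
    have ineq2: "M x \<le> ennreal (1/2) * (U x + W x)" for x
    proof -
      have "M x \<le> potential (\<lambda>y. ennreal (1/2) * (ennreal (\<bar>u y\<bar> powr p) + ennreal (\<bar>v y\<bar> powr p))) x"
        unfolding M_def
      proof (rule potential_mono)
        fix y
        have "ennreal (\<bar>(u y + v y) / 2\<bar> powr p) \<le> ennreal ((1/2) * (\<bar>u y\<bar> powr p + \<bar>v y\<bar> powr p))"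
          using powr_defect_nonneg[OF p, of "u y" "v y"]
              by (intro ennreal_leI) (simp add: powr_defect_def)
        also have "\<dots> = ennreal (1/2) * (ennreal (\<bar>u y\<bar> powr p) + ennreal (\<bar>v y\<bar> powr p))"
          by (subst ennreal_mult) auto
        finally show "ennreal (\<bar>(u y + v y) / 2\<bar> powr p)
            \<le> ennreal (1/2) * (ennreal (\<bar>u y\<bar> powr p) + ennreal (\<bar>v y\<bar> powr p))" .
      qed
      also have "\<dots> = ennreal (1/2) * (U x + W x)"
        unfolding U_def W_def by (subst potential_cmult, measurable, subst potential_add) auto
      finally show ?thesis .
    qed
    have fin: "AE x in lebesgue. U x < \<infinity> \<and> W x < \<infinity>"
      using power_potential_finite_AE[OF uv(1,3)] power_potential_finite_AE[OF uv(2,4)]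
      unfolding U_def W_def by eventually_elim simp
    have sq: "(D x)\<^sup>2 + ennreal (2 * C\<^sup>2) * (M x)\<^sup>2 \<le> ennreal (4 * \<epsilon>\<^sup>2 + C\<^sup>2) * ((U x)\<^sup>2 + (W x)\<^sup>2)
        \<and> (M x)\<^sup>2 \<le> ennreal (1/2) * ((U x)\<^sup>2 + (W x)\<^sup>2)" if x: "U x < \<infinity>" "W x < \<infinity>" for x
    proof -
      obtain a b where ab: "0 \<le> a" "0 \<le> b" "U x = ennreal a" "W x = ennreal b"
        using x by (cases "U x"; cases "W x") auto
      have "M x \<le> ennreal ((a + b) / 2)"
      proof -
        have "ennreal ((1/2) * (a + b)) = ennreal (1/2) * (ennreal a + ennreal b)"
          using ab by (subst ennreal_mult) auto
        then show ?thesis using ineq2[of x] ab by simp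
      qed
      then obtain m where m: "0 \<le> m" "M x = ennreal m" "m \<le> (a + b) / 2"
        using ab by (cases "M x") (auto simp: top_unique)
      have "D x + ennreal (C * m) \<le> ennreal ((\<epsilon> + C / 2) * (a + b))"
        using ineq1[of x] ab m C(1) \<epsilon> by (simp add: ennreal_mult)
      then obtain d where d: "0 \<le> d" "D x = ennreal d" "d + C * m \<le> (\<epsilon> + C / 2) * (a + b)"
        using ab m(1) C(1) \<epsilon> by (cases "D x") (auto simp: top_unique simp flip: ennreal_plus)
      define h where "h = (a + b) / 2"
      have "d \<le> \<epsilon> * (a + b) + C * (h - m)" using d(3) by (simp add: h_def algebra_simps)
      then have "d\<^sup>2 \<le> (\<epsilon> * (a + b) + C * (h - m))\<^sup>2" using d(1) by (rule power_mono)
      also have "\<dots> \<le> 2 * (\<epsilon> * (a + b))\<^sup>2 + 2 * (C * (h - m))\<^sup>2"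
      proof -
        have "0 \<le> (\<epsilon> * (a + b) - C * (h - m))\<^sup>2" by simp
        then show ?thesis by (simp add: power2_sum power2_diff)
      qed
      also have "\<dots> \<le> 4 * \<epsilon>\<^sup>2 * (a\<^sup>2 + b\<^sup>2) + C\<^sup>2 * (a\<^sup>2 + b\<^sup>2) - 2 * C\<^sup>2 * m\<^sup>2"
      proof -
        have s: "(a + b)\<^sup>2 \<le> 2 * (a\<^sup>2 + b\<^sup>2)"
          using zero_le_power2[of "a - b"] by (simp add: power2_sum power2_diff)
        have "(h - m)\<^sup>2 \<le> h\<^sup>2 - m\<^sup>2"
        proof -
          have "m \<le> h" using m(3) by (simp add: h_def)
          then have "0 \<le> m * (h - m)" using m(1) by simp
          then show ?thesis by (simp add: power2_eq_square algebra_simps)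
        qed
        also have "h\<^sup>2 \<le> (a\<^sup>2 + b\<^sup>2) / 2" using s by (simp add: h_def power_divide)
        finally have "(h - m)\<^sup>2 \<le> (a\<^sup>2 + b\<^sup>2) / 2 - m\<^sup>2" by simp
        from mult_left_mono[OF this, of "2 * C\<^sup>2"] mult_left_mono[OF s, of "2 * \<epsilon>\<^sup>2"]
        show ?thesis unfolding power_mult_distrib by (simp add: algebra_simps)
      qed
      finally have r1: "d\<^sup>2 + 2 * C\<^sup>2 * m\<^sup>2 \<le> (4 * \<epsilon>\<^sup>2 + C\<^sup>2) * (a\<^sup>2 + b\<^sup>2)" by (simp add: algebra_simps)
      have "m\<^sup>2 \<le> ((a + b) / 2)\<^sup>2" using m by (intro power_mono)
      also have "\<dots> \<le> (1/2) * (a\<^sup>2 + b\<^sup>2)"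
        using zero_le_power2[of "a - b"] by (simp add: power2_sum power2_diff power_divide)
      finally have r2: "m\<^sup>2 \<le> (1/2) * (a\<^sup>2 + b\<^sup>2)" .
      have half: "ennreal ((1/2) * (a\<^sup>2 + b\<^sup>2)) = ennreal (1/2) * (ennreal (a\<^sup>2) + ennreal (b\<^sup>2))"
        by (subst ennreal_mult) auto
      have "(M x)\<^sup>2 \<le> ennreal (1/2) * ((U x)\<^sup>2 + (W x)\<^sup>2)"
        using ennreal_leI[OF r2] ab m unfolding half by (simp add: ennreal_power)
      moreover have "(D x)\<^sup>2 + ennreal (2 * C\<^sup>2) * (M x)\<^sup>2
          \<le> ennreal (4 * \<epsilon>\<^sup>2 + C\<^sup>2) * ((U x)\<^sup>2 + (W x)\<^sup>2)"
        using ennreal_leI[OF r1] ab m d by (simp add: ennreal_power ennreal_mult)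
      ultimately show ?thesis by blast
    qed
    have "energy (\<lambda>x. u x - v x) + ennreal (2 * C\<^sup>2) * energy (\<lambda>x. (u x + v x) / 2)
        = (\<integral>\<^sup>+ x. (D x)\<^sup>2 + ennreal (2 * C\<^sup>2) * (M x)\<^sup>2 \<partial>lebesgue)"
      unfolding coulomb_energy_eq D_def[symmetric] M_def[symmetric]
      by (subst nn_integral_add, measurable, subst nn_integral_cmult) auto
    also have "\<dots> \<le> (\<integral>\<^sup>+ x. ennreal (4 * \<epsilon>\<^sup>2 + C\<^sup>2) * ((U x)\<^sup>2 + (W x)\<^sup>2) \<partial>lebesgue)"
      by (intro nn_integral_mono_AE eventually_mono[OF fin]) (use sq in blast)
    also have "\<dots> = ennreal (4 * \<epsilon>\<^sup>2 + C\<^sup>2) * (energy u + energy v)"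
      unfolding coulomb_energy_eq U_def[symmetric] W_def[symmetric]
      by (subst nn_integral_cmult, measurable, subst nn_integral_add) auto
    finally show "energy (\<lambda>x. u x - v x) + ennreal (2 * C\<^sup>2) * energy (\<lambda>x. (u x + v x) / 2)
        \<le> ennreal (4 * \<epsilon>\<^sup>2 + C\<^sup>2) * (energy u + energy v)" .
    have "energy (\<lambda>x. (u x + v x) / 2) \<le> (\<integral>\<^sup>+ x. ennreal (1/2) * ((U x)\<^sup>2 + (W x)\<^sup>2) \<partial>lebesgue)"
      unfolding coulomb_energy_eq M_def[symmetric]
      by (intro nn_integral_mono_AE eventually_mono[OF fin]) (use sq in blast)
    also have "\<dots> = ennreal (1/2) * (energy u + energy v)"
      unfolding coulomb_energy_eq U_def[symmetric] W_def[symmetric]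
      by (subst nn_integral_cmult, measurable, subst nn_integral_add) auto
    finally show "energy (\<lambda>x. (u x + v x) / 2) \<le> ennreal (1/2) * (energy u + energy v)" .
  qed
  then show thesis by (intro that[of C]) blast
qed

end

section \<open>The space and its energy\<close>

context coulomb_exponents
begin

abbreviation E :: "(real ^ 'n \<Rightarrow> real) set" where
  "E \<equiv> coulomb_sobolev \<alpha> p"

definition gradient_energy :: "(real ^ 'n \<Rightarrow> real) \<Rightarrow> real" where
  "gradient_energy u = (\<integral>x. (norm (weak_gradient u x))\<^sup>2 \<partial>lebesgue)"

text \<open>The sum of the two energies, without the roots in the norm, is what has an elementary
  convexity defect.\<close>

definition total_energy :: "(real ^ 'n \<Rightarrow> real) \<Rightarrow> real" where
  "total_energy u = gradient_energy u + enn2real (energy u)"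

lemma space_measurable: "u \<in> E \<Longrightarrow> u \<in> borel_measurable lebesgue"
  by (simp add: coulomb_sobolev_def)

lemma space_weakly_differentiable: "u \<in> E \<Longrightarrow> weakly_differentiable u"
  by (simp add: coulomb_sobolev_def)

lemma space_has_weak_gradient: "u \<in> E \<Longrightarrow> has_weak_gradient u (weak_gradient u)"
  by (simp add: space_weakly_differentiable has_weak_gradient_weak_gradient)

lemma space_locally_integrable:
  "u \<in> E \<Longrightarrow> locally_integrable u" "u \<in> E \<Longrightarrow> locally_integrable (weak_gradient u)"
  using space_has_weak_gradient by (auto simp: has_weak_gradient_def)

lemma space_gradient_measurable: "u \<in> E \<Longrightarrow> weak_gradient u \<in> borel_measurable lebesgue"
  by (simp add: space_weakly_differentiable weak_gradient_measurable)

lemma space_gradient_square_integrable: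
  assumes "u \<in> E" shows "integrable lebesgue (\<lambda>x. (norm (weak_gradient u x))\<^sup>2)"
proof (rule integrableI_bounded)
  show "(\<lambda>x. (norm (weak_gradient u x))\<^sup>2) \<in> borel_measurable lebesgue"
    using space_gradient_measurable[OF assms] by measurable
  show "(\<integral>\<^sup>+ x. ennreal (norm ((norm (weak_gradient u x))\<^sup>2)) \<partial>lebesgue) < \<infinity>"
    using assms by (simp add: coulomb_sobolev_def dirichlet_energy_def)
qed

lemma dirichlet_energy_eq: "u \<in> E \<Longrightarrow> dirichlet_energy u = ennreal (gradient_energy u)"
  unfolding dirichlet_energy_def gradient_energy_def
  by (rule nn_integral_eq_integral) (auto simp: space_gradient_square_integrable)

lemma energy_eq: "u \<in> E \<Longrightarrow> energy u = ennreal (enn2real (energy u))"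
  by (simp add: coulomb_sobolev_def)

lemma gradient_energy_nonneg: "0 \<le> gradient_energy u"
  unfolding gradient_energy_def by (rule integral_nonneg_AE) simp

lemma total_energy_nonneg: "0 \<le> total_energy u"
  by (simp add: total_energy_def gradient_energy_nonneg)

lemma norm_eq:
  assumes "u \<in> E"
  shows "coulomb_sobolev_norm \<alpha> p u = sqrt (gradient_energy u + enn2real (energy u) powr (1 / p))"
  unfolding coulomb_sobolev_norm_def dirichlet_energy_eq[OF assms]
  by (simp add: gradient_energy_nonneg)

lemma gradient_energy_lincomb:
  assumes "u \<in> E" "v \<in> E"
  shows "dirichlet_energy (\<lambda>x. a * u x + b * v x)
    = ennreal (\<integral>x. (norm (a *\<^sub>R weak_gradient u x + b *\<^sub>R weak_gradient v x))\<^sup>2 \<partial>lebesgue)" (is "_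
        = ennreal ?J")
    and "integrable lebesgue (\<lambda>x. (norm (a *\<^sub>R weak_gradient u x + b *\<^sub>R weak_gradient v x))\<^sup>2)"
    and "gradient_energy (\<lambda>x. a * u x + b * v x)
      = (\<integral>x. (norm (a *\<^sub>R weak_gradient u x + b *\<^sub>R weak_gradient v x))\<^sup>2 \<partial>lebesgue)"
proof -
  note [measurable] = space_gradient_measurable[OF assms(1)] space_gradient_measurable[OF assms(2)]
  note ae = weak_gradient_lincomb[OF assms[THEN space_weakly_differentiable], of a b]
  note [measurable] = weak_gradient_measurable[OF weakly_differentiable_lincomb[OF assms[THEN
      space_weakly_differentiable], of a b]]
  have i: "integrable lebesgue (\<lambda>x. 2 * a\<^sup>2 * (norm (weak_gradient u x))\<^sup>2
      + 2 * b\<^sup>2 * (norm (weak_gradient v x))\<^sup>2)"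
    using assms[THEN space_gradient_square_integrable] by auto
  have le: "(norm (a *\<^sub>R g + b *\<^sub>R h))\<^sup>2 \<le> 2 * a\<^sup>2 * (norm g)\<^sup>2
      + 2 * b\<^sup>2 * (norm h)\<^sup>2" for g h :: "real ^ 'n"
  proof -
    have "norm (a *\<^sub>R g + b *\<^sub>R h) \<le> \<bar>a\<bar> * norm g + \<bar>b\<bar> * norm h"
      using norm_triangle_ineq[of "a *\<^sub>R g" "b *\<^sub>R h"] by simp
    then have "(norm (a *\<^sub>R g + b *\<^sub>R h))\<^sup>2 \<le> (\<bar>a\<bar> * norm g + \<bar>b\<bar> * norm h)\<^sup>2" by (rule power_mono) simp
    also have "\<dots> \<le> 2 * a\<^sup>2 * (norm g)\<^sup>2 + 2 * b\<^sup>2 * (norm h)\<^sup>2"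
      using zero_le_power2[of "\<bar>a\<bar> * norm g - \<bar>b\<bar> * norm h"]
          by (simp add: power2_sum power2_diff power_mult_distrib)
    finally show ?thesis .
  qed
  show int: "integrable lebesgue (\<lambda>x. (norm (a *\<^sub>R weak_gradient u x + b *\<^sub>R weak_gradient v x))\<^sup>2)"
    by (rule Bochner_Integration.integrable_bound[OF i]) (use le in \<open>auto intro!: AE_I2 intro:
        order_trans abs_ge_self\<close>)
  have "dirichlet_energy (\<lambda>x. a * u x + b * v x)
     = (\<integral>\<^sup>+x. ennreal ((norm (a *\<^sub>R weak_gradient u x + b *\<^sub>R weak_gradient v x))\<^sup>2) \<partial>lebesgue)"
    unfolding dirichlet_energy_def using ae by (intro nn_integral_cong_AE) auto
  also have "\<dots> = ennreal ?J" by (rule nn_integral_eq_integral[OF int]) simp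
  finally show "dirichlet_energy (\<lambda>x. a * u x + b * v x) = ennreal ?J" .
  show "gradient_energy (\<lambda>x. a * u x + b * v x) = ?J"
    unfolding gradient_energy_def
  proof (rule integral_cong_AE)
    show "AE x in lebesgue. (norm (weak_gradient (\<lambda>x. a * u x + b * v x) x))\<^sup>2
        = (norm (a *\<^sub>R weak_gradient u x + b *\<^sub>R weak_gradient v x))\<^sup>2"
      using ae by eventually_elim simp
  qed measurable
qed

lemma energy_lincomb_le:
  assumes "u \<in> borel_measurable lebesgue" "v \<in> borel_measurable lebesgue"
  shows "energy (\<lambda>x. a * u x + b * v x)
    \<le> ennreal (2 * 2 powr (2 * p)) * (ennreal (\<bar>a\<bar> powr (2 * p)) * energy u
        + ennreal (\<bar>b\<bar> powr (2 * p)) * energy v)"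
  using coulomb_energy_add_le[of "\<lambda>x. a * u x" "\<lambda>x. b * v x"] assms
  by (simp add: coulomb_energy_scale)

lemma space_lincomb:
  assumes "u \<in> E" "v \<in> E"
  shows "(\<lambda>x. a * u x + b * v x) \<in> E"
proof -
  note [measurable] = assms[THEN space_measurable]
  have "energy (\<lambda>x. a * u x + b * v x)
    \<le> ennreal (2 * 2 powr (2 * p)) * (ennreal (\<bar>a\<bar> powr (2 * p)) * energy u
        + ennreal (\<bar>b\<bar> powr (2 * p)) * energy v)"
    by (rule energy_lincomb_le) measurable
  also have "\<dots> < \<infinity>"
    using assms by (simp add: coulomb_sobolev_def ennreal_mult_less_top)
  finally have "energy (\<lambda>x. a * u x + b * v x) < \<infinity>" .
  moreover have "(\<lambda>x. a * u x + b * v x) \<in> borel_measurable lebesgue" by measurable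
  ultimately show ?thesis
    using weakly_differentiable_lincomb[OF assms[THEN space_weakly_differentiable], of a b]
        gradient_energy_lincomb(1)[OF assms, of a b]
    by (simp add: coulomb_sobolev_def)
qed

lemma space_diff: "u \<in> E \<Longrightarrow> v \<in> E \<Longrightarrow> (\<lambda>x. u x - v x) \<in> E"
  using space_lincomb[of u v 1 "-1"] by simp

lemma space_midpoint: "u \<in> E \<Longrightarrow> v \<in> E \<Longrightarrow> (\<lambda>x. (u x + v x) / 2) \<in> E"
  using space_lincomb[of u v "1/2" "1/2"] by (simp add: add_divide_distrib)

lemma gradient_energy_diff:
  "u \<in> E \<Longrightarrow> v \<in> E \<Longrightarrow>
    gradient_energy (\<lambda>x. u x - v x) = (\<integral>x. (norm (weak_gradient u x - weak_gradient v x))\<^sup>2 \<partial>lebesgue)"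
  using gradient_energy_lincomb(3)[of u v 1 "-1"] by simp

lemma gradient_inner_integrable:
  assumes "u \<in> E" "v \<in> E"
  shows "integrable lebesgue (\<lambda>x. weak_gradient u x \<bullet> weak_gradient v x)"
proof (rule Bochner_Integration.integrable_bound)
  note [measurable] = assms[THEN space_gradient_measurable]
  show "integrable lebesgue (\<lambda>x. (norm (weak_gradient u x))\<^sup>2 + (norm (weak_gradient v x))\<^sup>2)"
    using assms[THEN space_gradient_square_integrable] by auto
  show "(\<lambda>x. weak_gradient u x \<bullet> weak_gradient v x) \<in> borel_measurable lebesgue" by measurable
  show "AE x in lebesgue. norm (weak_gradient u x \<bullet> weak_gradient v x)
      \<le> norm ((norm (weak_gradient u x))\<^sup>2 + (norm (weak_gradient v x))\<^sup>2)"
  proof (rule AE_I2)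
    fix x
    let ?a = "norm (weak_gradient u x)" and ?b = "norm (weak_gradient v x)"
    have "\<bar>weak_gradient u x \<bullet> weak_gradient v x\<bar> \<le> ?a * ?b" by (rule Cauchy_Schwarz_ineq2)
    also have "\<dots> \<le> ?a\<^sup>2 + ?b\<^sup>2"
    proof -
      have "0 \<le> ?a * ?b" by simp
      then show ?thesis using zero_le_power2[of "?a - ?b"] unfolding power2_diff by linarith
    qed
    finally show "norm (weak_gradient u x \<bullet> weak_gradient v x) \<le> norm (?a\<^sup>2 + ?b\<^sup>2)" by simp
  qed
qed

lemma gradient_energy_diff_expand:
  assumes "u \<in> E" "v \<in> E"
  shows "gradient_energy (\<lambda>x. u x - v x) = gradient_energy u + gradient_energy v
    - 2 * (\<integral>x. weak_gradient u x \<bullet> weak_gradient v x \<partial>lebesgue)"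
proof -
  have "gradient_energy (\<lambda>x. u x - v x) = (\<integral>x. (norm (weak_gradient u x))\<^sup>2
      + (norm (weak_gradient v x))\<^sup>2
      - 2 * (weak_gradient u x \<bullet> weak_gradient v x) \<partial>lebesgue)"
    unfolding gradient_energy_diff[OF assms]
    by (simp add: power2_norm_eq_inner inner_diff algebra_simps inner_commute)
  then show ?thesis
    using assms[THEN space_gradient_square_integrable] gradient_inner_integrable[OF assms]
    by (simp add: gradient_energy_def)
qed

lemma gradient_energy_parallelogram:
  assumes "u \<in> E" "v \<in> E"
  shows "gradient_energy (\<lambda>x. u x - v x) + 4 * gradient_energy (\<lambda>x. (u x + v x) / 2)
      = 2 * gradient_energy u + 2 * gradient_energy v"
proof -
  have "gradient_energy (\<lambda>x. (u x + v x) / 2)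
      = (\<integral>x. (norm ((1/2) *\<^sub>R weak_gradient u x + (1/2) *\<^sub>R weak_gradient v x))\<^sup>2 \<partial>lebesgue)"
    using gradient_energy_lincomb(3)[OF assms, of "1/2" "1/2"] by (simp add: add_divide_distrib)
  also have "\<dots> = (\<integral>x. (1/4) * ((norm (weak_gradient u x))\<^sup>2 + (norm (weak_gradient v x))\<^sup>2
      + 2 * (weak_gradient u x \<bullet> weak_gradient v x)) \<partial>lebesgue)"
    unfolding power2_norm_eq_inner
    by (intro Bochner_Integration.integral_cong) (auto simp: inner_add inner_commute algebra_simps)
  also have "\<dots> = (1/4) * (gradient_energy u + gradient_energy v
      + 2 * (\<integral>x. weak_gradient u x \<bullet> weak_gradient v x \<partial>lebesgue))"
    using assms[THEN space_gradient_square_integrable] gradient_inner_integrable[OF assms]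
    by (simp add: gradient_energy_def)
  finally show ?thesis using gradient_energy_diff_expand[OF assms] by simp
qed

definition coulomb_defect :: "(real ^ 'n \<Rightarrow> real) \<Rightarrow> (real ^ 'n \<Rightarrow> real) \<Rightarrow> real" where
  "coulomb_defect u v = (enn2real (energy u) + enn2real (energy v)) / 2 - enn2real (energy (\<lambda>x. (u x
      + v x) / 2))"

lemma coulomb_energy_uniform_convexity:
  assumes \<epsilon>: "0 < \<epsilon>"
  obtains C where "\<And>u v. u \<in> E \<Longrightarrow> v \<in> E \<Longrightarrow>
      enn2real (energy (\<lambda>x. u x - v x)) \<le> 4 * \<epsilon>\<^sup>2 * (enn2real (energy u) + enn2real (energy v))
          + 2 * C\<^sup>2 * coulomb_defect u v"
    "\<And>u v. u \<in> E \<Longrightarrow> v \<in> E \<Longrightarrow> 0 \<le> coulomb_defect u v"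
proof -
  obtain C where C: "\<forall>u v. u \<in> borel_measurable lebesgue \<longrightarrow> v \<in> borel_measurable lebesgue \<longrightarrow>
      energy u < \<infinity> \<longrightarrow> energy v < \<infinity> \<longrightarrow>
      energy (\<lambda>x. u x - v x) + ennreal (2 * C\<^sup>2) * energy (\<lambda>x. (u x + v x) / 2)
        \<le> ennreal (4 * \<epsilon>\<^sup>2 + C\<^sup>2) * (energy u + energy v) \<and>
      energy (\<lambda>x. (u x + v x) / 2) \<le> ennreal (1/2) * (energy u + energy v)"
    using coulomb_energy_uniform_convexity_aux[OF \<epsilon>] .
  show thesis
  proof (rule that[of C])
    fix u v assume uv: "u \<in> E" "v \<in> E"
    define a where "a = enn2real (energy u)"
    define b where "b = enn2real (energy v)"
    define m where "m = enn2real (energy (\<lambda>x. (u x + v x) / 2))"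
    define d where "d = enn2real (energy (\<lambda>x. u x - v x))"
    have nn: "0 \<le> a" "0 \<le> b" "0 \<le> m" "0 \<le> d" by (auto simp: a_def b_def m_def d_def)
    have e: "energy u = ennreal a" "energy v = ennreal b" "energy (\<lambda>x. (u x + v x) / 2) = ennreal m"
      "energy (\<lambda>x. u x - v x) = ennreal d"
      unfolding a_def b_def m_def d_def using uv space_diff space_midpoint energy_eq by blast+
    have fin: "energy u < \<infinity>" "energy v < \<infinity>" by (auto simp: e)
    note Cuv = C[rule_format, OF uv[THEN space_measurable] fin]
    have "ennreal (d + 2 * C\<^sup>2 * m) \<le> ennreal ((4 * \<epsilon>\<^sup>2 + C\<^sup>2) * (a + b))"
      using conjunct1[OF Cuv] nn unfolding e by (simp add: ennreal_mult)
    then have "d + 2 * C\<^sup>2 * m \<le> (4 * \<epsilon>\<^sup>2 + C\<^sup>2) * (a + b)"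
      using nn by (subst (asm) ennreal_le_iff) auto
    then show "d \<le> 4 * \<epsilon>\<^sup>2 * (a + b) + 2 * C\<^sup>2 * coulomb_defect u v"
      unfolding coulomb_defect_def a_def[symmetric] b_def[symmetric] m_def[symmetric]
      by (simp add: algebra_simps add_divide_distrib)
    have half: "ennreal ((1/2) * (a + b)) = ennreal (1/2) * (ennreal a + ennreal b)"
      using nn by (subst ennreal_mult) auto
    have "ennreal m \<le> ennreal ((1/2) * (a + b))"
      using conjunct2[OF Cuv] unfolding e half .
    then have "m \<le> (a + b) / 2" using nn by (subst (asm) ennreal_le_iff) auto
    then show "0 \<le> coulomb_defect u v"
      unfolding coulomb_defect_def a_def[symmetric] b_def[symmetric] m_def[symmetric] by simp
  qed
qed

text \<open>The convexity defect of the total energy splits into two nonnegative parts: the Coulomb part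
  controls the Coulomb energy of \<open>u - v\<close> up to \<open>\<epsilon>\<close>, and the gradient part is a quarter of the gradient
  energy of \<open>u - v\<close> by the parallelogram law.\<close>

lemma total_energy_uniform_convexity:
  assumes "0 \<le> B" "0 < \<eta>"
  obtains \<delta> where "0 < \<delta>" "\<And>u v. u \<in> E \<Longrightarrow> v \<in> E \<Longrightarrow> total_energy u \<le> B \<Longrightarrow> total_energy v \<le> B \<Longrightarrow>
    (total_energy u + total_energy v) / 2 - total_energy (\<lambda>x. (u x + v x) / 2) \<le> \<delta> \<Longrightarrow>
    total_energy (\<lambda>x. u x - v x) \<le> \<eta>"
proof -
  \<comment> \<open>The error \<open>4 \<epsilon>\<^sup>2 \<cdot> 2 B\<close> from the first term of the Coulomb estimate is then at most \<open>\<eta> / 2\<close>.\<close>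
  define \<epsilon> where "\<epsilon> = sqrt (\<eta> / (16 * (B + 1)))"
  have \<epsilon>: "0 < \<epsilon>" using assms by (simp add: \<epsilon>_def)
  have \<epsilon>2: "8 * \<epsilon>\<^sup>2 * B \<le> \<eta> / 2" using assms by (simp add: \<epsilon>_def field_simps)
  obtain C where C: "\<And>u v. u \<in> E \<Longrightarrow> v \<in> E \<Longrightarrow>
      enn2real (energy (\<lambda>x. u x - v x)) \<le> 4 * \<epsilon>\<^sup>2 * (enn2real (energy u) + enn2real (energy v))
          + 2 * C\<^sup>2 * coulomb_defect u v"
    "\<And>u v. u \<in> E \<Longrightarrow> v \<in> E \<Longrightarrow> 0 \<le> coulomb_defect u v"
    by (rule coulomb_energy_uniform_convexity[OF \<epsilon>], rule that)
  define q where "q = 2 * C\<^sup>2 + 4"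
  define \<delta> where "\<delta> = \<eta> / 2 / q"
  have pos: "0 < q" unfolding q_def by (rule add_nonneg_pos) auto
  show thesis
  proof (rule that[of \<delta>])
    show "0 < \<delta>" using assms pos by (simp add: \<delta>_def)
    fix u v assume uv: "u \<in> E" "v \<in> E" and B: "total_energy u \<le> B" "total_energy v \<le> B"
      and \<delta>: "(total_energy u + total_energy v) / 2 - total_energy (\<lambda>x. (u x + v x) / 2) \<le> \<delta>"
    define dc where "dc = coulomb_defect u v"
    define dg where "dg = (gradient_energy u + gradient_energy v) / 2 - gradient_energy (\<lambda>x. (u x
        + v x) / 2)"
    have dc: "0 \<le> dc" using C(2)[OF uv] by (simp add: dc_def)
    have g: "gradient_energy (\<lambda>x. u x - v x) = 4 * dg"
      proof -
      have "X = 4 * ((a + b) / 2 - c)" if "X + 4 * c = 2 * a + 2 * b" for X a b c :: real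
        using that by argo
      from this[OF gradient_energy_parallelogram[OF uv]] show ?thesis unfolding dg_def .
    qed
    have dg: "0 \<le> dg" using g gradient_energy_nonneg[of "\<lambda>x. u x - v x"] by simp
    have sum: "dc + dg \<le> \<delta>" using \<delta> by (simp add: dc_def coulomb_defect_def dg_def total_energy_def
        field_simps)
    have "enn2real (energy u) + enn2real (energy v) \<le> 2 * B"
      using B gradient_energy_nonneg[of u] gradient_energy_nonneg[of v] by (simp add: total_energy_def)
    then have "4 * \<epsilon>\<^sup>2 * (enn2real (energy u) + enn2real (energy v)) \<le> 4 * \<epsilon>\<^sup>2 * (2 * B)"
      by (rule mult_left_mono) simp
    then have "enn2real (energy (\<lambda>x. u x - v x)) \<le> \<eta> / 2 + 2 * C\<^sup>2 * dc"
      using C(1)[OF uv] \<epsilon>2 unfolding dc_def by linarith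
    then have "total_energy (\<lambda>x. u x - v x) \<le> \<eta> / 2 + (2 * C\<^sup>2 * dc + 4 * dg)"
      using g by (simp add: total_energy_def)
    also have "2 * C\<^sup>2 * dc + 4 * dg \<le> q * (dc + dg)"
      using dc dg by (simp add: q_def algebra_simps)
    also have "\<dots> \<le> q * \<delta>" using sum pos by (intro mult_left_mono) auto
    also have "\<dots> = \<eta> / 2" using pos by (simp add: \<delta>_def)
    finally show "total_energy (\<lambda>x. u x - v x) \<le> \<eta>" by simp
  qed
qed

end

section \<open>Local convergence in the mean\<close>

lemma ball_L1_lincomb_le:
  fixes u v :: "real ^ 'n \<Rightarrow> real"
  assumes "locally_integrable u" "locally_integrable v"
  shows "ball_L1 R (\<lambda>x. a * u x + b * v x) \<le> \<bar>a\<bar> * ball_L1 R u + \<bar>b\<bar> * ball_L1 R v"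
proof -
  have l: "locally_integrable (\<lambda>x. a * u x + b * v x)"
    using locally_integrable_lincomb[OF assms, of a b] by simp
  note I = locally_integrable_ball_norm[of _ R]
  have "ball_L1 R (\<lambda>x. a * u x + b * v x)
     \<le> (\<integral>x. \<bar>a\<bar> * (indicator (cball 0 R) x * norm (u x))
         + \<bar>b\<bar> * (indicator (cball 0 R) x * norm (v x)) \<partial>lebesgue)"
    unfolding ball_L1_def set_lebesgue_integral_def real_scaleR_def
  proof (rule integral_mono)
    show "integrable lebesgue (\<lambda>x. \<bar>a\<bar> * (indicator (cball 0 R) x * norm (u x))
        + \<bar>b\<bar> * (indicator (cball 0 R) x * norm (v x)))"
      by (intro Bochner_Integration.integrable_add integrable_mult_right I assms)
    show "indicator (cball 0 R) x * norm (a * u x + b * v x)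
        \<le> \<bar>a\<bar> * (indicator (cball 0 R) x * norm (u x))
        + \<bar>b\<bar> * (indicator (cball 0 R) x * norm (v x))" for x
      using abs_triangle_ineq[of "a * u x" "b * v x"] by (auto simp: indicator_def abs_mult)
  qed (rule I[OF l])
  also have "\<dots> = \<bar>a\<bar> * ball_L1 R u + \<bar>b\<bar> * ball_L1 R v"
    using I[OF assms(1)] I[OF assms(2)] by (simp add: ball_L1_def set_lebesgue_integral_def)
  finally show ?thesis .
qed

lemma converges_L1_loc_iff_balls:
  fixes u :: "nat \<Rightarrow> real ^ 'n \<Rightarrow> real"
  assumes u: "\<And>k. locally_integrable (u k)" and v: "locally_integrable v"
  shows "converges_L1_loc u v \<longleftrightarrow> (\<forall>R. (\<lambda>k. ball_L1 R (\<lambda>x. u k x - v x)) \<longlonglongrightarrow> 0)"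
proof -
  have l: "locally_integrable (\<lambda>x. u k x - v x)" for k
    using locally_integrable_lincomb[OF u v, of 1 k "-1"] by simp
  have eq: "(\<integral>\<^sup>+ x\<in>cball 0 R. ennreal \<bar>u k x - v x\<bar> \<partial>lebesgue)
      = ennreal (ball_L1 R (\<lambda>x. u k x - v x))" for k R
    unfolding ball_L1_nn_integral[OF l] by (simp add: mult.commute)
  have tends: "(\<lambda>k. ennreal (ball_L1 R (\<lambda>x. u k x - v x))) \<longlonglongrightarrow> 0 \<longleftrightarrow> (\<lambda>k. ball_L1 R (\<lambda>x. u k x - v x))
      \<longlonglongrightarrow> 0" for R
    by (subst ennreal_0[symmetric], subst tendsto_ennreal_iff) (auto simp: ball_L1_nonneg)
  show ?thesis
  proof
    assume L: "converges_L1_loc u v"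
    show "\<forall>R. (\<lambda>k. ball_L1 R (\<lambda>x. u k x - v x)) \<longlonglongrightarrow> 0"
    proof
      fix R
      have "(\<lambda>k. \<integral>\<^sup>+ x\<in>cball 0 R. ennreal \<bar>u k x - v x\<bar> \<partial>lebesgue) \<longlonglongrightarrow> 0"
        using L compact_cball unfolding converges_L1_loc_def by blast
      then show "(\<lambda>k. ball_L1 R (\<lambda>x. u k x - v x)) \<longlonglongrightarrow> 0" unfolding eq tends .
    qed
  next
    assume L: "\<forall>R. (\<lambda>k. ball_L1 R (\<lambda>x. u k x - v x)) \<longlonglongrightarrow> 0"
    show "converges_L1_loc u v"
      unfolding converges_L1_loc_def
    proof (intro allI impI)
      fix K :: "(real ^ 'n) set" assume K: "compact K"
      then obtain R where "\<forall>x\<in>K. norm x \<le> R"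
        using compact_imp_bounded bounded_iff by blast
      then have R: "K \<subseteq> cball 0 R" by auto
      have up: "(\<lambda>k. \<integral>\<^sup>+ x\<in>cball 0 R. ennreal \<bar>u k x - v x\<bar> \<partial>lebesgue) \<longlonglongrightarrow> 0"
        using L unfolding eq tends by blast
      show "(\<lambda>k. \<integral>\<^sup>+ x\<in>K. ennreal \<bar>u k x - v x\<bar> \<partial>lebesgue) \<longlonglongrightarrow> 0"
        by (rule tendsto_sandwich[OF _ _ tendsto_const up])
           (use R in \<open>auto intro!: always_eventually nn_integral_mono simp: indicator_def\<close>)
    qed
  qed
qed

text \<open>If the \<open>k\<close>th chosen term has norm below \<open>2\<^sup>-\<^sup>k\<close> on the ball of radius \<open>k\<close>, then the
  series of their absolute values on these balls is integrable, hence finite almost everywhere.\<close>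

lemma L1_loc_null_AE_subsequence:
  fixes z :: "nat \<Rightarrow> real ^ 'n \<Rightarrow> real"
  assumes z: "\<And>k. locally_integrable (z k)" and lim: "\<And>R. (\<lambda>k. ball_L1 R (z k)) \<longlonglongrightarrow> 0"
  obtains r :: "nat \<Rightarrow> nat" where "\<And>k. k \<le> r k" "AE x in lebesgue. (\<lambda>k. z (r k) x) \<longlonglongrightarrow> 0"
proof -
  have "\<exists>n\<ge>k. ball_L1 (real k) (z n) < (1/2) ^ k" for k
  proof -
    have "\<forall>\<^sub>F n in sequentially. ball_L1 (real k) (z n) < (1/2) ^ k"
      using lim by (rule order_tendstoD) simp
    then obtain n0 where "\<And>n. n0 \<le> n \<Longrightarrow> ball_L1 (real k) (z n) < (1/2) ^ k"
      by (auto simp: eventually_sequentially)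
    then show ?thesis by (intro exI[of _ "max n0 k"]) auto
  qed
  then obtain r where r: "\<And>k. k \<le> r k" "\<And>k. ball_L1 (real k) (z (r k)) < (1/2) ^ k" by metis
  note [measurable] = locally_integrable_measurable[OF z]
  let ?f = "\<lambda>k x. indicator (cball 0 (real k)) x * norm (z (r k) x)"
  define F where "F k x = ennreal (?f k x)" for k x
  have [measurable]: "F k \<in> borel_measurable lebesgue" for k unfolding F_def[abs_def] by measurable
  have "(\<integral>\<^sup>+ x. (\<Sum>k. F k x) \<partial>lebesgue) = (\<Sum>k. \<integral>\<^sup>+ x. F k x \<partial>lebesgue)"
    by (rule nn_integral_suminf) measurable
  also have "\<dots> = (\<Sum>k. ennreal (ball_L1 (real k) (z (r k))))"
    unfolding F_def by (simp add: ball_L1_nn_integral[OF z] ennreal_mult' ennreal_indicator)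
  also have "\<dots> \<le> (\<Sum>k. ennreal ((1/2) ^ k))"
    by (intro suminf_le) (auto intro!: ennreal_leI less_imp_le r(2))
  also have "\<dots> < \<infinity>"
    by (subst suminf_ennreal2) auto
  finally have "AE x in lebesgue. (\<Sum>k. F k x) \<noteq> \<infinity>"
    by (intro nn_integral_PInf_AE) auto
  then have "AE x in lebesgue. (\<lambda>k. z (r k) x) \<longlonglongrightarrow> 0"
  proof eventually_elim
    fix x assume "(\<Sum>k. F k x) \<noteq> \<infinity>"
    then have "summable (\<lambda>k. ?f k x)" unfolding F_def by (intro summable_suminf_not_top) auto
    then have 1: "(\<lambda>k. ?f k x) \<longlonglongrightarrow> 0" by (rule summable_LIMSEQ_zero)
    obtain n0 where n0: "norm x \<le> real n0" using real_arch_simple by blast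
    have "\<forall>\<^sub>F k in sequentially. ?f k x = norm (z (r k) x)"
    proof (rule eventually_sequentiallyI[of n0])
      fix k assume "n0 \<le> k"
      then have "norm x \<le> real k" using n0 by (auto intro: order_trans)
      then show "?f k x = norm (z (r k) x)" by simp
    qed
    then have "(\<lambda>k. norm (z (r k) x)) \<longlonglongrightarrow> 0" using 1 by (rule Lim_transform_eventually[rotated])
    then show "(\<lambda>k. z (r k) x) \<longlonglongrightarrow> 0" by (rule tendsto_norm_zero_cancel)
  qed
  then show thesis using that r(1) by blast
qed

section \<open>Bounded sequences converging locally in the mean converge weakly\<close>

context coulomb_exponents
begin

text \<open>The gradients of a sequence that is null in \<open>L\<^sup>1\<^sub>l\<^sub>o\<^sub>c\<close> are null as distributions, hence
  weakly in \<open>L\<^sup>2\<close> when they are bounded there.\<close>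

lemma gradient_inner_tendsto_0:
  assumes z: "\<And>k. z k \<in> E" and B: "\<And>k. gradient_energy (z k) \<le> B"
    and lim: "\<And>R. (\<lambda>k. ball_L1 R (z k)) \<longlonglongrightarrow> 0" and u: "u \<in> E"
  shows "(\<lambda>j. \<integral>x. weak_gradient u x \<bullet> weak_gradient (z j) x \<partial>lebesgue) \<longlonglongrightarrow> 0"
proof -
  note [measurable] = space_gradient_measurable[OF u] space_gradient_measurable[OF z]
  have comp: "integrable lebesgue (\<lambda>x. (weak_gradient w x $ i)\<^sup>2)" "(\<integral>x. (weak_gradient w x $ i)\<^sup>2
      \<partial>lebesgue) \<le> gradient_energy w"
    if w: "w \<in> E" for w i
  proof -
    have le: "(weak_gradient w x $ i)\<^sup>2 \<le> (norm (weak_gradient w x))\<^sup>2" for x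
      using component_le_norm_cart[of "weak_gradient w x" i] by (metis abs_ge_zero power2_abs power_mono)
    note [measurable] = locally_integrable_measurable[OF locally_integrable_nth[OF
        space_locally_integrable(2)[OF w], of i]]
    show int: "integrable lebesgue (\<lambda>x. (weak_gradient w x $ i)\<^sup>2)"
      by (rule Bochner_Integration.integrable_bound[OF space_gradient_square_integrable[OF w]]) (use
          le in auto)
    show "(\<integral>x. (weak_gradient w x $ i)\<^sup>2 \<partial>lebesgue) \<le> gradient_energy w"
      unfolding gradient_energy_def by (rule integral_mono[OF int
          space_gradient_square_integrable[OF w] le])
  qed
  have "(\<lambda>j. \<integral>x. weak_gradient (z j) x $ i * weak_gradient u x $ i \<partial>lebesgue) \<longlonglongrightarrow> 0" for i
  proof (rule L2_bounded_distributional_null_imp_weak)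
    show "(\<lambda>x. weak_gradient u x $ i) \<in> borel_measurable lebesgue"
      by (rule locally_integrable_measurable[OF locally_integrable_nth[OF
          space_locally_integrable(2)[OF u]]])
    show "locally_integrable (\<lambda>x. weak_gradient (z j) x $ i)" for j
      by (rule locally_integrable_nth[OF space_locally_integrable(2)[OF z]])
    show "(\<integral>x. (weak_gradient (z j) x $ i)\<^sup>2 \<partial>lebesgue) \<le> B" for j
      using comp(2)[OF z] B order_trans by blast
    fix \<phi> :: "real ^ 'n \<Rightarrow> real" assume \<phi>: "test_function \<phi>"
    note \<phi>' = test_function_partial_deriv[OF \<phi>, of i]
    obtain R where R: "0 \<le> R" "\<And>x. norm x > R \<Longrightarrow> partial_deriv i \<phi> x = 0"
      by (rule test_function_support[OF \<phi>'], rule that)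
    obtain C where C: "0 \<le> C" "\<And>x. \<bar>partial_deriv i \<phi> x\<bar> \<le> C"
      by (rule test_function_bounded[OF \<phi>'], rule that)
    have "\<bar>\<integral>x. weak_gradient (z j) x $ i * \<phi> x \<partial>lebesgue\<bar> \<le> C * ball_L1 R (z j)" for j
    proof -
      have "(\<integral>x. z j x * partial_deriv i \<phi> x \<partial>lebesgue)
          = - (\<integral>x. weak_gradient (z j) x $ i * \<phi> x \<partial>lebesgue)"
        using space_has_weak_gradient[OF z] \<phi> by (simp add: has_weak_gradient_def)
      moreover have "\<bar>\<integral>x. z j x * partial_deriv i \<phi> x \<partial>lebesgue\<bar> \<le> C * ball_L1 R (z j)"
        by (rule locally_integrable_times_bounded(2)[OF space_locally_integrable(1)[OF z]
            test_function_measurable[OF \<phi>'] C(2) R(2)])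
      ultimately show ?thesis by simp
    qed
    then show "(\<lambda>j. \<integral>x. weak_gradient (z j) x $ i * \<phi> x \<partial>lebesgue) \<longlonglongrightarrow> 0"
      by (intro Lim_null_comparison[OF _ tendsto_mult_right_zero[OF lim[of R], of C]]) auto
  qed (use comp(1) u z in auto)
  then have "(\<lambda>j. \<Sum>i\<in>UNIV. \<integral>x. weak_gradient (z j) x $ i * weak_gradient u x $ i \<partial>lebesgue)
      \<longlonglongrightarrow> (\<Sum>i\<in>(UNIV::'n set). 0)"
    by (intro tendsto_sum)
  moreover have "(\<Sum>i\<in>UNIV. \<integral>x. weak_gradient (z j) x $ i * weak_gradient u x $ i \<partial>lebesgue)
     = (\<integral>x. weak_gradient u x \<bullet> weak_gradient (z j) x \<partial>lebesgue)" for j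
  proof -
    have "integrable lebesgue (\<lambda>x. weak_gradient (z j) x $ i * weak_gradient u x $ i)" for i
    proof (rule Bochner_Integration.integrable_bound)
      show "integrable lebesgue (\<lambda>x. (weak_gradient (z j) x $ i)\<^sup>2 + (weak_gradient u x $ i)\<^sup>2)"
        using comp(1) u z by auto
      show "(\<lambda>x. weak_gradient (z j) x $ i * weak_gradient u x $ i) \<in> borel_measurable lebesgue"
        by (intro borel_measurable_times locally_integrable_measurable locally_integrable_nth
            space_locally_integrable u z)
      show "AE x in lebesgue. norm (weak_gradient (z j) x $ i * weak_gradient u x $ i)
          \<le> norm ((weak_gradient (z j) x $ i)\<^sup>2 + (weak_gradient u x $ i)\<^sup>2)"
      proof (rule AE_I2)
        fix x
        have "2 * (\<bar>s\<bar> * \<bar>t\<bar>) \<le> s\<^sup>2 + t\<^sup>2" for s t :: real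
          using zero_le_power2[of "\<bar>s\<bar> - \<bar>t\<bar>"] by (simp add: power2_diff)
        from this[of "weak_gradient (z j) x $ i" "weak_gradient u x $ i"]
        show "norm (weak_gradient (z j) x $ i * weak_gradient u x $ i)
            \<le> norm ((weak_gradient (z j) x $ i)\<^sup>2 + (weak_gradient u x $ i)\<^sup>2)"
          using mult_nonneg_nonneg[of "\<bar>weak_gradient (z j) x $ i\<bar>" "\<bar>weak_gradient u x $ i\<bar>"]
          unfolding real_norm_def abs_mult by linarith
      qed
    qed
    then show ?thesis
      by (subst Bochner_Integration.integral_sum[symmetric]) (simp_all add: inner_vec_def mult.commute)
  qed
  ultimately show ?thesis by simp
qed

text \<open>An energy Cauchy sequence that is null in \<open>L\<^sup>1\<^sub>l\<^sub>o\<^sub>c\<close> has vanishing energy: Fatou's lemma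
  along an almost everywhere convergent subsequence for the Coulomb part, expansion of the square
  and weak convergence of the gradients for the other.\<close>

lemma energy_Cauchy_L1_loc_null_imp_energy_null:
  assumes z: "\<And>k. z k \<in> E" and B: "\<And>k. total_energy (z k) \<le> B"
    and lim: "\<And>R. (\<lambda>k. ball_L1 R (z k)) \<longlonglongrightarrow> 0"
    and C: "\<And>\<eta>. 0 < \<eta> \<Longrightarrow> \<exists>K. \<forall>k\<ge>K. \<forall>j\<ge>k. total_energy (\<lambda>x. z k x - z j x) \<le> \<eta>"
  shows "(\<lambda>k. total_energy (z k)) \<longlonglongrightarrow> 0"
proof (rule LIMSEQ_I)
  fix e :: real assume e: "0 < e"
  obtain K where K: "\<And>k j. K \<le> k \<Longrightarrow> k \<le> j \<Longrightarrow> total_energy (\<lambda>x. z k x - z j x) \<le> e / 4"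
    using C[of "e/4"] e by auto
  obtain r where r: "\<And>k. k \<le> r k" "AE x in lebesgue. (\<lambda>k. z (r k) x) \<longlonglongrightarrow> 0"
    by (rule L1_loc_null_AE_subsequence[OF space_locally_integrable(1)[OF z] lim], rule that)
  note [measurable] = space_measurable[OF z]
  have "total_energy (z k) \<le> e / 2" if k: "K \<le> k" for k
  proof -
    \<comment> \<open>The index is shifted by \<open>k\<close> so that the Cauchy condition applies to every term.\<close>
    have "energy (z k) \<le> ennreal (e / 4)"
    proof (rule coulomb_energy_Fatou)
      show "AE x in lebesgue. (\<lambda>j. z k x - z (r (j + k)) x) \<longlonglongrightarrow> z k x"
        using r(2)
      proof eventually_elim
        fix x assume "(\<lambda>k. z (r k) x) \<longlonglongrightarrow> 0"
        then have "(\<lambda>j. z (r (j + k)) x) \<longlonglongrightarrow> 0" by (rule LIMSEQ_ignore_initial_segment)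
        from tendsto_diff[OF tendsto_const[of "z k x"] this]
        show "(\<lambda>j. z k x - z (r (j + k)) x) \<longlonglongrightarrow> z k x" by simp
      qed
      fix j
      have "k \<le> r (j + k)" using r(1)[of "j + k"] by simp
      then have "total_energy (\<lambda>x. z k x - z (r (j + k)) x) \<le> e / 4" using K[OF k] by blast
      then have "enn2real (energy (\<lambda>x. z k x - z (r (j + k)) x)) \<le> e / 4"
        using gradient_energy_nonneg[of "\<lambda>x. z k x - z (r (j + k)) x"] by (simp add: total_energy_def)
      then show "energy (\<lambda>x. z k x - z (r (j + k)) x) \<le> ennreal (e / 4)"
        by (subst energy_eq) (auto intro!: space_diff z ennreal_leI)
    qed measurable
    then have c: "enn2real (energy (z k)) \<le> e / 4"
      using e by (intro enn2real_leI) auto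
    have B': "gradient_energy (z k) \<le> B" for k
      using B[of k] by (simp add: total_energy_def) (metis add.commute add_increasing2
          enn2real_nonneg le_add_same_cancel1 order_trans)
    have "(\<lambda>j. e / 4 + 2 * (\<integral>x. weak_gradient (z k) x \<bullet> weak_gradient (z j) x \<partial>lebesgue))
        \<longlonglongrightarrow> e / 4 + 2 * 0"
      by (intro tendsto_intros gradient_inner_tendsto_0[OF z B' lim z])
    moreover have "\<forall>j\<ge>k. gradient_energy (z k)
        \<le> e / 4 + 2 * (\<integral>x. weak_gradient (z k) x \<bullet> weak_gradient (z j) x \<partial>lebesgue)"
    proof (intro allI impI)
      fix j assume "k \<le> j"
      then have "gradient_energy (\<lambda>x. z k x - z j x) \<le> e / 4"
        using K[OF k, of j] enn2real_nonneg[of "energy (\<lambda>x. z k x - z j x)"] unfolding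
            total_energy_def by linarith
      then show "gradient_energy (z k) \<le> e / 4
          + 2 * (\<integral>x. weak_gradient (z k) x \<bullet> weak_gradient (z j) x \<partial>lebesgue)"
        using gradient_energy_diff_expand[OF z z, of k j] gradient_energy_nonneg[of "z j"] by linarith
    qed
    ultimately have "gradient_energy (z k) \<le> e / 4 + 2 * 0"
      by (intro LIMSEQ_le_const) auto
    then show ?thesis using c by (simp add: total_energy_def)
  qed
  then show "\<exists>K. \<forall>k\<ge>K. norm (total_energy (z k) - 0) < e"
    using e total_energy_nonneg by (intro exI[of _ K]) (auto intro: le_less_trans[of _ "e/2"])
qed

lemma energy_null_imp_norm_null:
  assumes z: "\<And>k. z k \<in> E" and lim: "(\<lambda>k. total_energy (z k)) \<longlonglongrightarrow> 0"
  shows "(\<lambda>k. coulomb_sobolev_norm \<alpha> p (z k)) \<longlonglongrightarrow> 0"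
proof -
  have g: "(\<lambda>k. gradient_energy (z k)) \<longlonglongrightarrow> 0"
    by (rule tendsto_sandwich[OF _ _ tendsto_const lim]) (auto simp: total_energy_def
        gradient_energy_nonneg)
  have c: "(\<lambda>k. enn2real (energy (z k))) \<longlonglongrightarrow> 0"
    by (rule tendsto_sandwich[OF _ _ tendsto_const lim]) (auto simp: total_energy_def
        gradient_energy_nonneg)
  have "(\<lambda>k. enn2real (energy (z k)) powr (1 / p)) \<longlonglongrightarrow> 0 powr (1 / p)"
    using p by (intro tendsto_powr' c tendsto_const) auto
  then have "(\<lambda>k. sqrt (gradient_energy (z k) + enn2real (energy (z k)) powr (1 / p)))
      \<longlonglongrightarrow> sqrt (0 + 0 powr (1 / p))"
    by (intro tendsto_real_sqrt tendsto_add g)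
  then show ?thesis by (simp add: norm_eq[OF z])
qed

lemma dual_add:
  "L \<in> coulomb_sobolev_dual \<alpha> p \<Longrightarrow> u \<in> E \<Longrightarrow> v \<in> E \<Longrightarrow> L (\<lambda>x. u x + v x) = L u + L v"
  by (simp add: coulomb_sobolev_dual_def)

lemma dual_scale:
  "L \<in> coulomb_sobolev_dual \<alpha> p \<Longrightarrow> u \<in> E \<Longrightarrow> L (\<lambda>x. c * u x) = c * L u"
  by (simp add: coulomb_sobolev_dual_def)

lemma dual_diff:
  assumes "L \<in> coulomb_sobolev_dual \<alpha> p" "u \<in> E" "v \<in> E"
  shows "L (\<lambda>x. u x - v x) = L u - L v"
proof -
  have "(\<lambda>x. (- 1) * v x) \<in> E" using space_lincomb[OF assms(3,3), of "-1" 0] by simp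
  from dual_add[OF assms(1,2) this] dual_scale[OF assms(1,3), of "-1"] show ?thesis by simp
qed

lemma dual_midpoint:
  assumes "L \<in> coulomb_sobolev_dual \<alpha> p" "u \<in> E" "v \<in> E"
  shows "L (\<lambda>x. (u x + v x) / 2) = (L u + L v) / 2"
proof -
  have "(\<lambda>x. u x + v x) \<in> E" using space_lincomb[OF assms(2,3), of 1 1] by simp
  from dual_scale[OF assms(1) this, of "1/2"] dual_add[OF assms] show ?thesis by simp
qed

lemma dual_uminus: "L \<in> coulomb_sobolev_dual \<alpha> p \<Longrightarrow> (\<lambda>u. - L u) \<in> coulomb_sobolev_dual \<alpha> p"
  unfolding coulomb_sobolev_dual_def by auto

text \<open>If \<open>L (w n) \<ge> \<epsilon>\<close> infinitely often, then the convex sets \<open>C k\<close> below are nonempty, decreasing,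
  of bounded infimal energy, and any \<open>z k \<in> C k\<close> is null in \<open>L\<^sup>1\<^sub>l\<^sub>o\<^sub>c\<close>. Uniform convexity makes almost
  minimizers of the energy on \<open>C k\<close> a Cauchy sequence; its energy then vanishes, which
  contradicts \<open>L (z k) \<ge> \<epsilon>\<close>.\<close>

lemma dual_eventually_less:
  assumes w: "\<And>n. w n \<in> E" and B: "\<And>n. total_energy (w n) \<le> B"
    and lim: "\<And>R. (\<lambda>n. ball_L1 R (w n)) \<longlonglongrightarrow> 0"
    and L: "L \<in> coulomb_sobolev_dual \<alpha> p" and \<epsilon>: "0 < \<epsilon>"
  shows "\<forall>\<^sub>F n in sequentially. L (w n) < \<epsilon>"
proof (rule ccontr)
  assume "\<not> ?thesis"
  then have inf: "\<exists>n\<ge>k. \<epsilon> \<le> L (w n)" for k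
    by (auto simp: eventually_sequentially not_less)
  \<comment> \<open>The quantifier over \<open>b\<close> says that the norm of \<open>z\<close> is at most the supremum of those of the tail.\<close>
  define C where "C k = {z \<in> E. \<epsilon> \<le> L z \<and> (\<forall>R b. (\<forall>n\<ge>k. ball_L1 R (w n) \<le> b) \<longrightarrow> ball_L1 R z \<le> b)}" for k
  have Cmono: "C j \<subseteq> C k" if "k \<le> j" for j k
    unfolding C_def using that by (auto dest: order_trans)
  have Cmid: "(\<lambda>x. (u x + v x) / 2) \<in> C k" if "u \<in> C k" "v \<in> C k" for u v k
  proof -
    have uv: "u \<in> E" "v \<in> E" using that by (auto simp: C_def)
    have "ball_L1 R (\<lambda>x. (u x + v x) / 2) \<le> b" if "\<forall>n\<ge>k. ball_L1 R (w n) \<le> b" for R b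
    proof -
      have "ball_L1 R u \<le> b" "ball_L1 R v \<le> b" using \<open>u \<in> C k\<close> \<open>v \<in> C k\<close> that by (auto simp: C_def)
      then show ?thesis
        using ball_L1_lincomb_le[OF uv[THEN space_locally_integrable(1)], of R "1/2" "1/2"]
            by (simp add: add_divide_distrib)
    qed
    then show ?thesis
      using that space_midpoint[OF uv] dual_midpoint[OF L uv] by (auto simp: C_def)
  qed
  have Cne: "\<exists>z\<in>C k. total_energy z \<le> B" for k
  proof -
    obtain n where "n \<ge> k" "\<epsilon> \<le> L (w n)" using inf by blast
    then show ?thesis using w B by (intro bexI[of _ "w n"]) (auto simp: C_def)
  qed
  have B0: "0 \<le> B" using B[of 0] total_energy_nonneg[of "w 0"] by linarith
  define d where "d k = Inf (total_energy ` C k)" for k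
  have bdd: "bdd_below (total_energy ` C k)" for k
    using total_energy_nonneg by (intro bdd_belowI[of _ 0]) auto
  have ne: "total_energy ` C k \<noteq> {}" for k using Cne by blast
  have dle: "d k \<le> total_energy z" if "z \<in> C k" for k z
    unfolding d_def using that by (intro cInf_lower bdd) auto
  have dB: "d k \<le> B" for k using Cne[of k] dle by (meson order_trans)
  have dinc: "incseq d"
    unfolding incseq_def d_def using Cmono ne bdd by (auto intro!: cInf_superset_mono)
  have "bdd_above (range d)" using dB by (intro bdd_aboveI[of _ B]) auto
  from LIMSEQ_incseq_SUP[OF this dinc] obtain D where D: "d \<longlonglongrightarrow> D" by blast
  have dD: "d k \<le> D" for k using incseq_le[OF dinc D] .
  have "\<exists>z\<in>C k. total_energy z < d k + inverse (real (Suc k))" for k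
  proof -
    have "Inf (total_energy ` C k) < d k + inverse (real (Suc k))" by (simp add: d_def)
    from cInf_lessD[OF ne this] show ?thesis by auto
  qed
  then obtain z where z: "\<And>k. z k \<in> C k" "\<And>k. total_energy (z k) < d k + inverse (real (Suc k))"
    by metis
  have zE: "z k \<in> E" for k using z(1)[of k] by (simp add: C_def)
  have zL: "\<epsilon> \<le> L (z k)" for k using z(1)[of k] by (simp add: C_def)
  have zB: "total_energy (z k) \<le> B + 1" for k
  proof -
    have "inverse (real (Suc k)) \<le> 1" by (simp add: field_simps)
    then show ?thesis using z(2)[of k] dB[of k] by linarith
  qed
  have zlim: "(\<lambda>k. ball_L1 R (z k)) \<longlonglongrightarrow> 0" for R
  proof (rule LIMSEQ_I)
    fix e :: real assume "0 < e"
    then obtain K where K: "\<And>n. n \<ge> K \<Longrightarrow> ball_L1 R (w n) < e / 2"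
      using order_tendstoD(2)[OF lim[of R], of "e/2"] by (auto simp: eventually_sequentially)
    have half: "ball_L1 R (z k) \<le> e / 2" if "K \<le> k" for k
    proof -
      have "\<forall>n\<ge>K. ball_L1 R (w n) \<le> e / 2" using K less_imp_le by blast
      moreover have "z k \<in> C K" using z(1)[of k] Cmono[OF that] by blast
      ultimately show ?thesis unfolding C_def by blast
    qed
    then show "\<exists>K. \<forall>k\<ge>K. norm (ball_L1 R (z k) - 0) < e"
    proof (intro exI allI impI)
      fix k assume "K \<le> k"
      then show "norm (ball_L1 R (z k) - 0) < e"
        using half[of k] ball_L1_nonneg[of R "z k"] \<open>0 < e\<close> by simp
    qed
  qed
  have "\<exists>K. \<forall>k\<ge>K. \<forall>j\<ge>k. total_energy (\<lambda>x. z k x - z j x) \<le> \<eta>" if \<eta>: "0 < \<eta>" for \<eta>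
  proof -
    have B1: "0 \<le> B + 1" using B0 by simp
    obtain \<delta> where \<delta>: "0 < \<delta>" "\<And>u v. u \<in> E \<Longrightarrow> v \<in> E \<Longrightarrow> total_energy u \<le> B + 1 \<Longrightarrow> total_energy v \<le> B + 1 \<Longrightarrow>
      (total_energy u + total_energy v) / 2 - total_energy (\<lambda>x. (u x + v x) / 2) \<le> \<delta> \<Longrightarrow>
      total_energy (\<lambda>x. u x - v x) \<le> \<eta>"
      by (rule total_energy_uniform_convexity[OF B1 \<eta>], rule that)
    have "(\<lambda>k. (D - d k) / 2 + inverse (real (Suc k))) \<longlonglongrightarrow> (D - D) / 2 + 0"
      by (intro tendsto_intros D LIMSEQ_inverse_real_of_nat) auto
    then have "\<forall>\<^sub>F k in sequentially. (D - d k) / 2 + inverse (real (Suc k)) < \<delta>"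
      using \<delta>(1) by (intro order_tendstoD(2)) auto
    then obtain K where K: "\<And>k. k \<ge> K \<Longrightarrow> (D - d k) / 2 + inverse (real (Suc k)) < \<delta>"
      by (auto simp: eventually_sequentially)
    have "total_energy (\<lambda>x. z k x - z j x) \<le> \<eta>" if kj: "K \<le> k" "k \<le> j" for k j
    proof (rule \<delta>(2)[OF zE zE zB zB])
      have "d k \<le> total_energy (\<lambda>x. (z k x + z j x) / 2)"
        using z(1)[of k] z(1)[of j] Cmono[OF kj(2)] by (intro dle Cmid) auto
      moreover have "inverse (real (Suc j)) \<le> inverse (real (Suc k))"
        using kj by (intro le_imp_inverse_le) auto
      ultimately show "(total_energy (z k) + total_energy (z j)) / 2 - total_energy (\<lambda>x. (z k x
          + z j x) / 2) \<le> \<delta>"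
        using z(2)[of k] z(2)[of j] dD[of j] K[OF kj(1)] by argo
    qed
    then show ?thesis by blast
  qed
  from energy_Cauchy_L1_loc_null_imp_energy_null[OF zE zB zlim this]
  have n0: "(\<lambda>k. coulomb_sobolev_norm \<alpha> p (z k)) \<longlonglongrightarrow> 0"
    by (rule energy_null_imp_norm_null[OF zE])
  obtain M where M: "\<And>u. u \<in> E \<Longrightarrow> \<bar>L u\<bar> \<le> M * coulomb_sobolev_norm \<alpha> p u"
    using L unfolding coulomb_sobolev_dual_def by blast
  have "(\<lambda>k. M * coulomb_sobolev_norm \<alpha> p (z k)) \<longlonglongrightarrow> 0"
    by (rule tendsto_mult_right_zero[OF n0])
  moreover have "\<epsilon> \<le> M * coulomb_sobolev_norm \<alpha> p (z k)" for k
    using zL[of k] M[OF zE, of k] by linarith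
  ultimately have "\<epsilon> \<le> 0" by (intro LIMSEQ_le_const) auto
  then show False using \<epsilon> by simp
qed

lemma norm_le_imp_energies_le:
  assumes u: "u \<in> E" and C: "coulomb_sobolev_norm \<alpha> p u \<le> C"
  shows "gradient_energy u \<le> C\<^sup>2" "enn2real (energy u) \<le> (C\<^sup>2) powr p"
proof -
  let ?g = "gradient_energy u" and ?c = "enn2real (energy u)"
  have "0 \<le> ?g + ?c powr (1 / p)" using gradient_energy_nonneg[of u] by simp
  moreover have "sqrt (?g + ?c powr (1 / p)) \<le> C" using C norm_eq[OF u] by simp
  ultimately have le: "?g + ?c powr (1 / p) \<le> C\<^sup>2"
    by (metis real_sqrt_ge_zero real_sqrt_pow2 power_mono)
  then show "?g \<le> C\<^sup>2" using powr_ge_zero[of ?c "1/p"] by linarith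
  have "?c powr (1 / p) \<le> C\<^sup>2" using le gradient_energy_nonneg[of u] by linarith
  then have "(?c powr (1 / p)) powr p \<le> (C\<^sup>2) powr p" using p by (intro powr_mono2) auto
  then show "?c \<le> (C\<^sup>2) powr p" using p by (simp add: powr_powr)
qed

lemma diff_energies_bounded:
  assumes u: "\<And>k. u k \<in> E" and v: "v \<in> E"
    and b: "coulomb_sobolev_bounded \<alpha> p u"
  obtains B where "\<And>k. gradient_energy (\<lambda>x. u k x - v x)
      \<le> B" "\<And>k. enn2real (energy (\<lambda>x. u k x - v x)) \<le> B"
proof -
  obtain C where C: "\<And>k. coulomb_sobolev_norm \<alpha> p (u k) \<le> C"
    using b by (auto simp: coulomb_sobolev_bounded_def)
  let ?B1 = "2 * C\<^sup>2 + 2 * gradient_energy v"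
  let ?B2 = "2 * 2 powr (2 * p) * ((C\<^sup>2) powr p + enn2real (energy v))"
  show thesis
  proof (rule that[of "max ?B1 ?B2"])
    fix k
    have "gradient_energy (\<lambda>x. u k x - v x) \<le> ?B1"
      using gradient_energy_parallelogram[OF u v, of k] gradient_energy_nonneg[of "\<lambda>x. (u k x
          + v x) / 2"]
        norm_le_imp_energies_le(1)[OF u C, of k] by linarith
    then show "gradient_energy (\<lambda>x. u k x - v x) \<le> max ?B1 ?B2" by simp
    have "energy (\<lambda>x. u k x - v x) \<le> ennreal (2 * 2 powr (2 * p)) * (energy (u k) + energy v)"
      using energy_lincomb_le[OF space_measurable[OF u] space_measurable[OF v], of 1 k "-1"] by simp
    also have "\<dots> = ennreal (2 * 2 powr (2 * p) * (enn2real (energy (u k)) + enn2real (energy v)))"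
      by (subst (1 2) energy_eq) (auto simp: u v ennreal_mult)
    also have "\<dots> \<le> ennreal ?B2"
      using norm_le_imp_energies_le(2)[OF u C, of k] by (intro ennreal_leI mult_left_mono) auto
    finally have "enn2real (energy (\<lambda>x. u k x - v x)) \<le> ?B2"
      by (intro enn2real_leI) auto
    then show "enn2real (energy (\<lambda>x. u k x - v x)) \<le> max ?B1 ?B2" by simp
  qed
qed

theorem bounded_L1_loc_imp_weakly_converges:
  assumes u: "\<And>k. u k \<in> E" and v: "v \<in> E"
    and b: "coulomb_sobolev_bounded \<alpha> p u" and l: "converges_L1_loc u v"
  shows "coulomb_sobolev_weakly_converges \<alpha> p u v"
  unfolding coulomb_sobolev_weakly_converges_def
proof
  fix L :: "(real ^ 'n \<Rightarrow> real) \<Rightarrow> real" assume L: "L \<in> coulomb_sobolev_dual \<alpha> p"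
  let ?w = "\<lambda>k x. u k x - v x"
  have w: "?w k \<in> E" for k by (rule space_diff[OF u v])
  obtain B where B: "\<And>k. gradient_energy (?w k) \<le> B" "\<And>k. enn2real (energy (?w k)) \<le> B"
    by (rule diff_energies_bounded[OF u v b], rule that)
  have tB: "total_energy (?w k) \<le> 2 * B" for k
    using B[of k] by (simp add: total_energy_def)
  have lim: "(\<lambda>k. ball_L1 R (?w k)) \<longlonglongrightarrow> 0" for R
    using l converges_L1_loc_iff_balls[where u=u and v=v, OF space_locally_integrable(1)[OF u]
        space_locally_integrable(1)[OF v]] by blast
  have "(\<lambda>k. L (?w k)) \<longlonglongrightarrow> 0"
  proof (rule LIMSEQ_I)
    fix e :: real assume e: "0 < e"
    have "\<forall>\<^sub>F k in sequentially. L (?w k) < e \<and> - L (?w k) < e"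
      using dual_eventually_less[OF w tB lim L e] dual_eventually_less[OF w tB lim dual_uminus[OF L] e]
      by (rule eventually_conj)
    then show "\<exists>K. \<forall>k\<ge>K. norm (L (?w k) - 0) < e"
      by (auto simp: eventually_sequentially abs_less_iff)
  qed
  then have "(\<lambda>k. L (u k) - L v) \<longlonglongrightarrow> 0" by (simp add: dual_diff[OF L u v])
  then show "(\<lambda>k. L (u k)) \<longlonglongrightarrow> L v" by (rule LIM_zero_cancel)
qed

end

section \<open>A gliding hump\<close>

text \<open>Signs chosen one after the other so that no cancellation happens on the diagonal.\<close>

function hump_coeff :: "(nat \<Rightarrow> nat \<Rightarrow> real) \<Rightarrow> nat \<Rightarrow> real" where
  "hump_coeff b m = (if 0 \<le> (\<Sum>i<m. hump_coeff b i * b i m) then (1/8) ^ m else - ((1/8) ^ m))"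
  by pat_completeness auto
termination by (relation "Wellfounded.measure snd") auto

declare hump_coeff.simps [simp del]

lemma abs_hump_coeff: "\<bar>hump_coeff b m\<bar> = (1/8) ^ m"
  by (subst hump_coeff.simps) auto

text \<open>Sokal's proof of the uniform boundedness principle, for the matrix \<open>a j k = L\<^sub>j (u\<^sub>k)\<close> of a
  sequence of functionals evaluated on a sequence of vectors. With the weights \<open>8\<^sup>-\<^sup>m\<close> the tail
  \<open>\<Sum>i>m. 3 \<cdot> 8\<^sup>-\<^sup>i = 3/7 \<cdot> 8\<^sup>-\<^sup>m\<close> cannot cancel the diagonal term.\<close>

lemma gliding_hump:
  fixes a :: "nat \<Rightarrow> nat \<Rightarrow> real" and P :: "nat \<Rightarrow> real"
  assumes a: "\<And>j k. \<bar>a j k\<bar> \<le> 3 * P k" and diag: "\<And>k. a k k = P k"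
    and bd: "\<And>n c. summable (\<lambda>m. \<bar>c m\<bar>) \<Longrightarrow> \<exists>B. \<forall>k. \<bar>\<Sum>m. c m * a (n m) k\<bar> \<le> B"
  shows "\<exists>B. \<forall>k. P k \<le> B"
proof (rule ccontr)
  assume "\<not> ?thesis"
  \<comment> \<open>The growth \<open>16\<^sup>m\<close> against the weight \<open>8\<^sup>-\<^sup>m\<close> leaves a diagonal of size \<open>2\<^sup>m\<close>.\<close>
  then have "\<exists>k. (16::real) ^ m \<le> P k" for m
    by (meson linear)
  then obtain n where n: "\<And>m. (16::real) ^ m \<le> P (n m)" by metis
  have P0: "0 \<le> P k" for k using a[of k k] by linarith
  define b where "b i m = a (n i) (n m)" for i m
  define c where "c = hump_coeff b"
  have abs_c: "\<bar>c m\<bar> = (1/8) ^ m" for m by (simp add: c_def abs_hump_coeff)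
  have sc: "summable (\<lambda>m. \<bar>c m\<bar>)" by (simp add: abs_c)
  obtain B where B: "\<And>k. \<bar>\<Sum>m. c m * a (n m) k\<bar> \<le> B" using bd[OF sc, of n] by blast
  have big: "4/7 * 2 ^ m \<le> B" for m
  proof -
    let ?p = "P (n m)"
    have le: "\<bar>c i * b i m\<bar> \<le> 3 * ?p * (1/8) ^ i" for i
      unfolding abs_mult abs_c b_def using mult_right_mono[OF a[of "n i" "n m"], of "(1/8)^i"]
          by (simp add: mult.commute)
    have geo: "summable (\<lambda>i. 3 * ?p * (1/8) ^ i)" by (intro summable_mult summable_geometric) simp
    have sb: "summable (\<lambda>i. c i * b i m)"
      by (rule summable_comparison_test'[OF geo]) (use le in auto)
    have bmm: "b m m = ?p" by (simp add: b_def diag)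
    have head: "(1/8) ^ m * ?p \<le> \<bar>\<Sum>i<Suc m. c i * b i m\<bar>"
    proof (cases "0 \<le> (\<Sum>i<m. c i * b i m)")
      case True
      then have "c m = (1/8) ^ m" by (simp add: c_def hump_coeff.simps[of b m])
      then show ?thesis using True P0[of "n m"] by (simp add: bmm)
    next
      case False
      then have "c m = - ((1/8) ^ m)" by (simp add: c_def hump_coeff.simps[of b m])
      moreover have "0 \<le> (1/8) ^ m * ?p" using P0[of "n m"] by simp
      ultimately show ?thesis using False by (simp add: bmm)
    qed
    have tail: "\<bar>\<Sum>i. c (i + Suc m) * b (i + Suc m) m\<bar> \<le> 3/7 * ((1/8) ^ m * ?p)"
    proof -
      have s1: "summable (\<lambda>i. 3 * ?p * (1/8) ^ Suc m * (1/8) ^ i)"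
          by (intro summable_mult summable_geometric) simp
      have le': "norm (c (i + Suc m) * b (i + Suc m) m) \<le> 3 * ?p * (1/8) ^ Suc m * (1/8) ^ i" for i
        using le[of "i + Suc m"] by (simp add: power_add mult_ac)
      have "norm (\<Sum>i. c (i + Suc m) * b (i + Suc m) m) \<le> (\<Sum>i. 3 * ?p * (1/8) ^ Suc m * (1/8) ^ i)"
        by (rule norm_suminf_le[OF le' s1])
      also have "\<dots> = 3 * ?p * (1/8) ^ Suc m * (\<Sum>i. (1/8) ^ i)"
        by (rule suminf_mult) (rule summable_geometric, simp)
      also have "(\<Sum>i. (1/8 :: real) ^ i) = 8/7" by (subst suminf_geometric) auto
      finally show ?thesis by (simp add: mult_ac)
    qed
    have "(\<Sum>i. c i * b i m) = (\<Sum>i. c (i + Suc m) * b (i + Suc m) m) + (\<Sum>i<Suc m. c i * b i m)"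
      by (rule suminf_split_initial_segment[OF sb])
    then have "4/7 * ((1/8) ^ m * ?p) \<le> \<bar>\<Sum>i. c i * b i m\<bar>" using head tail by linarith
    also have "\<dots> \<le> B" using B[of "n m"] by (simp add: b_def)
    finally have "4/7 * ((1/8) ^ m * ?p) \<le> B" .
    moreover have "4/7 * ((1/8) ^ m * 16 ^ m) \<le> 4/7 * ((1/8) ^ m * ?p)"
      using n[of m] by (intro mult_left_mono) auto
    moreover have "(1/8 :: real) ^ m * 16 ^ m = 2 ^ m"
      unfolding power_mult_distrib[symmetric] by simp
    ultimately show ?thesis by simp
  qed
  obtain m where "7/4 * B < 2 ^ m" using real_arch_pow[of 2 "7/4 * B"] by auto
  then show False using big[of m] by simp
qed

section \<open>Norming functionals\<close>

text \<open>Scaling turns a bound on a unit ball into a bound by a power of a homogeneous energy.\<close>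

lemma homogeneous_bound:
  fixes A C e q :: real
  assumes A: "0 \<le> A" and e: "0 \<le> e" and q: "0 < q"
    and bound: "\<And>t. 0 < t \<Longrightarrow> t powr q * e \<le> 1 \<Longrightarrow> t * A \<le> C"
  shows "A \<le> C * e powr (1 / q)"
proof (cases "e = 0")
  case True
  have "A = 0"
  proof (rule ccontr)
    assume "A \<noteq> 0"
    then have A': "0 < A" using A by simp
    have "0 \<le> C" using bound[of 1] True A by simp
    then have "(C + 1) / A * A \<le> C" using A' True by (intro bound) auto
    then show False using A' by simp
  qed
  then show ?thesis using True by simp
next
  case False
  then have e': "0 < e" using e by simp
  let ?t = "e powr (- (1 / q))"
  have "?t powr q * e = 1" unfolding powr_powr using e' q by (simp add: powr_minus)
  then have "?t * A \<le> C" using e' by (intro bound) auto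
  then have le: "e powr (1 / q) * (?t * A) \<le> e powr (1 / q) * C" by (rule mult_left_mono) simp
  have "e powr (1 / q) * ?t = 1" using e' by (simp add: powr_minus)
  then have "A = e powr (1 / q) * (?t * A)" by (simp only: mult.assoc[symmetric])
  also note le
  finally show ?thesis by (simp only: mult.commute)
qed

context coulomb_exponents
begin

definition coulomb_norm :: "(real ^ 'n \<Rightarrow> real) \<Rightarrow> real" where
  "coulomb_norm u = enn2real (energy u) powr (1 / (2 * p))"

definition gradient_norm :: "(real ^ 'n \<Rightarrow> real) \<Rightarrow> real" where
  "gradient_norm u = sqrt (gradient_energy u)"

lemma norm_eq_seminorms:
  assumes "u \<in> E"
  shows "coulomb_sobolev_norm \<alpha> p u = sqrt ((gradient_norm u)\<^sup>2 + (coulomb_norm u)\<^sup>2)"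
proof -
  have "(coulomb_norm u)\<^sup>2 = enn2real (energy u) powr (1 / p)"
    using p by (simp add: coulomb_norm_def power2_eq_square powr_add[symmetric])
  then show ?thesis
    using norm_eq[OF assms] gradient_energy_nonneg[of u] by (simp add: gradient_norm_def)
qed

lemma coulomb_norm_nonneg: "0 \<le> coulomb_norm u"
  by (simp add: coulomb_norm_def)

lemma gradient_norm_nonneg: "0 \<le> gradient_norm u"
  by (simp add: gradient_norm_def gradient_energy_nonneg)

lemma seminorms_le_norm:
  assumes "u \<in> E"
  shows "gradient_norm u \<le> coulomb_sobolev_norm \<alpha> p u" "coulomb_norm u \<le> coulomb_sobolev_norm \<alpha> p u"
    "coulomb_sobolev_norm \<alpha> p u \<le> gradient_norm u + coulomb_norm u"
  unfolding norm_eq_seminorms[OF assms]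
  using gradient_norm_nonneg[of u] coulomb_norm_nonneg[of u]
  by (auto intro!: real_le_rsqrt sqrt_sum_squares_le_sum)

lemma space_scale: "u \<in> E \<Longrightarrow> (\<lambda>x. c * u x) \<in> E"
  using space_lincomb[of u u c 0] by simp

definition linear_functional :: "((real ^ 'n \<Rightarrow> real) \<Rightarrow> real) \<Rightarrow> bool" where
  "linear_functional L \<longleftrightarrow>
     (\<forall>v\<in>E. \<forall>w\<in>E. L (\<lambda>x. v x + w x) = L v + L w) \<and>
     (\<forall>c. \<forall>v\<in>E. L (\<lambda>x. c * v x) = c * L v)"

lemma dualI:
  "linear_functional L \<Longrightarrow> (\<And>w. w \<in> E \<Longrightarrow> \<bar>L w\<bar> \<le> C * coulomb_sobolev_norm \<alpha> p w) \<Longrightarrow>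
    L \<in> coulomb_sobolev_dual \<alpha> p"
  by (auto simp: coulomb_sobolev_dual_def linear_functional_def)

text \<open>The bound is on the integral of the absolute value, so that it also yields the integrability
  without which \<open>w \<mapsto> \<integral>\<theta> w\<close> would not be linear.\<close>

definition bounded_weight :: "(real ^ 'n \<Rightarrow> real) \<Rightarrow> real \<Rightarrow> bool" where
  "bounded_weight \<theta> C \<longleftrightarrow> \<theta> \<in> borel_measurable lebesgue \<and> 0 \<le> C \<and>
     (\<forall>w\<in>E. energy w \<le> 1 \<longrightarrow> (\<integral>\<^sup>+x. ennreal \<bar>\<theta> x * w x\<bar> \<partial>lebesgue) \<le> ennreal C)"

lemma bounded_weight_integral:
  assumes \<theta>: "bounded_weight \<theta> C"
    and w: "w \<in> E"
  shows "integrable lebesgue (\<lambda>x. \<theta> x * w x)" "(\<integral>x. \<bar>\<theta> x * w x\<bar> \<partial>lebesgue) \<le> C * coulomb_norm w"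
proof -
  have C: "0 \<le> C" and [measurable]: "\<theta> \<in> borel_measurable lebesgue"
    and bound: "\<And>w. w \<in> E \<Longrightarrow> energy w \<le> 1 \<Longrightarrow> (\<integral>\<^sup>+x. ennreal \<bar>\<theta> x * w x\<bar> \<partial>lebesgue) \<le> ennreal C"
    using \<theta> by (auto simp: bounded_weight_def)
  note [measurable] = space_measurable[OF w]
  let ?e = "enn2real (energy w)"
  have e1: "0 < ?e + 1" using enn2real_nonneg[of "energy w"] by linarith
  have scaled: "energy (\<lambda>x. t * w x) = ennreal (t powr (2 * p) * ?e)" if "0 < t" for t
    using that coulomb_energy_scale[OF space_measurable[OF w], of t] energy_eq[OF w]
        by (simp add: ennreal_mult')
  have A: "ennreal t * (\<integral>\<^sup>+x. ennreal \<bar>\<theta> x * w x\<bar> \<partial>lebesgue)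
      \<le> ennreal C" if t: "0 < t" "t powr (2 * p) * ?e \<le> 1" for t
  proof -
    have "ennreal t * (\<integral>\<^sup>+x. ennreal \<bar>\<theta> x * w x\<bar> \<partial>lebesgue)
        = (\<integral>\<^sup>+x. ennreal t * ennreal \<bar>\<theta> x * w x\<bar> \<partial>lebesgue)"
      by (rule nn_integral_cmult[symmetric]) measurable
    also have "\<dots> = (\<integral>\<^sup>+x. ennreal \<bar>\<theta> x * (t * w x)\<bar> \<partial>lebesgue)"
      using t by (intro nn_integral_cong) (simp add: abs_mult mult_ac flip: ennreal_mult')
    also have "\<dots> \<le> ennreal C"
      using t scaled[OF t(1)] by (intro bound space_scale w) (simp flip: ennreal_1)
    finally show ?thesis .
  qed
  define t0 where "t0 = (?e + 1) powr (- (1 / (2 * p)))"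
  have t0: "0 < t0" using e1 by (simp add: t0_def)
  have "t0 powr (2 * p) = inverse (?e + 1)" unfolding t0_def powr_powr using p e1
      by (simp add: powr_minus)
  then have "t0 powr (2 * p) * ?e + t0 powr (2 * p) = 1" using e1 by (simp add: field_simps)
  then have "t0 powr (2 * p) * ?e \<le> 1" using powr_ge_zero[of t0 "2 * p"] by linarith
  from A[OF t0 this] have "ennreal t0 * (\<integral>\<^sup>+x. ennreal \<bar>\<theta> x * w x\<bar> \<partial>lebesgue) < \<infinity>"
    by (auto intro: le_less_trans)
  then have fin: "(\<integral>\<^sup>+x. ennreal \<bar>\<theta> x * w x\<bar> \<partial>lebesgue) < \<infinity>"
    using t0 by (auto simp: ennreal_mult_less_top)
  show int: "integrable lebesgue (\<lambda>x. \<theta> x * w x)"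
    by (rule integrableI_bounded) (use fin in auto)
  have eq: "(\<integral>\<^sup>+x. ennreal \<bar>\<theta> x * w x\<bar> \<partial>lebesgue) = ennreal (\<integral>x. \<bar>\<theta> x * w x\<bar> \<partial>lebesgue)"
    by (rule nn_integral_eq_integral) (use int in auto)
  show "(\<integral>x. \<bar>\<theta> x * w x\<bar> \<partial>lebesgue) \<le> C * coulomb_norm w"
    unfolding coulomb_norm_def
  proof (rule homogeneous_bound)
    fix t :: real assume t: "0 < t" "t powr (2 * p) * ?e \<le> 1"
    have "ennreal (t * (\<integral>x. \<bar>\<theta> x * w x\<bar> \<partial>lebesgue)) \<le> ennreal C"
      using A[OF t] t(1) unfolding eq by (simp add: ennreal_mult')
    then show "t * (\<integral>x. \<bar>\<theta> x * w x\<bar> \<partial>lebesgue) \<le> C" using C by (subst (asm) ennreal_le_iff) auto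
  qed (use p in auto)
qed

lemma bounded_weight_functional:
  assumes "bounded_weight \<theta> C"
  shows "linear_functional (\<lambda>w. \<integral>x. \<theta> x * w x \<partial>lebesgue)"
    "w \<in> E \<Longrightarrow> \<bar>\<integral>x. \<theta> x * w x \<partial>lebesgue\<bar> \<le> C * coulomb_norm w"
proof -
  note I = bounded_weight_integral[OF assms]
  show "linear_functional (\<lambda>w. \<integral>x. \<theta> x * w x \<partial>lebesgue)"
    unfolding linear_functional_def
  proof (intro conjI ballI allI)
    fix v w assume vw: "v \<in> E" "w \<in> E"
    show "(\<integral>x. \<theta> x * (v x + w x) \<partial>lebesgue) = (\<integral>x. \<theta> x * v x \<partial>lebesgue) + (\<integral>x. \<theta> x * w x \<partial>lebesgue)"
      using vw[THEN I(1)] by (simp add: distrib_left)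
    show "(\<integral>x. \<theta> x * (c * v x) \<partial>lebesgue) = c * (\<integral>x. \<theta> x * v x \<partial>lebesgue)" for c
      by (simp add: mult.left_commute)
  qed
  show "\<bar>\<integral>x. \<theta> x * w x \<partial>lebesgue\<bar> \<le> C * coulomb_norm w" if "w \<in> E"
    using I(2)[OF that] integral_abs_bound[of lebesgue "\<lambda>x. \<theta> x * w x"] by linarith
qed

lemma powr_mult_le_add:
  fixes a b :: real
  assumes "0 \<le> a" "0 \<le> b"
  shows "a powr (p - 1) * b \<le> a powr p + b powr p"
proof -
  have split: "m powr (p - 1) * m = m powr p" if "0 \<le> m" for m :: real
    using that p powr_mult_base[of m "p - 1"] by (simp add: mult.commute)
  let ?m = "max a b"
  have "a powr (p - 1) * b \<le> ?m powr (p - 1) * ?m"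
    using assms p by (intro mult_mono powr_mono2) auto
  also have "\<dots> = ?m powr p" using assms by (intro split) auto
  also have "\<dots> \<le> a powr p + b powr p" by (auto simp: max_def)
  finally show ?thesis .
qed

lemma ennreal_mult_le_power2_add: "(x :: ennreal) * y \<le> x\<^sup>2 + y\<^sup>2"
proof (cases "x \<le> y")
  case True
  then have "x * y \<le> y\<^sup>2" by (auto simp: power2_eq_square intro: mult_right_mono)
  then show ?thesis by (meson add_increasing zero_le)
next
  case False
  then have "x * y \<le> x\<^sup>2" by (auto simp: power2_eq_square intro: mult_left_mono)
  then show ?thesis by (meson add_increasing2 zero_le)
qed

text \<open>The weight is the derivative of the energy, up to a factor, at a function of energy one. On the
  unit ball the crude Young inequality \<open>a\<^sup>p\<^sup>-\<^sup>1 b \<le> a\<^sup>p + b\<^sup>p\<close> stands in for the Hoelder inequality of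
  mixed norms, at the cost of the constant \<open>3\<close>.\<close>

lemma normalized_coulomb_norming_weight:
  assumes u: "u \<in> E" and e1: "energy u = 1"
  obtains \<theta> where "bounded_weight \<theta> 3" "(\<integral>x. \<theta> x * u x \<partial>lebesgue) = 1"
proof -
  note um [measurable] = space_measurable[OF u]
  define V where "V = potential (power_potential u)"
  have [measurable]: "V \<in> borel_measurable lebesgue" unfolding V_def by measurable
  define \<theta> where "\<theta> x = enn2real (V x) * (\<bar>u x\<bar> powr (p - 1) * sgn (u x))" for x
  have [measurable]: "\<theta> \<in> borel_measurable lebesgue"
  proof -
    have "(\<lambda>x. sgn (u x)) \<in> borel_measurable lebesgue"
      using measurable_compose[OF um borel_measurable_sgn] .
    then show ?thesis unfolding \<theta>_def[abs_def] by measurable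
  qed
  have sym: "(\<integral>\<^sup>+x. ennreal (\<bar>w x\<bar> powr p) * V x \<partial>lebesgue)
      = (\<integral>\<^sup>+x. power_potential w x * power_potential u x \<partial>lebesgue)"
    if [measurable]: "w \<in> borel_measurable lebesgue" for w
    unfolding V_def by (rule potential_symmetric[symmetric]) measurable
  have uu: "(\<integral>\<^sup>+x. ennreal (\<bar>u x\<bar> powr p) * V x \<partial>lebesgue) = 1"
    using sym[OF um] e1 by (simp add: coulomb_energy_eq power2_eq_square)
  have eVle: "ennreal (enn2real (V x)) \<le> V x" for x by (cases "V x") auto
  have split: "\<bar>u x\<bar> powr (p - 1) * \<bar>u x\<bar> = \<bar>u x\<bar> powr p" for x
    using p powr_mult_base[of "\<bar>u x\<bar>" "p - 1"] by (simp add: mult.commute)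
  have \<theta>u: "\<theta> x * u x = enn2real (V x) * \<bar>u x\<bar> powr p" for x
  proof -
    have "\<theta> x * u x = enn2real (V x) * (\<bar>u x\<bar> powr (p - 1) * (sgn (u x) * u x))" by (simp add: \<theta>_def)
    also have "sgn (u x) * u x = \<bar>u x\<bar>" by (simp add: sgn_if)
    finally show ?thesis by (simp add: split)
  qed
  show thesis
  proof (rule that)
    show "bounded_weight \<theta> 3"
      unfolding bounded_weight_def
    proof (intro conjI ballI impI)
      fix w assume w: "w \<in> E" and ew: "energy w \<le> 1"
      note wm [measurable] = space_measurable[OF w]
      have "(\<integral>\<^sup>+x. ennreal \<bar>\<theta> x * w x\<bar> \<partial>lebesgue)
        \<le> (\<integral>\<^sup>+x. ennreal (\<bar>u x\<bar> powr p) * V x + ennreal (\<bar>w x\<bar> powr p) * V x \<partial>lebesgue)"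
      proof (rule nn_integral_mono)
        fix x
        have "\<bar>\<theta> x * w x\<bar> \<le> enn2real (V x) * (\<bar>u x\<bar> powr (p - 1) * \<bar>w x\<bar>)"
          by (auto simp: \<theta>_def abs_mult sgn_if intro: mult_left_mono)
        also have "\<dots> \<le> enn2real (V x) * (\<bar>u x\<bar> powr p + \<bar>w x\<bar> powr p)"
          by (intro mult_left_mono powr_mult_le_add) auto
        finally have "ennreal \<bar>\<theta> x * w x\<bar> \<le> ennreal (enn2real (V x)) * (ennreal (\<bar>u x\<bar> powr p)
            + ennreal (\<bar>w x\<bar> powr p))"
          by (simp add: ennreal_mult'[symmetric] ennreal_leI flip: ennreal_plus)
        also have "\<dots> \<le> V x * (ennreal (\<bar>u x\<bar> powr p) + ennreal (\<bar>w x\<bar> powr p))"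
          by (intro mult_right_mono eVle) simp
        finally show "ennreal \<bar>\<theta> x * w x\<bar> \<le> ennreal (\<bar>u x\<bar> powr p) * V x + ennreal (\<bar>w x\<bar> powr p) * V x"
          by (simp add: distrib_left mult.commute)
      qed
      also have "\<dots> = 1 + (\<integral>\<^sup>+x. power_potential w x * power_potential u x \<partial>lebesgue)"
        by (subst nn_integral_add) (auto simp: uu sym[OF wm])
      also have "(\<integral>\<^sup>+x. power_potential w x * power_potential u x \<partial>lebesgue)
         \<le> (\<integral>\<^sup>+x. (power_potential w x)\<^sup>2 + (power_potential u x)\<^sup>2 \<partial>lebesgue)"
        by (intro nn_integral_mono ennreal_mult_le_power2_add)
      also have "\<dots> = energy w + energy u"
        unfolding coulomb_energy_eq by (rule nn_integral_add) measurable
      also have "1 + (energy w + energy u) \<le> 1 + (1 + 1)"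
        unfolding e1 by (intro add_mono ew order_refl)
      finally show "(\<integral>\<^sup>+x. ennreal \<bar>\<theta> x * w x\<bar> \<partial>lebesgue) \<le> ennreal 3" by (simp add: add_left_mono)
    qed (simp_all add: \<open>\<theta> \<in> borel_measurable lebesgue\<close>)
    have "AE x in lebesgue. ennreal (\<bar>u x\<bar> powr p) * V x \<noteq> \<infinity>"
      using uu by (intro nn_integral_PInf_AE) auto
    then have "AE x in lebesgue. ennreal (\<theta> x * u x) = ennreal (\<bar>u x\<bar> powr p) * V x"
    proof eventually_elim
      fix x assume fin: "ennreal (\<bar>u x\<bar> powr p) * V x \<noteq> \<infinity>"
      show "ennreal (\<theta> x * u x) = ennreal (\<bar>u x\<bar> powr p) * V x"
      proof (cases "u x = 0")
        case False
        then have "V x < top" using fin by (auto simp: ennreal_mult_eq_top_iff less_top)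
        then show ?thesis unfolding \<theta>u by (simp add: ennreal_mult' mult.commute)
      qed (use p in \<open>simp add: \<theta>u\<close>)
    qed
    then have "(\<integral>\<^sup>+x. ennreal (\<theta> x * u x) \<partial>lebesgue) = 1"
      unfolding uu[symmetric] by (rule nn_integral_cong_AE)
    moreover have "(\<integral>x. \<theta> x * u x \<partial>lebesgue) = enn2real (\<integral>\<^sup>+x. ennreal (\<theta> x * u x) \<partial>lebesgue)"
      by (rule integral_eq_nn_integral) (auto simp: \<theta>u)
    ultimately show "(\<integral>x. \<theta> x * u x \<partial>lebesgue) = 1" by simp
  qed
qed

text \<open>The functional is the derivative of the energy at the normalization of \<open>u\<close>, up to a factor, and
  zero when the energy of \<open>u\<close> vanishes.\<close>

lemma coulomb_norming_functional:
  assumes u: "u \<in> E"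
  obtains L where "linear_functional L" "\<And>w. w \<in> E \<Longrightarrow> \<bar>L w\<bar> \<le> 3 * coulomb_norm w" "L u = coulomb_norm u"
proof (cases "enn2real (energy u) = 0")
  case True
  show thesis
    by (rule that[of "\<lambda>w. 0"]) (use p True in \<open>auto simp: linear_functional_def coulomb_norm_def\<close>)
next
  case False
  let ?e = "enn2real (energy u)"
  have e: "0 < ?e" using False enn2real_nonneg[of "energy u"] by linarith
  define q where "q = coulomb_norm u"
  have q: "0 < q" using e by (simp add: q_def coulomb_norm_def)
  define U where "U x = (1 / q) * u x" for x
  have U: "U \<in> E" unfolding U_def[abs_def] by (rule space_scale[OF u])
  have "energy U = ennreal ((1 / q) powr (2 * p) * ?e)"
    unfolding U_def[abs_def] using q coulomb_energy_scale[OF space_measurable[OF u], of "1/q"]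
        energy_eq[OF u]
    by (simp add: ennreal_mult')
  also have "(1 / q) powr (2 * p) * ?e = 1"
  proof -
    have "q powr (2 * p) = ?e" using p e by (simp add: q_def coulomb_norm_def powr_powr)
    then show ?thesis using q e by (simp add: powr_divide)
  qed
  finally have "energy U = 1" by simp
  from normalized_coulomb_norming_weight[OF U this]
  obtain \<theta> where \<theta>: "bounded_weight \<theta> 3" "(\<integral>x. \<theta> x * U x \<partial>lebesgue) = 1" .
  note F = bounded_weight_functional[OF \<theta>(1)]
  have "(\<integral>x. \<theta> x * u x \<partial>lebesgue) = q * (\<integral>x. \<theta> x * U x \<partial>lebesgue)"
    using q by (simp add: U_def)
  then have "(\<integral>x. \<theta> x * u x \<partial>lebesgue) = coulomb_norm u" using \<theta>(2) by (simp add: q_def)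
  with F show thesis by (intro that[of "\<lambda>w. \<integral>x. \<theta> x * w x \<partial>lebesgue"])
qed

lemma gradient_inner_lincomb:
  assumes "u \<in> E" "v \<in> E" "w \<in> E"
  shows "(\<integral>x. weak_gradient u x \<bullet> weak_gradient (\<lambda>x. a * v x + b * w x) x \<partial>lebesgue)
    = a * (\<integral>x. weak_gradient u x \<bullet> weak_gradient v x \<partial>lebesgue)
        + b * (\<integral>x. weak_gradient u x \<bullet> weak_gradient w x \<partial>lebesgue)"
proof -
  note [measurable] = assms[THEN space_gradient_measurable] space_gradient_measurable[OF
      space_lincomb[OF assms(2,3), of a b]]
  have "(\<integral>x. weak_gradient u x \<bullet> weak_gradient (\<lambda>x. a * v x + b * w x) x \<partial>lebesgue)
    = (\<integral>x. a * (weak_gradient u x \<bullet> weak_gradient v x)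
        + b * (weak_gradient u x \<bullet> weak_gradient w x) \<partial>lebesgue)"
  proof (rule integral_cong_AE)
    show "AE x in lebesgue. weak_gradient u x \<bullet> weak_gradient (\<lambda>x. a * v x + b * w x) x
        = a * (weak_gradient u x \<bullet> weak_gradient v x) + b * (weak_gradient u x \<bullet> weak_gradient w x)"
      using weak_gradient_lincomb[OF assms(2,3)[THEN space_weakly_differentiable], of a b]
      by eventually_elim (simp add: inner_add_right)
  qed measurable
  also have "\<dots> = a * (\<integral>x. weak_gradient u x \<bullet> weak_gradient v x \<partial>lebesgue)
      + b * (\<integral>x. weak_gradient u x \<bullet> weak_gradient w x \<partial>lebesgue)"
    using gradient_inner_integrable assms by simp
  finally show ?thesis .
qed

lemma gradient_inner_le:
  assumes u: "u \<in> E" and w: "w \<in> E"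
  shows "2 * \<bar>\<integral>x. weak_gradient u x \<bullet> weak_gradient w x \<partial>lebesgue\<bar>
      \<le> gradient_energy u + gradient_energy w"
proof -
  have "2 * (\<integral>x. weak_gradient u x \<bullet> weak_gradient w x \<partial>lebesgue)
      \<le> gradient_energy u + gradient_energy w"
    using gradient_energy_diff_expand[OF u w] gradient_energy_nonneg[of "\<lambda>x. u x - w x"] by linarith
  moreover have "gradient_energy (\<lambda>x. (u x + w x) / 2) * 4
      = gradient_energy u + gradient_energy w
      + 2 * (\<integral>x. weak_gradient u x \<bullet> weak_gradient w x \<partial>lebesgue)"
    using gradient_energy_parallelogram[OF u w] gradient_energy_diff_expand[OF u w] by linarith
  then have "- (2 * (\<integral>x. weak_gradient u x \<bullet> weak_gradient w x \<partial>lebesgue))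
      \<le> gradient_energy u + gradient_energy w"
    using gradient_energy_nonneg[of "\<lambda>x. (u x + w x) / 2"] by linarith
  ultimately show ?thesis by linarith
qed

lemma gradient_energy_scale:
  assumes "u \<in> E" shows "gradient_energy (\<lambda>x. c * u x) = c\<^sup>2 * gradient_energy u"
  using gradient_energy_lincomb(3)[OF assms assms, of c 0]
  by (simp add: gradient_energy_def power_mult_distrib)

lemma gradient_norming_functional:
  assumes u: "u \<in> E"
  obtains L where "linear_functional L" "\<And>w. w \<in> E \<Longrightarrow> \<bar>L w\<bar> \<le> 3 * gradient_norm w" "L u = gradient_norm u"
proof (cases "gradient_energy u = 0")
  case True
  show thesis
    by (rule that[of "\<lambda>w. 0"]) (use True in \<open>auto simp: linear_functional_def gradient_norm_def
        gradient_energy_nonneg\<close>)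
next
  case False
  define d where "d = gradient_norm u"
  have d: "0 < d" "d\<^sup>2 = gradient_energy u" using False gradient_energy_nonneg[of u]
      by (auto simp: d_def gradient_norm_def)
  define U where "U x = (1 / d) * u x" for x
  have U: "U \<in> E" unfolding U_def[abs_def] by (rule space_scale[OF u])
  have eU: "gradient_energy U = 1"
    unfolding U_def[abs_def] gradient_energy_scale[OF u] d(2)[symmetric] using d(1)
        by (simp add: power_divide)
  let ?L = "\<lambda>w. \<integral>x. weak_gradient U x \<bullet> weak_gradient w x \<partial>lebesgue"
  have Lscale: "?L (\<lambda>x. c * v x) = c * ?L v" if "v \<in> E" for c v
    using gradient_inner_lincomb[OF U that that, of c 0] by simp
  show thesis
  proof (rule that[of ?L])
    show "linear_functional ?L"
      unfolding linear_functional_def using gradient_inner_lincomb[OF U, of _ _ 1 1] Lscale by simp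
    have "?L u = ?L (\<lambda>x. d * U x)" using d by (simp add: U_def)
    also have "\<dots> = d * ?L U" by (rule Lscale[OF U])
    also have "?L U = 1" using eU by (simp add: gradient_energy_def power2_norm_eq_inner)
    finally show "?L u = gradient_norm u" by (simp add: d_def)
    fix w assume w: "w \<in> E"
    have "\<bar>?L w\<bar> \<le> 3 * gradient_energy w powr (1 / 2)"
    proof (rule homogeneous_bound)
      fix t :: real assume t: "0 < t" "t powr 2 * gradient_energy w \<le> 1"
      then have "gradient_energy (\<lambda>x. t * w x)
          \<le> 1" by (simp add: gradient_energy_scale[OF w] powr_numeral)
      then have "2 * \<bar>?L (\<lambda>x. t * w x)\<bar> \<le> 2"
        using gradient_inner_le[OF U space_scale[OF w], of t] eU by simp
      then show "t * \<bar>?L w\<bar> \<le> 3" using t by (simp add: Lscale[OF w] abs_mult)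
    qed (auto simp: gradient_energy_nonneg)
    then show "\<bar>?L w\<bar> \<le> 3 * gradient_norm w"
      by (simp add: gradient_norm_def powr_half_sqrt gradient_energy_nonneg)
  qed
qed

section \<open>Weakly convergent sequences are bounded\<close>

text \<open>Absolutely convergent series of norming functionals are again continuous functionals, whose
  values along the sequence are bounded; the gliding hump then bounds the diagonal.\<close>

lemma weakly_converges_imp_seminorm_bounded:
  assumes u: "\<And>k. u k \<in> E" and weak: "coulomb_sobolev_weakly_converges \<alpha> p u v"
    and P: "\<And>w. w \<in> E \<Longrightarrow> P w \<le> coulomb_sobolev_norm \<alpha> p w"
    and norming: "\<And>w. w \<in> E \<Longrightarrow>
      \<exists>L. linear_functional L \<and> (\<forall>w\<in>E. \<bar>L w\<bar> \<le> 3 * P w) \<and> L w = P w"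
  shows "\<exists>B. \<forall>k. P (u k) \<le> B"
proof -
  have "\<forall>k. \<exists>L. linear_functional L \<and> (\<forall>w\<in>E. \<bar>L w\<bar> \<le> 3 * P w) \<and> L (u k) = P (u k)"
    using norming[OF u] by blast
  then obtain L where L: "\<And>k. linear_functional (L k)" "\<And>k w. w \<in> E \<Longrightarrow> \<bar>L k w\<bar> \<le> 3 * P w"
    "\<And>k. L k (u k) = P (u k)" by metis
  show ?thesis
  proof (rule gliding_hump[where a = "\<lambda>j k. L j (u k)"])
    fix n :: "nat \<Rightarrow> nat" and c :: "nat \<Rightarrow> real" assume c: "summable (\<lambda>m. \<bar>c m\<bar>)"
    have le: "norm (c m * L (n m) w) \<le> \<bar>c m\<bar> * (3 * P w)" if "w \<in> E" for w m
      unfolding real_norm_def abs_mult using L(2)[OF that] by (intro mult_left_mono) auto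
    have s: "summable (\<lambda>m. c m * L (n m) w)" if "w \<in> E" for w
      by (rule summable_comparison_test'[OF summable_mult2[OF c]]) (rule le[OF that])
    have "(\<lambda>w. \<Sum>m. c m * L (n m) w) \<in> coulomb_sobolev_dual \<alpha> p"
    proof (rule dualI)
      show "linear_functional (\<lambda>w. \<Sum>m. c m * L (n m) w)"
        unfolding linear_functional_def
      proof (intro conjI ballI allI)
        fix v w assume vw: "v \<in> E" "w \<in> E"
        show "(\<Sum>m. c m * L (n m) (\<lambda>x. v x + w x)) = (\<Sum>m. c m * L (n m) v) + (\<Sum>m. c m * L (n m) w)"
          using L(1) vw s[OF vw(1)] s[OF vw(2)]
              by (simp add: linear_functional_def distrib_left suminf_add)
        show "(\<Sum>m. c m * L (n m) (\<lambda>x. d * v x)) = d * (\<Sum>m. c m * L (n m) v)" for d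
          using L(1) vw s[OF vw(1)] by (simp add: linear_functional_def mult.left_commute suminf_mult)
      qed
      fix w assume w: "w \<in> E"
      have "\<bar>\<Sum>m. c m * L (n m) w\<bar> \<le> (\<Sum>m. \<bar>c m\<bar> * (3 * P w))"
        using norm_suminf_le[OF le[OF w] summable_mult2[OF c]] by simp
      also have "\<dots> = (\<Sum>m. \<bar>c m\<bar>) * 3 * P w" by (simp add: suminf_mult2[OF c, symmetric])
      also have "\<dots> \<le> (\<Sum>m. \<bar>c m\<bar>) * 3 * coulomb_sobolev_norm \<alpha> p w"
        using P[OF w] suminf_nonneg[OF c] by (intro mult_left_mono) auto
      finally show "\<bar>\<Sum>m. c m * L (n m) w\<bar> \<le> (\<Sum>m. \<bar>c m\<bar>) * 3 * coulomb_sobolev_norm \<alpha> p w" .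
    qed
    then have "(\<lambda>k. \<Sum>m. c m * L (n m) (u k)) \<longlonglongrightarrow> (\<Sum>m. c m * L (n m) v)"
      using weak by (auto simp: coulomb_sobolev_weakly_converges_def)
    from convergent_imp_Bseq[OF convergentI[OF this]]
    show "\<exists>B. \<forall>k. \<bar>\<Sum>m. c m * L (n m) (u k)\<bar> \<le> B" unfolding Bseq_def by auto
  qed (use L u in auto)
qed

theorem weakly_converges_imp_bounded:
  assumes u: "\<And>k. u k \<in> E" and weak: "coulomb_sobolev_weakly_converges \<alpha> p u v"
  shows "coulomb_sobolev_bounded \<alpha> p u"
proof -
  obtain B1 where B1: "\<And>k. gradient_norm (u k) \<le> B1"
    using weakly_converges_imp_seminorm_bounded[where P = gradient_norm, OF u weak seminorms_le_norm(1)]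
      gradient_norming_functional by metis
  obtain B2 where B2: "\<And>k. coulomb_norm (u k) \<le> B2"
    using weakly_converges_imp_seminorm_bounded[where P = coulomb_norm, OF u weak seminorms_le_norm(2)]
      coulomb_norming_functional by metis
  have "coulomb_sobolev_norm \<alpha> p (u k) \<le> B1 + B2" for k
    using seminorms_le_norm(3)[OF u, of k] B1[of k] B2[of k] by linarith
  then show ?thesis by (auto simp: coulomb_sobolev_bounded_def)
qed

section \<open>Weakly convergent sequences converge locally in the mean\<close>

lemma ball_indicator_bounded_weight:
  assumes R: "0 < R"
  obtains C where "bounded_weight (indicator (cball 0 R)) C"
proof -
  obtain C where C: "0 \<le> C" "\<And>u. u \<in> borel_measurable lebesgue \<Longrightarrow>
    (\<integral>\<^sup>+ y. indicator (cball 0 R) y * ennreal (\<bar>u y\<bar> powr p) \<partial>lebesgue)\<^sup>2 \<le> ennreal C * energy u"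
    by (rule coulomb_energy_controls_ball[OF R], rule that)
  define V where "V = measure lebesgue (cball (0 :: real ^ 'n) R)"
  have emV: "emeasure lebesgue (cball (0 :: real ^ 'n) R) = ennreal V"
    unfolding V_def by (rule emeasure_eq_ennreal_measure) (use cball_emeasure_finite[of "0::real^'n"
        R] in auto)
  show thesis
  proof (rule that[of "V + sqrt C"], unfold bounded_weight_def, intro conjI ballI impI)
    show "indicator (cball 0 R) \<in> borel_measurable (lebesgue :: (real ^ 'n) measure)" by measurable
    show "0 \<le> V + sqrt C" using C(1) by (simp add: V_def)
    fix w assume w: "w \<in> E" and ew: "energy w \<le> 1"
    note wm [measurable] = space_measurable[OF w]
    let ?I = "\<integral>\<^sup>+ y. indicator (cball 0 R) y * ennreal (\<bar>w y\<bar> powr p) \<partial>lebesgue"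
    have "?I\<^sup>2 \<le> ennreal C * 1" using C(2)[OF wm] ew by (meson mult_left_mono order_trans zero_le)
    then have I: "?I \<le> ennreal (sqrt C)"
    proof (cases ?I)
      case (real r)
      then show ?thesis using \<open>?I\<^sup>2 \<le> ennreal C * 1\<close> C(1) by (simp add: ennreal_power real_le_rsqrt)
    qed (simp add: power2_eq_square top_unique)
    have "(\<integral>\<^sup>+x. ennreal \<bar>indicator (cball 0 R) x * w x\<bar> \<partial>lebesgue)
      \<le> (\<integral>\<^sup>+x. indicator (cball 0 R) x + indicator (cball 0 R) x * ennreal (\<bar>w x\<bar> powr p) \<partial>lebesgue)"
    proof (rule nn_integral_mono)
      fix x
      have "\<bar>w x\<bar> \<le> 1 + \<bar>w x\<bar> powr p"
        using powr_mult_le_add[of 1 "\<bar>w x\<bar>"] by simp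
      then have "ennreal \<bar>w x\<bar> \<le> 1 + ennreal (\<bar>w x\<bar> powr p)"
        by (metis ennreal_1 ennreal_leI ennreal_plus powr_ge_zero zero_le_one)
      then show "ennreal \<bar>indicator (cball 0 R) x * w x\<bar>
          \<le> indicator (cball 0 R) x + indicator (cball 0 R) x * ennreal (\<bar>w x\<bar> powr p)"
        by (auto simp: indicator_def)
    qed
    also have "\<dots> = ennreal V + ?I"
      by (subst nn_integral_add) (auto simp: emV)
    also have "\<dots> \<le> ennreal V + ennreal (sqrt C)" by (intro add_left_mono I)
    also have "\<dots> = ennreal (V + sqrt C)" using C(1) by (simp add: V_def)
    finally show "(\<integral>\<^sup>+x. ennreal \<bar>indicator (cball 0 R) x * w x\<bar> \<partial>lebesgue) \<le> ennreal (V + sqrt C)" .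
  qed
qed

lemma ball_L1_le_coulomb_norm:
  assumes R: "0 < R"
  obtains C where "0 \<le> C" "\<And>w. w \<in> E \<Longrightarrow> ball_L1 R w \<le> C * coulomb_norm w"
proof -
  obtain C where C: "bounded_weight (indicator (cball 0 R)) C"
    using ball_indicator_bounded_weight[OF R] .
  have "ball_L1 R w \<le> C * coulomb_norm w" if "w \<in> E" for w
    using bounded_weight_integral(2)[OF C that]
    by (simp add: ball_L1_def set_lebesgue_integral_def abs_mult)
  then show thesis using that C unfolding bounded_weight_def by blast
qed

lemma gradient_ball_L1_le:
  assumes w: "w \<in> E"
  shows "ball_L1 R (weak_gradient w) \<le> measure lebesgue (cball (0 :: real ^ 'n) R) + gradient_energy w"
proof -
  have i: "integrable lebesgue (indicator (cball (0 :: real ^ 'n) R) :: _ \<Rightarrow> real)"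
    by (intro integrable_real_indicator cball_emeasure_finite) simp
  have "ball_L1 R (weak_gradient w) \<le> (\<integral>x. indicator (cball 0 R) x
      + (norm (weak_gradient w x))\<^sup>2 \<partial>lebesgue)"
    unfolding ball_L1_def set_lebesgue_integral_def real_scaleR_def
  proof (rule integral_mono)
    show "integrable lebesgue (\<lambda>x. indicator (cball 0 R) x + (norm (weak_gradient w x))\<^sup>2)"
      using i space_gradient_square_integrable[OF w] by auto
    fix x
    have "norm (weak_gradient w x) \<le> 1 + (norm (weak_gradient w x))\<^sup>2"
      using zero_le_power2[of "norm (weak_gradient w x) - 1/2"] by (simp add: power2_diff power_divide)
    then show "indicator (cball 0 R) x * norm (weak_gradient w x)
        \<le> indicator (cball 0 R) x + (norm (weak_gradient w x))\<^sup>2"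
      by (auto simp: indicator_def)
  qed (rule locally_integrable_ball_norm[OF space_locally_integrable(2)[OF w]])
  also have "\<dots> = measure lebesgue (cball (0 :: real ^ 'n) R) + gradient_energy w"
    using i space_gradient_square_integrable[OF w] by (simp add: gradient_energy_def)
  finally show ?thesis .
qed

text \<open>At a fixed scale \<open>\<epsilon>\<close> the averages of a weakly null sequence tend to zero pointwise and
  boundedly, since an average is a continuous functional.\<close>

lemma ball_averages_tendsto_0:
  assumes w: "\<And>n. w n \<in> E" and null: "\<And>L. L \<in> coulomb_sobolev_dual \<alpha> p \<Longrightarrow> (\<lambda>n. L (w n)) \<longlonglongrightarrow> 0"
    and B: "\<And>n. coulomb_norm (w n) \<le> B" and \<epsilon>: "0 < \<epsilon>" and R: "0 \<le> R"
  shows "(\<lambda>n. \<integral>\<^sup>+x. indicator (cball 0 R) x * ennreal \<bar>ball_average \<epsilon> (w n) x\<bar> \<partial>lebesgue) \<longlonglongrightarrow> 0"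
proof -
  let ?V = "measure lebesgue (cball (0 :: real ^ 'n) \<epsilon>)"
  have V: "0 < ?V" by (rule measure_cball_pos[OF \<epsilon>])
  have R': "0 < R + \<epsilon>" using R \<epsilon> by simp
  obtain C where C: "0 \<le> C" "\<And>w. w \<in> E \<Longrightarrow> ball_L1 (R + \<epsilon>) w \<le> C * coulomb_norm w"
    by (rule ball_L1_le_coulomb_norm[OF R'], rule that)
  note [measurable] = ball_average_measurable[OF space_measurable[OF w]]
  have bd: "\<bar>ball_average \<epsilon> (w n) x\<bar> \<le> C * B / ?V" if "norm x \<le> R" for n x
  proof -
    have "\<bar>\<integral>y. w n y * indicator (cball x \<epsilon>) y \<partial>lebesgue\<bar> \<le> 1 * ball_L1 (R + \<epsilon>) (w n)"
    proof (rule locally_integrable_times_bounded(2)[OF space_locally_integrable(1)[OF w]])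
      show "indicator (cball x \<epsilon>) y = (0::real)" if "R + \<epsilon> < norm y" for y
        using that \<open>norm x \<le> R\<close> norm_triangle_ineq2[of y x]
            by (auto simp: indicator_def dist_norm norm_minus_commute)
      show "indicator (cball x \<epsilon>) \<in> borel_measurable (lebesgue :: (real ^ 'n) measure)" by measurable
    qed (auto simp: indicator_def)
    also have "1 * ball_L1 (R + \<epsilon>) (w n) \<le> C * B"
      using C(2)[OF w, of n] mult_left_mono[OF B C(1), of n] by linarith
    finally show ?thesis using V by (simp add: ball_average_def divide_right_mono mult.commute)
  qed
  have pt: "(\<lambda>n. ball_average \<epsilon> (w n) x) \<longlonglongrightarrow> 0" for x
  proof -
    have S: "0 < norm x + \<epsilon>" using \<epsilon> norm_ge_zero[of x] by linarith
    obtain C' where C': "bounded_weight (indicator (cball 0 (norm x + \<epsilon>))) C'"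
      using ball_indicator_bounded_weight[OF S] .
    then have C'0: "0 \<le> C'" by (simp add: bounded_weight_def)
    have bound: "(\<integral>\<^sup>+y. ennreal \<bar>indicator (cball x \<epsilon>) y * w y\<bar> \<partial>lebesgue)
        \<le> ennreal C'" if "w \<in> E" "energy w \<le> 1" for w
    proof -
      have "(\<integral>\<^sup>+y. ennreal \<bar>indicator (cball x \<epsilon>) y * w y\<bar> \<partial>lebesgue)
        \<le> (\<integral>\<^sup>+y. ennreal \<bar>indicator (cball 0 (norm x + \<epsilon>)) y * w y\<bar> \<partial>lebesgue)"
      proof (rule nn_integral_mono)
        fix y
        have "y \<in> cball 0 (norm x + \<epsilon>)" if "y \<in> cball x \<epsilon>"
          using that norm_triangle_ineq2[of y x] by (auto simp: dist_norm norm_minus_commute)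
        then show "ennreal \<bar>indicator (cball x \<epsilon>) y * w y\<bar>
            \<le> ennreal \<bar>indicator (cball 0 (norm x + \<epsilon>)) y * w y\<bar>"
          by (auto simp: indicator_def)
      qed
      also have "\<dots> \<le> ennreal C'" using C' that by (simp add: bounded_weight_def)
      finally show ?thesis .
    qed
    have m: "indicator (cball x \<epsilon>) \<in> borel_measurable (lebesgue :: (real ^ 'n) measure)" by measurable
    have "bounded_weight (indicator (cball x \<epsilon>)) C'"
      unfolding bounded_weight_def using m C'0 bound by blast
    note F = bounded_weight_functional[OF this]
    have "(\<lambda>w. \<integral>y. indicator (cball x \<epsilon>) y * w y \<partial>lebesgue) \<in> coulomb_sobolev_dual \<alpha> p"
    proof (rule dualI[OF F(1)])
      show "\<bar>\<integral>y. indicator (cball x \<epsilon>) y * w y \<partial>lebesgue\<bar>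
          \<le> C' * coulomb_sobolev_norm \<alpha> p w" if "w \<in> E" for w
        using F(2)[OF that] mult_left_mono[OF seminorms_le_norm(2)[OF that] C'0] by linarith
    qed
    from tendsto_divide[OF null[OF this] tendsto_const, of ?V] V
    show ?thesis by (simp add: ball_average_def)
  qed
  have "(\<lambda>n. \<integral>\<^sup>+x. indicator (cball 0 R) x * ennreal \<bar>ball_average \<epsilon> (w n) x\<bar> \<partial>lebesgue)
      \<longlonglongrightarrow> (\<integral>\<^sup>+x. 0 \<partial>(lebesgue :: (real ^ 'n) measure))"
  proof (rule nn_integral_dominated_convergence[where w
      = "\<lambda>x. indicator (cball 0 R) x * ennreal (C * B / ?V)"])
    show "(\<integral>\<^sup>+x. indicator (cball (0 :: real ^ 'n) R) x * ennreal (C * B / ?V) \<partial>lebesgue) < \<infinity>"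
      by (subst nn_integral_multc) (use cball_emeasure_finite[of "0 :: real ^ 'n" R] in \<open>auto simp:
          ennreal_mult_less_top\<close>)
    show "AE x in lebesgue. indicator (cball 0 R) x * ennreal \<bar>ball_average \<epsilon> (w n) x\<bar>
        \<le> indicator (cball 0 R) x * ennreal (C * B / ?V)" for n
      using bd by (intro AE_I2) (auto simp: indicator_def intro: ennreal_leI)
    show "AE x in lebesgue. (\<lambda>n. indicator (cball 0 R) x * ennreal \<bar>ball_average \<epsilon> (w n) x\<bar>) \<longlonglongrightarrow> 0"
    proof (rule AE_I2)
      fix x
      have "(\<lambda>n. ennreal \<bar>ball_average \<epsilon> (w n) x\<bar>) \<longlonglongrightarrow> ennreal \<bar>0\<bar>"
        by (intro tendsto_ennrealI tendsto_rabs pt)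
      then show "(\<lambda>n. indicator (cball 0 R) x * ennreal \<bar>ball_average \<epsilon> (w n) x\<bar>) \<longlonglongrightarrow> 0"
        by (auto simp: indicator_def)
    qed
  qed measurable
  then show ?thesis by simp
qed

text \<open>Choose the scale of the averages first, so that the gradient bound makes them close to the
  functions uniformly along the sequence, and then go far enough along the sequence.\<close>

theorem weakly_converges_imp_L1_loc:
  assumes u: "\<And>k. u k \<in> E" and v: "v \<in> E"
    and weak: "coulomb_sobolev_weakly_converges \<alpha> p u v"
  shows "converges_L1_loc u v"
proof -
  let ?w = "\<lambda>k x. u k x - v x"
  have w: "?w k \<in> E" for k by (rule space_diff[OF u v])
  obtain B where B: "\<And>k. gradient_energy (?w k) \<le> B" "\<And>k. enn2real (energy (?w k)) \<le> B"
    by (rule diff_energies_bounded[OF u v weakly_converges_imp_bounded[OF u weak]], rule that)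
  have cB: "coulomb_norm (?w k) \<le> B powr (1 / (2 * p))" for k
    unfolding coulomb_norm_def using B(2) p by (intro powr_mono2) auto
  have null: "(\<lambda>k. L (?w k)) \<longlonglongrightarrow> 0" if "L \<in> coulomb_sobolev_dual \<alpha> p" for L
  proof -
    have "(\<lambda>k. L (u k)) \<longlonglongrightarrow> L v" using weak that by (auto simp: coulomb_sobolev_weakly_converges_def)
    then have "(\<lambda>k. L (u k) - L v) \<longlonglongrightarrow> 0" by (rule LIM_zero)
    then show ?thesis by (simp add: dual_diff[OF that u v])
  qed
  have "(\<lambda>k. ball_L1 R (?w k)) \<longlonglongrightarrow> 0" for R
  proof (cases "0 \<le> R")
    case False
    then show ?thesis by (simp add: ball_L1_def set_lebesgue_integral_def)
  next
    case R: True
    show ?thesis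
    proof (rule LIMSEQ_I)
      fix e :: real assume e: "0 < e"
      define G where "G = measure lebesgue (cball (0 :: real ^ 'n) (R + 2)) + B"
      have B0: "0 \<le> B" using B(1)[of 0] gradient_energy_nonneg[of "?w 0"] by linarith
      have G0: "0 \<le> G" using B0 by (simp add: G_def)
      have G: "ball_L1 (R + 2) (weak_gradient (?w k)) \<le> G" for k
        using gradient_ball_L1_le[OF w, of "R + 2" k] B(1)[of k] by (simp add: G_def)
      define q where "q = G + 1"
      have q: "0 < q" "G \<le> q" using G0 by (auto simp: q_def)
      define \<epsilon> where "\<epsilon> = min 1 (e / 8 / q)"
      have \<epsilon>: "0 < \<epsilon>" "\<epsilon> \<le> 1" using e q by (auto simp: \<epsilon>_def)
      have "\<epsilon> * G \<le> e / 8 / q * q"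
        using G0 e q by (intro mult_mono) (auto simp: \<epsilon>_def)
      also have "\<dots> = e / 8" using q by simp
      finally have \<epsilon>G: "2 * \<epsilon> * G \<le> e / 4" by simp
      let ?A = "\<lambda>k. \<integral>\<^sup>+x. indicator (cball 0 R) x * ennreal \<bar>ball_average \<epsilon> (?w k) x\<bar> \<partial>lebesgue"
      have "?A \<longlonglongrightarrow> 0" by (rule ball_averages_tendsto_0[where w = ?w, OF w null cB \<epsilon>(1) R])
      then have "\<forall>\<^sub>F k in sequentially. ?A k < ennreal (e / 4)"
        using e by (intro order_tendstoD(2)) auto
      then obtain K where K: "\<And>k. K \<le> k \<Longrightarrow> ?A k < ennreal (e / 4)" by (auto simp: eventually_sequentially)
      have half: "ball_L1 R (?w k) \<le> e / 2" if "K \<le> k" for k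
      proof -
        note [measurable] = space_measurable[OF w, of k] ball_average_measurable[OF
            space_measurable[OF w, of k], of \<epsilon>]
        have "ennreal (ball_L1 R (?w k)) = (\<integral>\<^sup>+x. indicator (cball 0 R) x * ennreal (norm (?w k x))
            \<partial>lebesgue)"
          by (rule ball_L1_nn_integral[OF space_locally_integrable(1)[OF w]])
        also have "\<dots> \<le> (\<integral>\<^sup>+x. indicator (cball 0 R) x * ennreal \<bar>?w k x - ball_average \<epsilon> (?w k) x\<bar>
            + indicator (cball 0 R) x * ennreal \<bar>ball_average \<epsilon> (?w k) x\<bar> \<partial>lebesgue)"
        proof (rule nn_integral_mono)
          fix x
          have "ennreal \<bar>?w k x\<bar> \<le> ennreal (\<bar>?w k x - ball_average \<epsilon> (?w k) x\<bar>
              + \<bar>ball_average \<epsilon> (?w k) x\<bar>)"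
            by (intro ennreal_leI) linarith
          then show "indicator (cball 0 R) x * ennreal (norm (?w k x))
              \<le> indicator (cball 0 R) x * ennreal \<bar>?w k x - ball_average \<epsilon> (?w k) x\<bar>
            + indicator (cball 0 R) x * ennreal \<bar>ball_average \<epsilon> (?w k) x\<bar>"
            by (auto simp: indicator_def)
        qed
        also have "\<dots> = (\<integral>\<^sup>+x. indicator (cball 0 R) x * ennreal \<bar>?w k x - ball_average \<epsilon> (?w k) x\<bar>
            \<partial>lebesgue) + ?A k"
          by (rule nn_integral_add) measurable
        also have "\<dots> \<le> ennreal (2 * \<epsilon> * ball_L1 (R + 2) (weak_gradient (?w k))) + ennreal (e / 4)"
          using K[OF that] by (intro add_mono ball_average_estimate[OF space_has_weak_gradient[OF w]
              \<epsilon> R]) auto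
        also have "\<dots> \<le> ennreal (e / 4) + ennreal (e / 4)"
        proof (intro add_right_mono ennreal_leI)
          show "2 * \<epsilon> * ball_L1 (R + 2) (weak_gradient (?w k)) \<le> e / 4"
            using mult_left_mono[OF G[of k], of "2 * \<epsilon>"] \<epsilon> \<epsilon>G by linarith
        qed
        also have "\<dots> = ennreal (e / 2)" using e by (simp flip: ennreal_plus)
        finally show ?thesis using e by (subst (asm) ennreal_le_iff) auto
      qed
      then show "\<exists>K. \<forall>k\<ge>K. norm (ball_L1 R (?w k) - 0) < e"
      proof (intro exI allI impI)
        fix k assume "K \<le> k"
        then show "norm (ball_L1 R (?w k) - 0) < e"
          using half[of k] ball_L1_nonneg[of R "?w k"] e by simp
      qed
    qed
  qed
  then show ?thesis
    using converges_L1_loc_iff_balls[where u=u and v=v, OF space_locally_integrable(1)[OF u]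
        space_locally_integrable(1)[OF v]] by blast
qed

end

theorem proposition2p10:
  fixes \<alpha> p :: real
    and u :: "nat \<Rightarrow> real ^ 'n \<Rightarrow> real"
    and v :: "real ^ 'n \<Rightarrow> real"
  assumes "0 < \<alpha>" and "\<alpha> < real CARD('n)"
    and "1 < p"
    and "\<And>k. u k \<in> coulomb_sobolev \<alpha> p"
    and "v \<in> coulomb_sobolev \<alpha> p"
  shows "coulomb_sobolev_weakly_converges \<alpha> p u v \<longleftrightarrow>
         coulomb_sobolev_bounded \<alpha> p u \<and> converges_L1_loc u v"
proof -
  interpret coulomb_exponents \<alpha> p "TYPE('n)"
    by unfold_locales (use assms in auto)
  show ?thesis
    using bounded_L1_loc_imp_weakly_converges[where u=u and v=v, OF assms(4,5)]
        weakly_converges_imp_bounded[where u=u and v=v, OF assms(4)]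
      weakly_converges_imp_L1_loc[where u=u and v=v, OF assms(4,5)] by blast
qed

end
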